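(* Let $p$ be a prime and $n\ge1$ an integer. If $\tau>1+1/n$, then $\dim W^*_{\tau,n}(p)=\frac{n+1}{\tau}$. Furthermore, $W^*_{\tau,n}(p)\cap\mathbb{Z}_p^n=\emptyset$ as soon as $\tau\ge1$.
   Context: $\mathbb{Q}_p$ denotes the $p$-adic numbers and $\mathbb{Z}_p$ the $p$-adic integers. For $\bm{x}\in\mathbb{Q}_p^n$, $|\bm{x}|_p$ is the maximum of the $p$-adic absolute values of its components; for $\bm{r}\in\mathbb{Z}^n$, $|\bm{r}|$ is the maximum of the real absolute values of its components. Hausdorff dimension on $\mathbb{Q}_p^n$ is taken with respect to the metric induced by $|\cdot|_p$. For $\tau>0$, $W^*_{\tau,n}(p)$ is the set of $\bm{x}\in\mathbb{Q}_p^n$ such that $|q\bm{x}-\bm{r}|_p<\max(|\bm{r}|,q)^{-\tau}$ holds for infinitely many $(\bm{r},q)\in\mathbb{Z}^n\times p\mathbb{N}$ (i.e. with $p\mid q$) and for only finitely many $(\bm{r},q)\in\mathbb{Z}^n\times\mathbb{N}$ with $p\nmid q$. *)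

theory Defs
  imports "HOL-Analysis.Analysis" "HOL-Algebra.QuotRing"
    "HOL-Computational_Algebra.Primes"
begin

definition padic_abs :: "nat \<Rightarrow> rat \<Rightarrow> real" where
  "padic_abs p x = (if x = 0 then 0
     else real p powi (int (multiplicity (int p) (snd (quotient_of x)))
                       - int (multiplicity (int p) (fst (quotient_of x)))))"

lemma padic_abs_zero [simp]: "padic_abs p 0 = 0"
  by (simp add: padic_abs_def)

lemma padic_abs_fract:
  assumes p: "prime p" and a: "a \<noteq> 0" and b: "b \<noteq> 0"
  shows "padic_abs p (of_int a / of_int b) =
    real p powi (int (multiplicity (int p) b) - int (multiplicity (int p) a))"
proof -
  have pp: "prime_elem (int p)" using p by simp
  obtain u v where uv: "quotient_of (of_int a / of_int b) = (u, v)" by fastforce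
  have v: "v > 0" using quotient_of_denom_pos[OF uv] .
  have e: "(of_int a / of_int b :: rat) = of_int u / of_int v" using quotient_of_div[OF uv] .
  have "(of_int (a * v) :: rat) = of_int (u * b)" using e b v by (simp add: field_simps)
  then have av: "a * v = u * b" by (simp only: of_int_eq_iff)
  have u: "u \<noteq> 0" using av a v by auto
  have "multiplicity (int p) (a * v) = multiplicity (int p) a + multiplicity (int p) v"
    using prime_elem_multiplicity_mult_distrib[OF pp a, of v] v by simp
  moreover have "multiplicity (int p) (u * b) = multiplicity (int p) u + multiplicity (int p) b"
    using prime_elem_multiplicity_mult_distrib[OF pp u b] .
  ultimately have "multiplicity (int p) a + multiplicity (int p) v
      = multiplicity (int p) u + multiplicity (int p) b" using av by simp
  then have "int (multiplicity (int p) v) - int (multiplicity (int p) u)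
      = int (multiplicity (int p) b) - int (multiplicity (int p) a)" by linarith
  then show ?thesis using a b uv by (simp add: padic_abs_def)
qed

lemma rat_fractE:
  fixes x :: rat
  obtains a b where "x = of_int a / of_int b" "b \<noteq> 0"
proof -
  obtain u v where uv: "quotient_of x = (u, v)" by fastforce
  show ?thesis using that[OF quotient_of_div[OF uv]] quotient_of_denom_pos[OF uv] by simp
qed

lemma padic_abs_pos: "prime p \<Longrightarrow> x \<noteq> 0 \<Longrightarrow> padic_abs p x > 0"
  by (simp add: padic_abs_def prime_gt_0_nat)

lemma padic_abs_nonneg [simp]: "padic_abs p x \<ge> 0"
  by (simp add: padic_abs_def)

lemma padic_abs_eq_0_iff: "prime p \<Longrightarrow> padic_abs p x = 0 \<longleftrightarrow> x = 0"
  using padic_abs_pos[of p x] by (cases "x = 0") auto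

lemma padic_abs_mult:
  assumes p: "prime p"
  shows "padic_abs p (x * y) = padic_abs p x * padic_abs p y"
proof (cases "x = 0 \<or> y = 0")
  case True
  then show ?thesis by auto
next
  case False
  obtain a b where x: "x = of_int a / of_int b" and b: "b \<noteq> 0" by (rule rat_fractE)
  obtain c d where y: "y = of_int c / of_int d" and d: "d \<noteq> 0" by (rule rat_fractE)
  have a: "a \<noteq> 0" and c: "c \<noteq> 0" using False x y by auto
  have pp: "prime_elem (int p)" and p0: "real p \<noteq> 0" using p by auto
  have xy: "x * y = of_int (a * c) / of_int (b * d)" by (simp add: x y)
  have "padic_abs p (x * y) = real p powi
      (int (multiplicity (int p) (b * d)) - int (multiplicity (int p) (a * c)))"
    unfolding xy using a b c d by (intro padic_abs_fract p) auto
  also have "int (multiplicity (int p) (b * d)) - int (multiplicity (int p) (a * c)) =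
     (int (multiplicity (int p) b) - int (multiplicity (int p) a)) +
     (int (multiplicity (int p) d) - int (multiplicity (int p) c))"
    using prime_elem_multiplicity_mult_distrib[OF pp a c]
      prime_elem_multiplicity_mult_distrib[OF pp b d] by simp
  also have "real p powi \<dots> = padic_abs p x * padic_abs p y"
    unfolding x y padic_abs_fract[OF p a b] padic_abs_fract[OF p c d]
    by (rule power_int_add) (use p0 in simp)
  finally show ?thesis .
qed

lemma padic_abs_one [simp]: "prime p \<Longrightarrow> padic_abs p 1 = 1"
  using padic_abs_fract[of p 1 1] by simp

lemma padic_abs_minus [simp]: "padic_abs p (- x) = padic_abs p x"
  by (simp add: padic_abs_def rat_uminus_code split: prod.splits)
    (metis normalize_int_def abs_minus_cancel multiplicity_normalize_right)

lemma padic_abs_diff_commute: "padic_abs p (x - y) = padic_abs p (y - x)"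
  using padic_abs_minus[of p "x - y"] by simp

lemma padic_abs_of_int:
  "prime p \<Longrightarrow> a \<noteq> 0 \<Longrightarrow> padic_abs p (of_int a) = real p powi (- int (multiplicity (int p) a))"
  using padic_abs_fract[of p a 1] by simp

lemma padic_abs_of_int_le_1:
  assumes p: "prime p" shows "padic_abs p (of_int a) \<le> 1"
proof (cases "a = 0")
  case False
  have "real p ^ multiplicity (int p) a \<ge> 1" using prime_ge_1_nat[OF p] by simp
  then show ?thesis
    by (simp add: padic_abs_of_int[OF p False] power_int_minus divide_simps)
qed simp

lemma padic_abs_inverse:
  assumes p: "prime p" shows "padic_abs p (inverse x) = inverse (padic_abs p x)"
proof (cases "x = 0")
  case False
  then have "padic_abs p (inverse x) * padic_abs p x = 1"
    using padic_abs_mult[OF p, of "inverse x" x] p by simp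
  then show ?thesis by (metis inverse_unique mult.commute)
qed simp

lemma padic_abs_one_add_le:
  assumes p: "prime p" and z: "padic_abs p z \<le> 1"
  shows "padic_abs p (1 + z) \<le> 1"
proof (cases "z = 0 \<or> 1 + z = 0")
  case True
  then show ?thesis using p by auto
next
  case False
  obtain a b where zz: "z = of_int a / of_int b" and b: "b \<noteq> 0" by (rule rat_fractE)
  have a: "a \<noteq> 0" using False zz by auto
  have s: "1 + z = of_int (a + b) / of_int b" using b by (simp add: zz field_simps)
  have ab: "a + b \<noteq> 0" using False s by auto
  have p1: "real p > 1" using prime_gt_1_nat[OF p] by simp
  have iff: "real p powi k \<le> 1 \<longleftrightarrow> k \<le> 0" for k
    using p1 power_int_strict_increasing[of 0 k "real p"] power_int_increasing[of k 0 "real p"]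
    by (cases "k \<le> 0") auto
  have "multiplicity (int p) b \<le> multiplicity (int p) a"
    using z unfolding zz padic_abs_fract[OF p a b] iff by simp
  then have "int p ^ multiplicity (int p) b dvd a" by (simp add: multiplicity_dvd')
  then have "int p ^ multiplicity (int p) b dvd a + b" by (simp add: multiplicity_dvd)
  then have "multiplicity (int p) b \<le> multiplicity (int p) (a + b)"
    using ab p prime_gt_1_nat[OF p] by (intro multiplicity_geI) auto
  then show ?thesis unfolding s padic_abs_fract[OF p ab b] iff by simp
qed

lemma padic_abs_add_le:
  assumes p: "prime p"
  shows "padic_abs p (x + y) \<le> max (padic_abs p x) (padic_abs p y)"
proof -
  have main: "padic_abs p (x + y) \<le> padic_abs p x" if le: "padic_abs p y \<le> padic_abs p x" for x y
  proof (cases "x = 0")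
    case True
    then show ?thesis using le padic_abs_eq_0_iff[OF p, of y] padic_abs_nonneg[of p y] by simp
  next
    case False
    have x: "padic_abs p x > 0" using False p by (simp add: padic_abs_pos)
    have "padic_abs p (y / x) = padic_abs p y / padic_abs p x"
      by (simp add: divide_inverse padic_abs_mult[OF p] padic_abs_inverse[OF p])
    then have "padic_abs p (y / x) \<le> 1" using le x by simp
    then have "padic_abs p x * padic_abs p (1 + y / x) \<le> padic_abs p x * 1"
      using x by (intro mult_left_mono padic_abs_one_add_le p) auto
    moreover have "x + y = x * (1 + y / x)" using False by (simp add: field_simps)
    ultimately show ?thesis by (simp add: padic_abs_mult[OF p])
  qed
  show ?thesis
    using main[of x y] main[of y x] by (cases "padic_abs p y \<le> padic_abs p x") (auto simp: add.commute)
qed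

lemma padic_abs_diff_le:
  "prime p \<Longrightarrow> padic_abs p (x - y) \<le> max (padic_abs p x) (padic_abs p y)"
  using padic_abs_add_le[of p x "- y"] by simp

lemma padic_abs_abs_diff_le:
  assumes "prime p" shows "\<bar>padic_abs p x - padic_abs p y\<bar> \<le> padic_abs p (x - y)"
proof -
  have "padic_abs p x \<le> padic_abs p (x - y) + padic_abs p y" for x y
  proof -
    have "padic_abs p x \<le> max (padic_abs p (x - y)) (padic_abs p y)"
      using padic_abs_add_le[OF assms, of "x - y" y] by simp
    with padic_abs_nonneg[of p y] padic_abs_nonneg[of p "x - y"] show ?thesis by linarith
  qed
  from this[of x y] this[of y x] show ?thesis
    using padic_abs_diff_commute[of p x y] by linarith
qed


text \<open>The completion of the rationals with respect to the \<open>p\<close>-adic absolute value: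
  \<open>p\<close>-adic Cauchy sequences of rationals modulo null sequences.\<close>

definition padic_Cauchy :: "nat \<Rightarrow> (nat \<Rightarrow> rat) \<Rightarrow> bool" where
  "padic_Cauchy p f \<longleftrightarrow> (\<forall>e>0. \<exists>N. \<forall>i\<ge>N. \<forall>j\<ge>N. padic_abs p (f i - f j) < e)"

definition padic_Cauchy_ring :: "nat \<Rightarrow> (nat \<Rightarrow> rat) ring" where
  "padic_Cauchy_ring p = \<lparr>carrier = {f. padic_Cauchy p f},
     monoid.mult = (\<lambda>f g k. f k * g k), one = (\<lambda>k. 1),
     zero = (\<lambda>k. 0), add = (\<lambda>f g k. f k + g k)\<rparr>"

definition padic_null :: "nat \<Rightarrow> (nat \<Rightarrow> rat) set" where
  "padic_null p = {f. (\<lambda>k. padic_abs p (f k)) \<longlonglongrightarrow> 0}"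

definition Qp :: "nat \<Rightarrow> (nat \<Rightarrow> rat) set ring" where
  "Qp p = padic_Cauchy_ring p Quot padic_null p"

definition padic_norm :: "nat \<Rightarrow> (nat \<Rightarrow> rat) set \<Rightarrow> real" where
  "padic_norm p X = lim (\<lambda>k. padic_abs p ((SOME f. f \<in> X) k))"

definition Zp :: "nat \<Rightarrow> (nat \<Rightarrow> rat) set set" where
  "Zp p = {X \<in> carrier (Qp p). padic_norm p X \<le> 1}"

context
  fixes p :: nat
  assumes p: "prime p"
begin

lemma padic_null_iff:
  "f \<in> padic_null p \<longleftrightarrow> (\<forall>e>0. \<exists>N. \<forall>i\<ge>N. padic_abs p (f i) < e)"
  by (simp add: padic_null_def LIMSEQ_iff)

lemma padic_Cauchy_const: "padic_Cauchy p (\<lambda>_. c)"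
  by (simp add: padic_Cauchy_def)

lemma padic_Cauchy_add:
  assumes "padic_Cauchy p f" "padic_Cauchy p g"
  shows "padic_Cauchy p (\<lambda>k. f k + g k)"
  unfolding padic_Cauchy_def
proof (intro allI impI)
  fix e :: real assume e: "e > 0"
  obtain N1 where N1: "\<And>i j. i \<ge> N1 \<Longrightarrow> j \<ge> N1 \<Longrightarrow> padic_abs p (f i - f j) < e"
    using assms(1) e unfolding padic_Cauchy_def by blast
  obtain N2 where N2: "\<And>i j. i \<ge> N2 \<Longrightarrow> j \<ge> N2 \<Longrightarrow> padic_abs p (g i - g j) < e"
    using assms(2) e unfolding padic_Cauchy_def by blast
  have "padic_abs p (f i + g i - (f j + g j)) < e"
    if "i \<ge> max N1 N2" "j \<ge> max N1 N2" for i j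
    using padic_abs_add_le[OF p, of "f i - f j" "g i - g j"] N1[of i j] N2[of i j] that
    by (auto simp: algebra_simps)
  then show "\<exists>N. \<forall>i\<ge>N. \<forall>j\<ge>N. padic_abs p (f i + g i - (f j + g j)) < e"
    by (intro exI[of _ "max N1 N2"] allI impI)
qed

lemma padic_Cauchy_minus: "padic_Cauchy p f \<Longrightarrow> padic_Cauchy p (\<lambda>k. - f k)"
proof -
  have "padic_abs p (- f i - - f j) = padic_abs p (f i - f j)" for i j
    using padic_abs_diff_commute[of p "f j" "f i"] by simp
  then show "padic_Cauchy p f \<Longrightarrow> padic_Cauchy p (\<lambda>k. - f k)"
    by (simp add: padic_Cauchy_def)
qed

lemma padic_Cauchy_abs_Cauchy:
  assumes "padic_Cauchy p f" shows "Cauchy (\<lambda>k. padic_abs p (f k))"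
  unfolding Cauchy_def dist_real_def
proof (intro allI impI)
  fix e :: real assume "e > 0"
  then obtain N where "\<And>i j. i \<ge> N \<Longrightarrow> j \<ge> N \<Longrightarrow> padic_abs p (f i - f j) < e"
    using assms unfolding padic_Cauchy_def by blast
  then show "\<exists>M. \<forall>m\<ge>M. \<forall>n\<ge>M. \<bar>padic_abs p (f m) - padic_abs p (f n)\<bar> < e"
    by (intro exI[of _ N] allI impI le_less_trans[OF padic_abs_abs_diff_le[OF p]])
qed

lemma padic_Cauchy_bounded:
  assumes "padic_Cauchy p f" obtains B where "B > 0" "\<And>k. padic_abs p (f k) \<le> B"
proof -
  have "Bseq (\<lambda>k. padic_abs p (f k))"
    using padic_Cauchy_abs_Cauchy[OF assms] Cauchy_Bseq by blast
  then obtain K where "K > 0" "\<forall>k. norm (padic_abs p (f k)) \<le> K" by (rule BseqE)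
  then show ?thesis using that[of K] by simp
qed

lemma padic_Cauchy_mult:
  assumes f: "padic_Cauchy p f" and g: "padic_Cauchy p g"
  shows "padic_Cauchy p (\<lambda>k. f k * g k)"
  unfolding padic_Cauchy_def
proof (intro allI impI)
  fix e :: real assume e: "e > 0"
  obtain A where A: "A > 0" "\<And>k. padic_abs p (f k) \<le> A" using padic_Cauchy_bounded[OF f] by blast
  obtain B where B: "B > 0" "\<And>k. padic_abs p (g k) \<le> B" using padic_Cauchy_bounded[OF g] by blast
  obtain N1 where N1: "\<And>i j. i \<ge> N1 \<Longrightarrow> j \<ge> N1 \<Longrightarrow> padic_abs p (f i - f j) < e / B"
    using f divide_pos_pos[OF e B(1)] unfolding padic_Cauchy_def by blast
  obtain N2 where N2: "\<And>i j. i \<ge> N2 \<Longrightarrow> j \<ge> N2 \<Longrightarrow> padic_abs p (g i - g j) < e / A"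
    using g divide_pos_pos[OF e A(1)] unfolding padic_Cauchy_def by blast
  have "padic_abs p (f i * g i - f j * g j) < e"
    if ij: "i \<ge> max N1 N2" "j \<ge> max N1 N2" for i j
  proof -
    have "padic_abs p (f i * (g i - g j)) \<le> A * padic_abs p (g i - g j)"
      using A by (simp add: padic_abs_mult[OF p] mult_right_mono)
    also have "\<dots> < A * (e / A)" using A(1) N2[of i j] ij by (intro mult_strict_left_mono) auto
    finally have 1: "padic_abs p (f i * (g i - g j)) < e" using A(1) by simp
    have "padic_abs p ((f i - f j) * g j) \<le> padic_abs p (f i - f j) * B"
      using B by (simp add: padic_abs_mult[OF p] mult_left_mono)
    also have "\<dots> < (e / B) * B" using B(1) N1[of i j] ij by (intro mult_strict_right_mono) auto
    finally have 2: "padic_abs p ((f i - f j) * g j) < e" using B(1) by simp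
    have "f i * g i - f j * g j = f i * (g i - g j) + (f i - f j) * g j" by (simp add: algebra_simps)
    then show ?thesis
      using padic_abs_add_le[OF p, of "f i * (g i - g j)" "(f i - f j) * g j"] 1 2 by auto
  qed
  then show "\<exists>N. \<forall>i\<ge>N. \<forall>j\<ge>N. padic_abs p (f i * g i - f j * g j) < e"
    by (intro exI[of _ "max N1 N2"] allI impI)
qed

lemma cring_padic_Cauchy_ring: "cring (padic_Cauchy_ring p)"
proof (rule cringI)
  show "abelian_group (padic_Cauchy_ring p)"
  proof (rule abelian_groupI)
    fix f assume f: "f \<in> carrier (padic_Cauchy_ring p)"
    show "\<exists>g\<in>carrier (padic_Cauchy_ring p). g \<oplus>\<^bsub>padic_Cauchy_ring p\<^esub> f = \<zero>\<^bsub>padic_Cauchy_ring p\<^esub>"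
      using f padic_Cauchy_minus[of f]
      by (intro bexI[of _ "\<lambda>k. - f k"]) (auto simp: padic_Cauchy_ring_def)
  qed (auto simp: padic_Cauchy_ring_def algebra_simps padic_Cauchy_const padic_Cauchy_add)
  show "comm_monoid (padic_Cauchy_ring p)"
    by (rule comm_monoidI)
      (auto simp: padic_Cauchy_ring_def algebra_simps padic_Cauchy_const padic_Cauchy_mult)
qed (auto simp: padic_Cauchy_ring_def algebra_simps)

lemma a_inv_padic_Cauchy_ring:
  assumes "padic_Cauchy p f"
  shows "\<ominus>\<^bsub>padic_Cauchy_ring p\<^esub> f = (\<lambda>k. - f k)"
proof -
  interpret cring "padic_Cauchy_ring p" by (rule cring_padic_Cauchy_ring)
  show ?thesis
    by (rule minus_equality) (use assms padic_Cauchy_minus[OF assms] in \<open>auto simp: padic_Cauchy_ring_def\<close>)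
qed

lemma padic_null_imp_Cauchy:
  assumes "f \<in> padic_null p" shows "padic_Cauchy p f"
  unfolding padic_Cauchy_def
proof (intro allI impI)
  fix e :: real assume "e > 0"
  then obtain N where N: "\<And>i. i \<ge> N \<Longrightarrow> padic_abs p (f i) < e"
    using assms unfolding padic_null_iff by blast
  have "padic_abs p (f i - f j) < e" if "i \<ge> N" "j \<ge> N" for i j
    using padic_abs_diff_le[OF p, of "f i" "f j"] N[of i] N[of j] that by auto
  then show "\<exists>N. \<forall>i\<ge>N. \<forall>j\<ge>N. padic_abs p (f i - f j) < e"
    by (intro exI[of _ N] allI impI)
qed

lemma padic_null_add:
  assumes "f \<in> padic_null p" "g \<in> padic_null p"
  shows "(\<lambda>k. f k + g k) \<in> padic_null p"
proof -
  have "(\<lambda>k. max (padic_abs p (f k)) (padic_abs p (g k))) \<longlonglongrightarrow> max 0 0"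
    using assms unfolding padic_null_def by (intro tendsto_max) auto
  then have "(\<lambda>k. max (padic_abs p (f k)) (padic_abs p (g k))) \<longlonglongrightarrow> 0" by simp
  then have "(\<lambda>k. padic_abs p (f k + g k)) \<longlonglongrightarrow> 0"
    by (rule Lim_null_comparison[rotated]) (simp add: padic_abs_add_le[OF p])
  then show ?thesis by (simp add: padic_null_def)
qed

lemma padic_null_mult:
  assumes f: "padic_Cauchy p f" and g: "g \<in> padic_null p"
  shows "(\<lambda>k. f k * g k) \<in> padic_null p"
proof -
  have "Bseq (\<lambda>k. padic_abs p (f k))"
    using padic_Cauchy_abs_Cauchy[OF f] Cauchy_Bseq by blast
  then have "Zfun (\<lambda>k. padic_abs p (g k) * padic_abs p (f k)) sequentially"
    using g unfolding padic_null_def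
    by (intro bounded_bilinear.Zfun_prod_Bfun[OF bounded_bilinear_mult]) (auto simp: tendsto_Zfun_iff)
  then show ?thesis by (simp add: padic_null_def padic_abs_mult[OF p] tendsto_Zfun_iff mult.commute)
qed

lemma ideal_padic_null: "ideal (padic_null p) (padic_Cauchy_ring p)"
proof (rule idealI)
  show "ring (padic_Cauchy_ring p)" using cring_padic_Cauchy_ring cring.axioms(1) by blast
  have *: "f \<in> padic_null p \<Longrightarrow> (\<lambda>k. - f k) \<in> padic_null p" for f by (simp add: padic_null_def)
  interpret cring "padic_Cauchy_ring p" by (rule cring_padic_Cauchy_ring)
  show "subgroup (padic_null p) (add_monoid (padic_Cauchy_ring p))"
  proof (rule add.subgroupI)
    show "padic_null p \<subseteq> carrier (padic_Cauchy_ring p)"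
      using padic_null_imp_Cauchy by (auto simp: padic_Cauchy_ring_def)
    show "padic_null p \<noteq> {}" by (auto simp: padic_null_def intro!: exI[of _ "\<lambda>_. 0"])
    show "\<ominus>\<^bsub>padic_Cauchy_ring p\<^esub> f \<in> padic_null p" if "f \<in> padic_null p" for f
      using that * by (simp add: a_inv_padic_Cauchy_ring padic_null_imp_Cauchy)
    show "f \<oplus>\<^bsub>padic_Cauchy_ring p\<^esub> g \<in> padic_null p" if "f \<in> padic_null p" "g \<in> padic_null p" for f g
      using padic_null_add[OF that] by (simp add: padic_Cauchy_ring_def)
  qed
  show "g \<otimes>\<^bsub>padic_Cauchy_ring p\<^esub> f \<in> padic_null p"
    if "f \<in> padic_null p" "g \<in> carrier (padic_Cauchy_ring p)" for f g
    using padic_null_mult[of g f] that by (simp add: padic_Cauchy_ring_def)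
  show "f \<otimes>\<^bsub>padic_Cauchy_ring p\<^esub> g \<in> padic_null p"
    if "f \<in> padic_null p" "g \<in> carrier (padic_Cauchy_ring p)" for f g
    using padic_null_mult[of g f] that by (simp add: padic_Cauchy_ring_def mult.commute)
qed

lemma ring_hom_Qp: "(+>\<^bsub>padic_Cauchy_ring p\<^esub>) (padic_null p) \<in> ring_hom (padic_Cauchy_ring p) (Qp p)"
  unfolding Qp_def by (rule ideal.rcos_ring_hom[OF ideal_padic_null])

lemma in_padic_coset_iff:
  "g \<in> padic_null p +>\<^bsub>padic_Cauchy_ring p\<^esub> f \<longleftrightarrow> (\<lambda>k. g k - f k) \<in> padic_null p"
proof -
  have "g \<in> padic_null p +>\<^bsub>padic_Cauchy_ring p\<^esub> f \<longleftrightarrow> (\<exists>h\<in>padic_null p. g = (\<lambda>k. h k + f k))"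
    by (auto simp: a_r_coset_def' padic_Cauchy_ring_def)
  also have "\<dots> \<longleftrightarrow> (\<lambda>k. g k - f k) \<in> padic_null p"
    by (auto intro!: bexI[of _ "\<lambda>k. g k - f k"])
  finally show ?thesis .
qed

lemma carrier_Qp:
  "carrier (Qp p) = {padic_null p +>\<^bsub>padic_Cauchy_ring p\<^esub> f |f. padic_Cauchy p f}"
proof -
  have "carrier (padic_Cauchy_ring p) = {f. padic_Cauchy p f}" by (simp add: padic_Cauchy_ring_def)
  then show ?thesis by (auto simp: Qp_def FactRing_def A_RCOSETS_def' a_r_coset_def')
qed

lemma padic_norm_tendsto:
  assumes X: "X \<in> carrier (Qp p)" and f: "f \<in> X"
  shows "(\<lambda>k. padic_abs p (f k)) \<longlonglongrightarrow> padic_norm p X"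
proof -
  obtain h where h: "padic_Cauchy p h" and Xh: "X = padic_null p +>\<^bsub>padic_Cauchy_ring p\<^esub> h"
    using X by (auto simp: carrier_Qp)
  obtain l where l: "(\<lambda>k. padic_abs p (h k)) \<longlonglongrightarrow> l"
    using padic_Cauchy_abs_Cauchy[OF h] Cauchy_convergent convergent_def by blast
  have lim: "(\<lambda>k. padic_abs p (g k)) \<longlonglongrightarrow> l" if "g \<in> X" for g
  proof -
    have "(\<lambda>k. padic_abs p (g k - h k)) \<longlonglongrightarrow> 0"
      using that unfolding Xh in_padic_coset_iff by (simp add: padic_null_def)
    then have "(\<lambda>k. padic_abs p (g k) - padic_abs p (h k)) \<longlonglongrightarrow> 0"
      by (rule Lim_null_comparison[rotated]) (simp add: padic_abs_abs_diff_le[OF p])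
    from tendsto_add[OF this l] show ?thesis by simp
  qed
  have "(SOME f. f \<in> X) \<in> X" using someI[of "\<lambda>f. f \<in> X", OF f] .
  then have "padic_norm p X = l" unfolding padic_norm_def using lim limI by blast
  then show ?thesis using lim[OF f] by simp
qed


lemma field_Qp: "field (Qp p)"
proof -
  let ?R = "padic_Cauchy_ring p"
  interpret R: cring ?R by (rule cring_padic_Cauchy_ring)
  have "maximalideal (padic_null p) ?R"
  proof (rule maximalidealI)
    show "ideal (padic_null p) ?R" by (rule ideal_padic_null)
    have "(\<lambda>k. 1) \<notin> padic_null p"
      using p by (simp add: padic_null_def LIMSEQ_const_iff)
    then show "carrier ?R \<noteq> padic_null p" using R.one_closed by (auto simp: padic_Cauchy_ring_def)
  next
    fix J assume J: "ideal J ?R" and sub: "padic_null p \<subseteq> J" and "J \<subseteq> carrier ?R"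
    interpret J: ideal J ?R by (rule J)
    show "J = padic_null p \<or> J = carrier ?R"
    proof (cases "J \<subseteq> padic_null p")
      case True
      then show ?thesis using sub by blast
    next
      case False
      then obtain f where fJ: "f \<in> J" and fn: "f \<notin> padic_null p" by blast
      have f: "padic_Cauchy p f" using fJ J.Icarr[OF fJ] by (simp add: padic_Cauchy_ring_def)
      obtain l where l: "(\<lambda>k. padic_abs p (f k)) \<longlonglongrightarrow> l"
        using padic_Cauchy_abs_Cauchy[OF f] Cauchy_convergent convergent_def by blast
      have "l \<ge> 0" using l by (rule LIMSEQ_le_const) simp
      moreover have "l \<noteq> 0" using l fn by (auto simp: padic_null_def)
      ultimately have l0: "l / 2 > 0" "l / 2 < l" by auto
      obtain N where N: "\<And>k. k \<ge> N \<Longrightarrow> padic_abs p (f k) > l / 2"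
        using order_tendstoD(1)[OF l l0(2)] unfolding eventually_sequentially by blast
      define g where "g k = inverse (f k)" for k
      have g: "padic_Cauchy p g"
        unfolding padic_Cauchy_def
      proof (intro allI impI)
        fix e :: real assume e: "e > 0"
        have "e * (l / 2 * (l / 2)) > 0" using e l0 by simp
        then obtain N' where N': "\<And>i j. i \<ge> N' \<Longrightarrow> j \<ge> N' \<Longrightarrow>
            padic_abs p (f i - f j) < e * (l / 2 * (l / 2))"
          using f unfolding padic_Cauchy_def by blast
        have "padic_abs p (g i - g j) < e" if "i \<ge> max N N'" "j \<ge> max N N'" for i j
        proof -
          have fi: "padic_abs p (f i) > l / 2" and fj: "padic_abs p (f j) > l / 2"
            using N[of i] N[of j] that by auto
          have nz: "f i \<noteq> 0" "f j \<noteq> 0" using fi fj l0 by auto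
          have "f i * f j * (g i - g j) = f j - f i"
            using nz by (simp add: g_def field_simps)
          then have eq: "padic_abs p (f i) * padic_abs p (f j) * padic_abs p (g i - g j)
              = padic_abs p (f j - f i)"
            by (metis padic_abs_mult[OF p])
          have "l / 2 * (l / 2) * padic_abs p (g i - g j) \<le>
              padic_abs p (f i) * padic_abs p (f j) * padic_abs p (g i - g j)"
            using fi fj l0 by (intro mult_right_mono mult_mono) auto
          also have "\<dots> < e * (l / 2 * (l / 2))" unfolding eq using N'[of j i] that by simp
          finally have "l / 2 * (l / 2) * padic_abs p (g i - g j) < l / 2 * (l / 2) * e"
            by (simp add: mult.commute)
          moreover have "l / 2 * (l / 2) > 0" using l0 by simp
          ultimately show ?thesis by (simp only: mult_less_cancel_left_pos)
        qed
        then show "\<exists>N. \<forall>i\<ge>N. \<forall>j\<ge>N. padic_abs p (g i - g j) < e"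
          by (intro exI[of _ "max N N'"] allI impI)
      qed
      have gf: "(\<lambda>k. g k * f k) \<in> J"
        using J.I_l_closed[OF fJ, of g] g by (simp add: padic_Cauchy_ring_def)
      have "(\<lambda>k. padic_abs p (1 - g k * f k)) \<longlonglongrightarrow> 0"
      proof (rule tendsto_eventually)
        have "1 - g k * f k = 0" if "k \<ge> N" for k
          using N[OF that] l0 by (cases "f k = 0") (auto simp: g_def)
        then show "\<forall>\<^sub>F k in sequentially. padic_abs p (1 - g k * f k) = 0"
          unfolding eventually_sequentially by (intro exI[of _ N]) auto
      qed
      then have "(\<lambda>k. 1 - g k * f k) \<in> J" using sub by (auto simp: padic_null_def)
      then have "(\<lambda>k. 1 - g k * f k) \<oplus>\<^bsub>?R\<^esub> (\<lambda>k. g k * f k) \<in> J" using gf by (rule J.a_closed)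
      then have "\<one>\<^bsub>?R\<^esub> \<in> J" by (simp add: padic_Cauchy_ring_def)
      then show ?thesis using J.one_imp_carrier by blast
    qed
  qed
  then show ?thesis unfolding Qp_def by (rule maximalideal.quotient_is_field) (rule cring_padic_Cauchy_ring)
qed

abbreviation (input) "padic_class f \<equiv> padic_null p +>\<^bsub>padic_Cauchy_ring p\<^esub> f"

lemma self_in_coset: "f \<in> padic_class f"
  unfolding in_padic_coset_iff by (simp add: padic_null_def)

lemma QpE:
  assumes "X \<in> carrier (Qp p)" obtains f where "padic_Cauchy p f" "X = padic_class f"
  using assms unfolding carrier_Qp by blast

lemma cls_closed: "padic_Cauchy p f \<Longrightarrow> padic_class f \<in> carrier (Qp p)"
  unfolding carrier_Qp by blast

lemma Qp_add: "padic_Cauchy p f \<Longrightarrow> padic_Cauchy p g \<Longrightarrow> padic_class f \<oplus>\<^bsub>Qp p\<^esub> padic_class g = padic_class (\<lambda>k. f k + g k)"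
  using ring_hom_add[OF ring_hom_Qp, of f g] by (simp add: padic_Cauchy_ring_def)

lemma Qp_mult: "padic_Cauchy p f \<Longrightarrow> padic_Cauchy p g \<Longrightarrow> padic_class f \<otimes>\<^bsub>Qp p\<^esub> padic_class g = padic_class (\<lambda>k. f k * g k)"
  using ring_hom_mult[OF ring_hom_Qp, of f g] by (simp add: padic_Cauchy_ring_def)

lemma Qp_one: "\<one>\<^bsub>Qp p\<^esub> = padic_class (\<lambda>k. 1)"
  using ring_hom_one[OF ring_hom_Qp] by (simp add: padic_Cauchy_ring_def)

lemma Qp_zero: "\<zero>\<^bsub>Qp p\<^esub> = padic_class (\<lambda>k. 0)"
  using ring_hom_zero[OF ring_hom_Qp] field_Qp cring_padic_Cauchy_ring
  by (simp add: padic_Cauchy_ring_def field_def domain_def cring_def)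

lemma Qp_a_inv:
  assumes f: "padic_Cauchy p f" shows "\<ominus>\<^bsub>Qp p\<^esub> padic_class f = padic_class (\<lambda>k. - f k)"
proof -
  interpret field "Qp p" by (rule field_Qp)
  show ?thesis
    by (rule minus_equality)
      (use f padic_Cauchy_minus[OF f] in \<open>simp_all add: cls_closed Qp_add Qp_zero\<close>)
qed

lemma Qp_minus: "padic_Cauchy p f \<Longrightarrow> padic_Cauchy p g \<Longrightarrow> padic_class f \<ominus>\<^bsub>Qp p\<^esub> padic_class g = padic_class (\<lambda>k. f k - g k)"
  using Qp_add[of f "\<lambda>k. - g k"] padic_Cauchy_minus[of g] by (simp add: a_minus_def Qp_a_inv)

lemma padic_norm_cls:
  "padic_Cauchy p f \<Longrightarrow> (\<lambda>k. padic_abs p (f k)) \<longlonglongrightarrow> padic_norm p (padic_class f)"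
  by (rule padic_norm_tendsto[OF cls_closed self_in_coset])

lemma padic_norm_const: "padic_norm p (padic_class (\<lambda>_. q)) = padic_abs p q"
  using padic_norm_cls[OF padic_Cauchy_const, of q] by (simp add: LIMSEQ_const_iff)

lemma Qp_add_pow_nat: "padic_Cauchy p f \<Longrightarrow> [k] \<cdot>\<^bsub>Qp p\<^esub> padic_class f = padic_class (\<lambda>i. of_nat k * f i)" for k :: nat
proof (induction k)
  case 0
  interpret field "Qp p" by (rule field_Qp)
  show ?case by (simp add: Qp_zero)
next
  case (Suc k)
  interpret field "Qp p" by (rule field_Qp)
  show ?case
    using Suc padic_Cauchy_mult[OF padic_Cauchy_const Suc.prems]
    by (simp add: cls_closed Qp_add algebra_simps)
qed

lemma Qp_add_pow_int: "padic_Cauchy p f \<Longrightarrow> [k] \<cdot>\<^bsub>Qp p\<^esub> padic_class f = padic_class (\<lambda>i. of_int k * f i)" for k :: int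
proof -
  assume f: "padic_Cauchy p f"
  interpret field "Qp p" by (rule field_Qp)
  show ?thesis
  proof (cases "k \<ge> 0")
    case True
    then show ?thesis using f by (simp add: add_pow_int_ge Qp_add_pow_nat of_nat_nat)
  next
    case False
    then have "of_nat (nat (- k)) = - (of_int k :: rat)" by (simp add: of_nat_nat)
    then show ?thesis
      using False f padic_Cauchy_mult[OF padic_Cauchy_const f, of "of_nat (nat (- k))"]
      by (simp add: add_pow_int_lt Qp_add_pow_nat Qp_a_inv)
  qed
qed

lemma padic_norm_of_int: "padic_norm p ([k] \<cdot>\<^bsub>Qp p\<^esub> \<one>\<^bsub>Qp p\<^esub>) = padic_abs p (of_int k)" for k :: int
  using Qp_add_pow_int[OF padic_Cauchy_const, of k 1] by (simp add: Qp_one padic_norm_const)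

lemma padic_norm_nonneg: "X \<in> carrier (Qp p) \<Longrightarrow> padic_norm p X \<ge> 0"
  by (erule QpE) (auto intro!: LIMSEQ_le_const[OF padic_norm_cls])

lemma padic_norm_eq_0_iff:
  assumes "X \<in> carrier (Qp p)" shows "padic_norm p X = 0 \<longleftrightarrow> X = \<zero>\<^bsub>Qp p\<^esub>"
proof -
  interpret I: ideal "padic_null p" "padic_Cauchy_ring p" by (rule ideal_padic_null)
  obtain f where f: "padic_Cauchy p f" "X = padic_class f" using assms by (rule QpE)
  have "padic_norm p X = 0 \<longleftrightarrow> f \<in> padic_null p"
    using padic_norm_cls[OF f(1)] LIMSEQ_unique f(2) by (auto simp: padic_null_def)
  also have "\<dots> \<longleftrightarrow> padic_class f = padic_class (\<lambda>k. 0)"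
  proof
    assume "padic_class f = padic_class (\<lambda>k. 0)"
    then have "f \<in> padic_class (\<lambda>k. 0)" using self_in_coset by metis
    then show "f \<in> padic_null p" unfolding in_padic_coset_iff by simp
  next
    assume "f \<in> padic_null p"
    then show "padic_class f = padic_class (\<lambda>k. 0)"
      using I.a_rcos_const[of f] I.a_rcos_const[of "\<lambda>k. 0"] by (simp add: padic_null_def)
  qed
  finally show ?thesis by (simp add: f(2) Qp_zero)
qed

lemma padic_norm_mult:
  assumes "X \<in> carrier (Qp p)" "Y \<in> carrier (Qp p)"
  shows "padic_norm p (X \<otimes>\<^bsub>Qp p\<^esub> Y) = padic_norm p X * padic_norm p Y"
proof -
  obtain f where f: "padic_Cauchy p f" "X = padic_class f" using assms(1) by (rule QpE)
  obtain g where g: "padic_Cauchy p g" "Y = padic_class g" using assms(2) by (rule QpE)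
  have "(\<lambda>k. padic_abs p (f k * g k)) \<longlonglongrightarrow> padic_norm p X * padic_norm p Y"
    unfolding padic_abs_mult[OF p] f(2) g(2)
    by (intro tendsto_mult padic_norm_cls f(1) g(1))
  moreover have "(\<lambda>k. padic_abs p (f k * g k)) \<longlonglongrightarrow> padic_norm p (X \<otimes>\<^bsub>Qp p\<^esub> Y)"
    unfolding f(2) g(2) Qp_mult[OF f(1) g(1)]
    by (intro padic_norm_cls padic_Cauchy_mult f(1) g(1))
  ultimately show ?thesis using LIMSEQ_unique by blast
qed

lemma padic_norm_diff_le:
  assumes "X \<in> carrier (Qp p)" "Y \<in> carrier (Qp p)"
  shows "padic_norm p (X \<ominus>\<^bsub>Qp p\<^esub> Y) \<le> max (padic_norm p X) (padic_norm p Y)"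
proof -
  obtain f where f: "padic_Cauchy p f" "X = padic_class f" using assms(1) by (rule QpE)
  obtain g where g: "padic_Cauchy p g" "Y = padic_class g" using assms(2) by (rule QpE)
  have "padic_Cauchy p (\<lambda>k. f k - g k)"
    using padic_Cauchy_add[OF f(1) padic_Cauchy_minus[OF g(1)]] by simp
  then have 1: "(\<lambda>k. padic_abs p (f k - g k)) \<longlonglongrightarrow> padic_norm p (X \<ominus>\<^bsub>Qp p\<^esub> Y)"
    unfolding f(2) g(2) Qp_minus[OF f(1) g(1)] by (rule padic_norm_cls)
  have 2: "(\<lambda>k. max (padic_abs p (f k)) (padic_abs p (g k))) \<longlonglongrightarrow> max (padic_norm p X) (padic_norm p Y)"
    unfolding f(2) g(2) by (intro tendsto_max padic_norm_cls f(1) g(1))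
  show ?thesis by (rule LIMSEQ_le[OF 1 2]) (simp add: padic_abs_diff_le[OF p])
qed

lemma padic_norm_diff_commute:
  assumes "X \<in> carrier (Qp p)" "Y \<in> carrier (Qp p)"
  shows "padic_norm p (X \<ominus>\<^bsub>Qp p\<^esub> Y) = padic_norm p (Y \<ominus>\<^bsub>Qp p\<^esub> X)"
proof -
  interpret field "Qp p" by (rule field_Qp)
  have z: "padic_norm p \<zero>\<^bsub>Qp p\<^esub> = 0" using padic_norm_eq_0_iff by simp
  have le: "padic_norm p (Y \<ominus>\<^bsub>Qp p\<^esub> X) \<le> padic_norm p (X \<ominus>\<^bsub>Qp p\<^esub> Y)"
    if "X \<in> carrier (Qp p)" "Y \<in> carrier (Qp p)" for X Y
  proof -
    have "Y \<ominus>\<^bsub>Qp p\<^esub> X = \<zero>\<^bsub>Qp p\<^esub> \<ominus>\<^bsub>Qp p\<^esub> (X \<ominus>\<^bsub>Qp p\<^esub> Y)"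
      using that by (simp add: a_minus_def minus_add a_comm)
    then show ?thesis
      using padic_norm_diff_le[of "\<zero>\<^bsub>Qp p\<^esub>" "X \<ominus>\<^bsub>Qp p\<^esub> Y"] padic_norm_nonneg[of "X \<ominus>\<^bsub>Qp p\<^esub> Y"] that z
      by simp
  qed
  show ?thesis using le[of X Y] le[of Y X] assms by simp
qed

lemma padic_norm_dist_le:
  assumes X: "X \<in> carrier (Qp p)" and Y: "Y \<in> carrier (Qp p)" and Z: "Z \<in> carrier (Qp p)"
  shows "padic_norm p (X \<ominus>\<^bsub>Qp p\<^esub> Z) \<le> max (padic_norm p (X \<ominus>\<^bsub>Qp p\<^esub> Y)) (padic_norm p (Y \<ominus>\<^bsub>Qp p\<^esub> Z))"
proof -
  interpret field "Qp p" by (rule field_Qp)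
  have "X \<ominus>\<^bsub>Qp p\<^esub> Z = (X \<ominus>\<^bsub>Qp p\<^esub> Y) \<ominus>\<^bsub>Qp p\<^esub> (Z \<ominus>\<^bsub>Qp p\<^esub> Y)"
    using X Y Z by algebra
  then show ?thesis
    using padic_norm_diff_le[of "X \<ominus>\<^bsub>Qp p\<^esub> Y" "Z \<ominus>\<^bsub>Qp p\<^esub> Y"] padic_norm_diff_commute[OF Y Z] X Y Z by simp
qed

lemma Qp_rat_dense:
  assumes "X \<in> carrier (Qp p)" "e > 0"
  shows "\<exists>q. padic_norm p (X \<ominus>\<^bsub>Qp p\<^esub> padic_class (\<lambda>_. q)) \<le> e"
proof -
  obtain f where f: "padic_Cauchy p f" "X = padic_class f" using assms(1) by (rule QpE)
  obtain N where N: "\<And>i j. i \<ge> N \<Longrightarrow> j \<ge> N \<Longrightarrow> padic_abs p (f i - f j) < e"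
    using f assms(2) unfolding padic_Cauchy_def by blast
  have c: "padic_Cauchy p (\<lambda>k. f k - f N)"
    using padic_Cauchy_add[OF f(1) padic_Cauchy_const, of "- f N"] by simp
  have "padic_norm p (padic_class (\<lambda>k. f k - f N)) \<le> e"
    by (rule LIMSEQ_le_const2[OF padic_norm_cls[OF c]]) (use N[of _ N] in \<open>auto intro!: exI[of _ N] less_imp_le\<close>)
  then show ?thesis
    unfolding f(2) Qp_minus[OF f(1) padic_Cauchy_const, symmetric] by blast
qed

lemma Qp_complete:
  assumes X: "\<And>k. X k \<in> carrier (Qp p)"
    and C: "\<And>e. e > 0 \<Longrightarrow> \<exists>N. \<forall>i\<ge>N. \<forall>j\<ge>N. padic_norm p (X i \<ominus>\<^bsub>Qp p\<^esub> X j) < e"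
  shows "\<exists>L\<in>carrier (Qp p). (\<lambda>k. padic_norm p (X k \<ominus>\<^bsub>Qp p\<^esub> L)) \<longlonglongrightarrow> 0"
proof -
  interpret field "Qp p" by (rule field_Qp)
  have "\<forall>k. \<exists>q. padic_norm p (X k \<ominus>\<^bsub>Qp p\<^esub> padic_class (\<lambda>_. q)) \<le> inverse (real (Suc k))"
    by (intro allI Qp_rat_dense X) simp
  then obtain a where a: "\<And>k. padic_norm p (X k \<ominus>\<^bsub>Qp p\<^esub> padic_class (\<lambda>_. a k)) \<le> inverse (real (Suc k))"
    by metis
  define A where "A k = padic_class (\<lambda>_. a k)" for k
  have A: "A k \<in> carrier (Qp p)" for k unfolding A_def by (intro cls_closed padic_Cauchy_const)
  have aXA: "padic_norm p (X k \<ominus>\<^bsub>Qp p\<^esub> A k) \<le> inverse (real (Suc k))" for k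
    using a by (simp add: A_def)
  have AA: "padic_norm p (A i \<ominus>\<^bsub>Qp p\<^esub> A j) = padic_abs p (a i - a j)" for i j
    unfolding A_def by (simp add: Qp_minus padic_Cauchy_const padic_norm_const)
  have small: "\<exists>N. \<forall>k\<ge>N. padic_norm p (X k \<ominus>\<^bsub>Qp p\<^esub> A k) < e" if "e > 0" for e :: real
  proof -
    obtain N where N: "inverse (real (Suc N)) < e" using reals_Archimedean[OF \<open>e > 0\<close>] by blast
    have "padic_norm p (X k \<ominus>\<^bsub>Qp p\<^esub> A k) < e" if "k \<ge> N" for k
    proof -
      have "inverse (real (Suc k)) \<le> inverse (real (Suc N))" using that by simp
      then show ?thesis using aXA[of k] N by linarith
    qed
    then show ?thesis by blast
  qed
  have ca: "padic_Cauchy p a"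
    unfolding padic_Cauchy_def
  proof (intro allI impI)
    fix e :: real assume e: "e > 0"
    obtain N1 where N1: "\<And>k. k \<ge> N1 \<Longrightarrow> padic_norm p (X k \<ominus>\<^bsub>Qp p\<^esub> A k) < e" using small[OF e] by blast
    obtain N2 where N2: "\<And>i j. i \<ge> N2 \<Longrightarrow> j \<ge> N2 \<Longrightarrow> padic_norm p (X i \<ominus>\<^bsub>Qp p\<^esub> X j) < e"
      using C[OF e] by blast
    have "padic_abs p (a i - a j) < e" if ij: "i \<ge> max N1 N2" "j \<ge> max N1 N2" for i j
    proof -
      have "padic_norm p (A i \<ominus>\<^bsub>Qp p\<^esub> X i) < e"
        using N1[of i] ij padic_norm_diff_commute[OF A X] by simp
      moreover have "padic_norm p (X i \<ominus>\<^bsub>Qp p\<^esub> X j) < e" "padic_norm p (X j \<ominus>\<^bsub>Qp p\<^esub> A j) < e"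
        using N1[of j] N2[of i j] ij by auto
      ultimately show ?thesis
        using padic_norm_dist_le[OF A X A, of i j i] padic_norm_dist_le[OF X X A, of i j j]
        unfolding AA by linarith
    qed
    then show "\<exists>N. \<forall>i\<ge>N. \<forall>j\<ge>N. padic_abs p (a i - a j) < e"
      by (intro exI[of _ "max N1 N2"] allI impI)
  qed
  have L: "padic_class a \<in> carrier (Qp p)" by (rule cls_closed[OF ca])
  have "(\<lambda>k. padic_norm p (X k \<ominus>\<^bsub>Qp p\<^esub> padic_class a)) \<longlonglongrightarrow> 0"
  proof (rule LIMSEQ_I)
    fix e :: real assume e: "e > 0"
    obtain N1 where N1: "\<And>k. k \<ge> N1 \<Longrightarrow> padic_norm p (X k \<ominus>\<^bsub>Qp p\<^esub> A k) < e" using small[OF e] by blast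
    have "e / 2 > 0" using e by simp
    then obtain N2 where N2: "\<And>i j. i \<ge> N2 \<Longrightarrow> j \<ge> N2 \<Longrightarrow> padic_abs p (a i - a j) < e / 2"
      using ca unfolding padic_Cauchy_def by blast
    have "norm (padic_norm p (X k \<ominus>\<^bsub>Qp p\<^esub> padic_class a) - 0) < e" if k: "k \<ge> max N1 N2" for k
    proof -
      have c: "padic_Cauchy p (\<lambda>j. a k - a j)"
        using padic_Cauchy_add[OF padic_Cauchy_const padic_Cauchy_minus[OF ca], of "a k"] by simp
      have "padic_norm p (padic_class (\<lambda>j. a k - a j)) \<le> e / 2"
        by (rule LIMSEQ_le_const2[OF padic_norm_cls[OF c]])
          (use N2[of k] k in \<open>auto intro!: exI[of _ N2] less_imp_le\<close>)
      then have "padic_norm p (A k \<ominus>\<^bsub>Qp p\<^esub> padic_class a) \<le> e / 2"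
        unfolding A_def Qp_minus[OF padic_Cauchy_const ca] .
      then have "padic_norm p (X k \<ominus>\<^bsub>Qp p\<^esub> padic_class a) < e"
        using padic_norm_dist_le[OF X A L, of k k] N1[of k] k e by simp
      moreover have "padic_norm p (X k \<ominus>\<^bsub>Qp p\<^esub> padic_class a) \<ge> 0" using X L by (intro padic_norm_nonneg) simp
      ultimately show ?thesis by simp
    qed
    then show "\<exists>N. \<forall>k\<ge>N. norm (padic_norm p (X k \<ominus>\<^bsub>Qp p\<^esub> padic_class a) - 0) < e"
      by (intro exI[of _ "max N1 N2"] allI impI)
  qed
  then show ?thesis using L by blast
qed

end


text \<open>Vectors of length \<open>n\<close> are extensional functions on \<open>{..<n}\<close>; the definitions are
  used only for \<open>n \<ge> 1\<close>, where the maxima range over non-empty sets.\<close>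

definition Qp_vec :: "nat \<Rightarrow> nat \<Rightarrow> (nat \<Rightarrow> (nat \<Rightarrow> rat) set) set" where
  "Qp_vec p n = {..<n} \<rightarrow>\<^sub>E carrier (Qp p)"

definition Zp_vec :: "nat \<Rightarrow> nat \<Rightarrow> (nat \<Rightarrow> (nat \<Rightarrow> rat) set) set" where
  "Zp_vec p n = {..<n} \<rightarrow>\<^sub>E Zp p"

definition padic_vec_norm :: "nat \<Rightarrow> nat \<Rightarrow> (nat \<Rightarrow> (nat \<Rightarrow> rat) set) \<Rightarrow> real" where
  "padic_vec_norm p n x = Max ((\<lambda>i. padic_norm p (x i)) ` {..<n})"

text \<open>The value 0 outside the space is a dummy: the locale \<^locale>\<open>Metric_space\<close> wants
  distances to be symmetric and non-negative on the whole type.\<close>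

definition padic_vec_dist ::
    "nat \<Rightarrow> nat \<Rightarrow> (nat \<Rightarrow> (nat \<Rightarrow> rat) set) \<Rightarrow> (nat \<Rightarrow> (nat \<Rightarrow> rat) set) \<Rightarrow> real" where
  "padic_vec_dist p n x y =
     (if x \<in> Qp_vec p n \<and> y \<in> Qp_vec p n
      then padic_vec_norm p n (\<lambda>i. x i \<ominus>\<^bsub>Qp p\<^esub> y i) else 0)"

lemma Metric_space_Qp_vec:
  assumes p: "prime p" and n: "n \<ge> 1"
  shows "Metric_space (Qp_vec p n) (padic_vec_dist p n)"
proof -
  interpret field "Qp p" by (rule field_Qp[OF p])
  let ?d = "\<lambda>x y i. padic_norm p (x i \<ominus>\<^bsub>Qp p\<^esub> y i)"
  have dist: "padic_vec_dist p n x y = Max (?d x y ` {..<n})"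
    if "x \<in> Qp_vec p n" "y \<in> Qp_vec p n" for x y
    using that by (simp add: padic_vec_dist_def padic_vec_norm_def)
  have ne: "{..<n} \<noteq> {}" using n by (auto simp: lessThan_empty_iff)
  have comp: "x i \<in> carrier (Qp p)" if "x \<in> Qp_vec p n" "i < n" for x i
    using that by (auto simp: Qp_vec_def)
  have nn: "?d x y i \<ge> 0" if "x \<in> Qp_vec p n" "y \<in> Qp_vec p n" "i < n" for x y i
    using comp that by (intro padic_norm_nonneg p) simp
  have ge: "?d x y i \<le> padic_vec_dist p n x y"
    if "x \<in> Qp_vec p n" "y \<in> Qp_vec p n" "i < n" for x y i
    using that by (simp add: dist)
  have nonneg: "padic_vec_dist p n x y \<ge> 0" for x y
  proof (cases "x \<in> Qp_vec p n \<and> y \<in> Qp_vec p n")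
    case True
    then show ?thesis using nn[of x y 0] ge[of x y 0] n by simp
  qed (auto simp: padic_vec_dist_def)
  have tri: "padic_vec_dist p n x z \<le> max (padic_vec_dist p n x y) (padic_vec_dist p n y z)"
    if xyz: "x \<in> Qp_vec p n" "y \<in> Qp_vec p n" "z \<in> Qp_vec p n" for x y z
  proof -
    have "?d x z i \<le> max (padic_vec_dist p n x y) (padic_vec_dist p n y z)" if i: "i < n" for i
      using padic_norm_dist_le[OF p comp comp comp, OF xyz(1) i xyz(2) i xyz(3) i]
        ge[OF xyz(1,2) i] ge[OF xyz(2,3) i] by simp
    then show ?thesis unfolding dist[OF xyz(1,3)] using ne by (subst Max_le_iff) auto
  qed
  show ?thesis
  proof
    show "0 \<le> padic_vec_dist p n x y" for x y by (rule nonneg)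
  next
    fix x y
    have "padic_norm p (x i \<ominus>\<^bsub>Qp p\<^esub> y i) = padic_norm p (y i \<ominus>\<^bsub>Qp p\<^esub> x i)"
      if "x \<in> Qp_vec p n" "y \<in> Qp_vec p n" "i < n" for i
      using that by (intro padic_norm_diff_commute p comp)
    then show "padic_vec_dist p n x y = padic_vec_dist p n y x"
      by (auto simp: padic_vec_dist_def padic_vec_norm_def intro!: arg_cong[of _ _ Max] image_cong)
  next
    fix x y assume xy: "x \<in> Qp_vec p n" "y \<in> Qp_vec p n"
    show "padic_vec_dist p n x y = 0 \<longleftrightarrow> x = y"
    proof
      assume 0: "padic_vec_dist p n x y = 0"
      have "x i = y i" if i: "i < n" for i
      proof -
        have "?d x y i = 0" using ge[OF xy i] nn[OF xy i] 0 by simp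
        then have "x i \<ominus>\<^bsub>Qp p\<^esub> y i = \<zero>\<^bsub>Qp p\<^esub>"
          using padic_norm_eq_0_iff[OF p] comp xy i by simp
        moreover have "x i = (x i \<ominus>\<^bsub>Qp p\<^esub> y i) \<oplus>\<^bsub>Qp p\<^esub> y i"
          using comp xy i by (simp add: a_minus_def a_assoc l_neg)
        ultimately show ?thesis using comp xy i by simp
      qed
      then show "x = y" using xy unfolding Qp_vec_def by (intro PiE_ext[of x "{..<n}" _ y]) auto
    next
      assume "x = y"
      moreover have "?d x x i = 0" if "i < n" for i
        using padic_norm_eq_0_iff[OF p, of "\<zero>\<^bsub>Qp p\<^esub>"] comp[OF xy(1) that] by (simp add: a_minus_def r_neg)
      ultimately show "padic_vec_dist p n x y = 0"
        using ge nonneg[of x y] ne dist[OF xy] by (simp add: image_constant_conv)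
    qed
  next
    fix x y z assume "x \<in> Qp_vec p n" "y \<in> Qp_vec p n" "z \<in> Qp_vec p n"
    then show "padic_vec_dist p n x z \<le> padic_vec_dist p n x y + padic_vec_dist p n y z"
      using tri[of x y z] nonneg[of x y] nonneg[of y z] by simp
  qed
qed


context Metric_space
begin

definition mdiam :: "'a set \<Rightarrow> real" where
  "mdiam U = (SUP (x, y)\<in>U \<times> U. d x y)"

text \<open>The \<open>s\<close>-th power of the diameter, with the conventions that the empty set contributes
  nothing and that \<open>0\<^sup>0 = 1\<close>, so that the case \<open>s = 0\<close> is the counting measure.\<close>

definition diam_power :: "real \<Rightarrow> 'a set \<Rightarrow> ennreal" where
  "diam_power s U = (if U = {} then 0 else if s = 0 then 1 else ennreal (mdiam U powr s))"

definition hausdorff_premeasure :: "real \<Rightarrow> real \<Rightarrow> 'a set \<Rightarrow> ennreal" where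
  "hausdorff_premeasure s \<delta> E =
     (INF U\<in>{U :: nat \<Rightarrow> 'a set. (\<forall>i. U i \<subseteq> M \<and> (\<forall>x\<in>U i. \<forall>y\<in>U i. d x y \<le> \<delta>)) \<and> E \<subseteq> (\<Union>i. U i)}.
        \<Sum>i. diam_power s (U i))"

definition hausdorff_measure :: "real \<Rightarrow> 'a set \<Rightarrow> ennreal" where
  "hausdorff_measure s E = (SUP \<delta>\<in>{0<..}. hausdorff_premeasure s \<delta> E)"

definition hausdorff_dim :: "'a set \<Rightarrow> ereal" where
  "hausdorff_dim E = Inf {ereal s |s. s \<ge> 0 \<and> hausdorff_measure s E = 0}"

end

abbreviation padic_hausdorff_dim :: "nat \<Rightarrow> nat \<Rightarrow> (nat \<Rightarrow> (nat \<Rightarrow> rat) set) set \<Rightarrow> ereal" where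
  "padic_hausdorff_dim p n \<equiv> Metric_space.hausdorff_dim (Qp_vec p n) (padic_vec_dist p n)"


definition int_vec_norm :: "nat \<Rightarrow> (nat \<Rightarrow> int) \<Rightarrow> int" where
  "int_vec_norm n r = Max ((\<lambda>i. \<bar>r i\<bar>) ` {..<n})"

text \<open>Numerators are extensional, so that distinct solutions are distinct pairs; denominators
  are positive.\<close>

definition padic_approximations ::
    "nat \<Rightarrow> nat \<Rightarrow> real \<Rightarrow> (nat \<Rightarrow> (nat \<Rightarrow> rat) set) \<Rightarrow> ((nat \<Rightarrow> int) \<times> nat) set" where
  "padic_approximations p n \<tau> x =
     {(r, q). r \<in> {..<n} \<rightarrow>\<^sub>E UNIV \<and> q > 0 \<and>
        padic_vec_norm p n (\<lambda>i. [q] \<cdot>\<^bsub>Qp p\<^esub> x i \<ominus>\<^bsub>Qp p\<^esub> [r i] \<cdot>\<^bsub>Qp p\<^esub> \<one>\<^bsub>Qp p\<^esub>)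
          < real_of_int (max (int_vec_norm n r) (int q)) powr (- \<tau>)}"

definition W_star :: "nat \<Rightarrow> nat \<Rightarrow> real \<Rightarrow> (nat \<Rightarrow> (nat \<Rightarrow> rat) set) set" where
  "W_star p n \<tau> = {x \<in> Qp_vec p n.
     infinite {(r, q). (r, q) \<in> padic_approximations p n \<tau> x \<and> p dvd q} \<and>
     finite {(r, q). (r, q) \<in> padic_approximations p n \<tau> x \<and> \<not> p dvd q}}"

end

theory Submission
  imports Defs "HOL-Probability.Probability" "HOL-Number_Theory.Cong"
begin

text \<open>If \<open>x\<close> is integral and \<open>\<tau> \<ge> 1\<close>, then every power of \<open>p\<close> dividing the denominator of an
  approximation divides its numerators and can be cancelled; this yields arbitrarily good
  approximations with denominators prime to \<open>p\<close>, hence infinitely many of them.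

  For the upper bound let \<open>x\<close> have norm at most \<open>p ^ m\<close>. In an approximation with denominator
  \<open>p ^ j * q\<close> the numerators are divisible by \<open>p ^ (j - m)\<close>, so the \<open>s\<close>-th powers of the radii
  of the approximation balls are summable for \<open>s > (n + 1) / \<tau>\<close>.

  For the lower bound, points outside \<^const>\<open>Zp_vec\<close> have no approximations with denominators prime
  to \<open>p\<close>, so it suffices to approximate \<open>x = y / p\<close> with \<open>y\<close> a unit. By the pigeonhole principle
  every residue class of \<open>y\<close> modulo \<open>p ^ ((n + 1) * T)\<close> has a Dirichlet solution of height at most
  \<open>p ^ (n * T)\<close>; counting shows that for half of the classes its denominator is not divisible by a
  high power of \<open>p\<close>, and such classes contain well-separated rational points. Iterating this inside
  shrunken balls about these points gives a Cantor set, and choosing uniformly and independently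
  at each level a measure to which the mass distribution principle applies.\<close>

section \<open>Defects of rational approximations\<close>

text \<open>The exponent is already visible in one level of the tree. Up to factors depending on the
  earlier levels, a ball contains about p^(n(n+1)T) usable rational points of height p^(nT), each
  surrounded by a ball of radius p^(-\<tau> n T), and the ratio of the exponents is (n+1)/\<tau>. T
  is chosen after the previous radius and so large that the inherited factors disappear in the gap
  between s and (n+1)/\<tau>. In the upper bound the same ratio appears when H^(-\<tau> s) is summed
  over n+1 integer coordinates. The two bounds use \<tau> differently. The upper one needs \<tau> >
  1, so that the sum over the powers of p in the denominator converges. The lower one needs \<tau> >
  1 + 1/n, so that the balls are smaller than the distances between their centres. The obstacle in
  the lower bound is a Dirichlet denominator divisible by p^j: cancelling p^j costs j digits of the
  congruence.\<close>

lemma power_int_le_cancel_iff: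
  fixes b :: "'a :: linordered_field"
  assumes "b > 1"
  shows "b powi m \<le> b powi n \<longleftrightarrow> m \<le> n"
  using assms power_int_strict_increasing[of n m b] power_int_increasing[of m n b]
  by (cases "m \<le> n") auto

lemma power_int_less_cancel_iff:
  fixes b :: "'a :: linordered_field"
  assumes "b > 1"
  shows "b powi m < b powi n \<longleftrightarrow> m < n"
  using power_int_le_cancel_iff[OF assms, of n m] by (simp add: not_le[symmetric])

context
  fixes p :: nat
  assumes p: "prime p"
begin

lemma padic_abs_of_int_le_iff:
  "padic_abs p (of_int z) \<le> real p powi (- int k) \<longleftrightarrow> int p ^ k dvd z"
proof (cases "z = 0")
  case True
  then show ?thesis by simp
next
  case False
  have p1: "real p > 1" using prime_gt_1_nat[OF p] by simp
  have "padic_abs p (of_int z) \<le> real p powi (- int k) \<longleftrightarrow> - int (multiplicity (int p) z) \<le> - int k"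
    unfolding padic_abs_of_int[OF p False] by (rule power_int_le_cancel_iff[OF p1])
  also have "\<dots> \<longleftrightarrow> int p ^ k dvd z"
    using False prime_gt_1_nat[OF p] by (subst power_dvd_iff_le_multiplicity) auto
  finally show ?thesis .
qed

lemma padic_abs_of_int_eq_1_iff: "padic_abs p (of_int z) = 1 \<longleftrightarrow> \<not> int p dvd z"
proof -
  have "padic_abs p (of_int z) = 1 \<longleftrightarrow> \<not> padic_abs p (of_int z) \<le> real p powi (- int 1)"
  proof (cases "z = 0")
    case False
    have p1: "real p > 1" using prime_gt_1_nat[OF p] by simp
    show ?thesis
      unfolding padic_abs_of_int[OF p False]
      using power_int_le_cancel_iff[OF p1, of 0 "- int (multiplicity (int p) z)"] p1
      by (subst power_int_le_cancel_iff[OF p1])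
        (cases "multiplicity (int p) z"; auto simp: power_int_minus)
  qed simp
  then show ?thesis unfolding padic_abs_of_int_le_iff by simp
qed

text \<open>The nonzero values are integral powers of p, so a strict bound improves by a whole
  power. This recovers exact divisibility after a passage to the limit.\<close>

lemma padic_abs_less_imp_le:
  assumes "padic_abs p x < real p powi (k + 1)"
  shows "padic_abs p x \<le> real p powi k"
proof (cases "x = 0")
  case False
  have p1: "real p > 1" using prime_gt_1_nat[OF p] by simp
  show ?thesis
    using assms False unfolding padic_abs_def
    by (simp add: power_int_le_cancel_iff[OF p1] power_int_less_cancel_iff[OF p1])
qed simp

lemma padic_abs_p_power: "padic_abs p (of_nat (p ^ j)) = real p powi (- int j)"
proof -
  have "multiplicity (int p) (int p ^ j) = j"
    using p prime_gt_1_nat[OF p] by (intro multiplicity_same_power) auto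
  then show ?thesis using padic_abs_of_int[OF p, of "int p ^ j"] prime_gt_0_nat[OF p] by simp
qed

lemma padic_norm_nat_smult:
  fixes q :: nat
  assumes X: "X \<in> carrier (Qp p)"
  shows "padic_norm p ([q] \<cdot>\<^bsub>Qp p\<^esub> X) = padic_abs p (of_nat q) * padic_norm p X"
proof -
  interpret field "Qp p" by (rule field_Qp[OF p])
  have "[q] \<cdot>\<^bsub>Qp p\<^esub> X = ([int q] \<cdot>\<^bsub>Qp p\<^esub> \<one>\<^bsub>Qp p\<^esub>) \<otimes>\<^bsub>Qp p\<^esub> X"
    using X by (simp add: add_pow_ldistr add_pow_int_ge)
  then show ?thesis using X padic_norm_mult[OF p, of "[int q] \<cdot>\<^bsub>Qp p\<^esub> \<one>\<^bsub>Qp p\<^esub>" X] padic_norm_of_int[OF p, of "int q"]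
    by simp
qed

abbreviation defect :: "nat \<Rightarrow> (nat \<Rightarrow> rat) set \<Rightarrow> int \<Rightarrow> real" where
  "defect q X r \<equiv> padic_norm p ([q] \<cdot>\<^bsub>Qp p\<^esub> X \<ominus>\<^bsub>Qp p\<^esub> [r] \<cdot>\<^bsub>Qp p\<^esub> \<one>\<^bsub>Qp p\<^esub>)"

lemma defect_nonneg: "X \<in> carrier (Qp p) \<Longrightarrow> defect q X r \<ge> 0"
proof -
  interpret field "Qp p" by (rule field_Qp[OF p])
  assume "X \<in> carrier (Qp p)"
  then show ?thesis by (intro padic_norm_nonneg[OF p]) simp
qed

text \<open>In the difference of the two defects the numerator cancels. Hence the points
  approximated by one fixed pair form a set of diameter at most the defect bound divided by the
  absolute value of q.\<close>

lemma padic_norm_diff_le_defect: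
  assumes X: "X \<in> carrier (Qp p)" and Y: "Y \<in> carrier (Qp p)"
  shows "padic_abs p (of_nat q) * padic_norm p (X \<ominus>\<^bsub>Qp p\<^esub> Y) \<le> max (defect q X r) (defect q Y r)"
proof -
  interpret field "Qp p" by (rule field_Qp[OF p])
  define R where "R = [r] \<cdot>\<^bsub>Qp p\<^esub> \<one>\<^bsub>Qp p\<^esub>"
  have R: "R \<in> carrier (Qp p)" by (simp add: R_def)
  define Q where "Q = [q] \<cdot>\<^bsub>Qp p\<^esub> \<one>\<^bsub>Qp p\<^esub>"
  have Q: "Q \<in> carrier (Qp p)" by (simp add: Q_def)
  have smult: "[q] \<cdot>\<^bsub>Qp p\<^esub> Z = Q \<otimes>\<^bsub>Qp p\<^esub> Z" if "Z \<in> carrier (Qp p)" for Z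
    using that by (simp add: Q_def add_pow_ldistr)
  have "Q \<otimes>\<^bsub>Qp p\<^esub> (X \<ominus>\<^bsub>Qp p\<^esub> Y) = (Q \<otimes>\<^bsub>Qp p\<^esub> X \<ominus>\<^bsub>Qp p\<^esub> R) \<ominus>\<^bsub>Qp p\<^esub> (Q \<otimes>\<^bsub>Qp p\<^esub> Y \<ominus>\<^bsub>Qp p\<^esub> R)"
    using X Y Q R by algebra
  then have "padic_norm p ([q] \<cdot>\<^bsub>Qp p\<^esub> (X \<ominus>\<^bsub>Qp p\<^esub> Y)) \<le> max (defect q X r) (defect q Y r)"
    using X Y Q R padic_norm_diff_le[OF p, of "Q \<otimes>\<^bsub>Qp p\<^esub> X \<ominus>\<^bsub>Qp p\<^esub> R" "Q \<otimes>\<^bsub>Qp p\<^esub> Y \<ominus>\<^bsub>Qp p\<^esub> R"]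
    by (simp add: smult R_def[symmetric])
  then show ?thesis using padic_norm_nat_smult[of "X \<ominus>\<^bsub>Qp p\<^esub> Y" q] X Y by simp
qed

text \<open>Apply the ultrametric inequality to r = qX - (qX - r). This is how a good approximation
  forces powers of p into its numerators.\<close>

lemma padic_abs_le_defect:
  assumes X: "X \<in> carrier (Qp p)"
  shows "padic_abs p (of_int r) \<le> max (defect q X r) (padic_abs p (of_nat q) * padic_norm p X)"
proof -
  interpret field "Qp p" by (rule field_Qp[OF p])
  have e: "[r] \<cdot>\<^bsub>Qp p\<^esub> \<one>\<^bsub>Qp p\<^esub> = [q] \<cdot>\<^bsub>Qp p\<^esub> X \<ominus>\<^bsub>Qp p\<^esub> ([q] \<cdot>\<^bsub>Qp p\<^esub> X \<ominus>\<^bsub>Qp p\<^esub> [r] \<cdot>\<^bsub>Qp p\<^esub> \<one>\<^bsub>Qp p\<^esub>)"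
  proof -
    have "b = a \<ominus>\<^bsub>Qp p\<^esub> (a \<ominus>\<^bsub>Qp p\<^esub> b)" if "a \<in> carrier (Qp p)" "b \<in> carrier (Qp p)" for a b
      using that by (simp add: a_minus_def minus_add r_neg2)
    then show ?thesis using X by simp
  qed
  have "padic_norm p ([r] \<cdot>\<^bsub>Qp p\<^esub> \<one>\<^bsub>Qp p\<^esub>) \<le> max (padic_norm p ([q] \<cdot>\<^bsub>Qp p\<^esub> X)) (defect q X r)"
    by (subst e, rule padic_norm_diff_le[OF p]) (use X in auto)
  then show ?thesis using X by (simp add: padic_norm_of_int[OF p] padic_norm_nat_smult max.commute)
qed

text \<open>Used with m = p^j to cancel a common power of p, and with m = 1 + pk to produce further
  exact solutions.\<close>

lemma defect_multiple:
  assumes X: "X \<in> carrier (Qp p)"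
  shows "defect (m * q) X (int m * r) = padic_abs p (of_nat m) * defect q X r"
proof -
  interpret field "Qp p" by (rule field_Qp[OF p])
  obtain f where f: "padic_Cauchy p f" "X = padic_null p +>\<^bsub>padic_Cauchy_ring p\<^esub> f"
    using X by (rule QpE[OF p])
  have 1: "padic_Cauchy p (\<lambda>i. of_nat (m * q) * f i)" "padic_Cauchy p (\<lambda>i. of_nat q * f i)"
    using f by (auto intro: padic_Cauchy_mult[OF p] padic_Cauchy_const[OF p])
  have 2: "[(m * q)] \<cdot>\<^bsub>Qp p\<^esub> X \<ominus>\<^bsub>Qp p\<^esub> [(int m * r)] \<cdot>\<^bsub>Qp p\<^esub> \<one>\<^bsub>Qp p\<^esub>
    = [m] \<cdot>\<^bsub>Qp p\<^esub> ([q] \<cdot>\<^bsub>Qp p\<^esub> X \<ominus>\<^bsub>Qp p\<^esub> [r] \<cdot>\<^bsub>Qp p\<^esub> \<one>\<^bsub>Qp p\<^esub>)"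
    unfolding f(2) Qp_one[OF p]
    using f 1 padic_Cauchy_const[OF p] padic_Cauchy_add[OF p 1(2) padic_Cauchy_minus[OF p padic_Cauchy_const[OF p, of "of_int r"]]]
    by (simp add: Qp_add_pow_nat[OF p] Qp_add_pow_int[OF p] Qp_minus[OF p] algebra_simps)
  show ?thesis unfolding 2 by (rule padic_norm_nat_smult) (use X in simp)
qed

end

section \<open>Hausdorff measure\<close>

context Metric_space
begin

text \<open>The bound B guarantees that the real supremum in \<open>mdiam\<close> is a genuine
  one.\<close>

lemma dist_le_mdiam:
  assumes "\<And>x y. x \<in> U \<Longrightarrow> y \<in> U \<Longrightarrow> d x y \<le> B" "x \<in> U" "y \<in> U"
  shows "d x y \<le> mdiam U"
proof -
  have "bdd_above ((\<lambda>(x, y). d x y) ` (U \<times> U))"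
    using assms(1) by (intro bdd_aboveI[of _ B]) auto
  then have "(\<lambda>(x, y). d x y) (x, y) \<le> mdiam U"
    unfolding mdiam_def using assms(2,3) by (intro cSUP_upper) auto
  then show ?thesis by simp
qed

lemma mdiam_le:
  assumes "\<And>x y. x \<in> U \<Longrightarrow> y \<in> U \<Longrightarrow> d x y \<le> B" "U \<noteq> {}"
  shows "mdiam U \<le> B"
  unfolding mdiam_def using assms by (intro cSUP_least) auto

lemma diam_power_le:
  assumes "\<And>x y. x \<in> U \<Longrightarrow> y \<in> U \<Longrightarrow> d x y \<le> B" "s > 0"
  shows "diam_power s U \<le> ennreal (B powr s)"
proof (cases "U = {}")
  case False
  then obtain x where x: "x \<in> U" by blast
  have "0 \<le> mdiam U" using dist_le_mdiam[OF assms(1) x x] nonneg[of x x] by linarith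
  moreover have "mdiam U \<le> B" using mdiam_le[OF assms(1) False] .
  ultimately show ?thesis
    using assms(2) False by (auto simp: diam_power_def intro!: ennreal_leI powr_mono2)
qed (simp add: diam_power_def)

text \<open>The convergence half of Borel-Cantelli: tails of the sums are covers of arbitrarily
  small weight. The index m serves sets that are only countable unions of sets with such a cover,
  here the points of norm at most p^m; the weights \<epsilon>/2^(m+1) include the countable
  subadditivity.\<close>

lemma hausdorff_measure_Cantelli:
  fixes B :: "nat \<Rightarrow> 'z \<Rightarrow> 'a set" and \<rho> :: "nat \<Rightarrow> 'z \<Rightarrow> real"
  assumes s: "s > 0" and cZ: "countable Z"
    and BM: "\<And>m z. z \<in> Z \<Longrightarrow> B m z \<subseteq> M"
    and diam: "\<And>m z x y. z \<in> Z \<Longrightarrow> x \<in> B m z \<Longrightarrow> y \<in> B m z \<Longrightarrow> d x y \<le> \<rho> m z"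
    and sum: "\<And>m. (\<lambda>z. \<rho> m z powr s) summable_on Z"
    and E: "\<And>x. x \<in> E \<Longrightarrow> \<exists>m. infinite {z \<in> Z. x \<in> B m z}"
  shows "hausdorff_measure s E = 0"
proof -
  have "hausdorff_premeasure s \<delta> E \<le> ennreal \<epsilon>" if \<delta>: "\<delta> > 0" and \<epsilon>: "\<epsilon> > 0" for \<delta> \<epsilon> :: real
  proof -
    \<comment> \<open>The second term is for the diameters: applied to a single index of the tail,
      the bound \<delta>^s on sums forces its radius to be at most \<delta>.\<close>
    define \<eta> where "\<eta> m = min (\<epsilon> * (1/2) ^ Suc m) (\<delta> powr s)" for m
    have \<eta>: "\<eta> m > 0" for m using \<delta> \<epsilon> by (simp add: \<eta>_def)
    have "\<exists>F. finite F \<and> F \<subseteq> Z \<and> (\<forall>G. finite G \<longrightarrow> G \<subseteq> Z - F \<longrightarrow> (\<Sum>z\<in>G. \<rho> m z powr s) \<le> \<eta> m)" for m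
    proof -
      obtain S where S: "((\<lambda>z. \<rho> m z powr s) has_sum S) Z"
        using sum unfolding summable_on_def by blast
      have "\<forall>\<^sub>F F in finite_subsets_at_top Z. dist (\<Sum>z\<in>F. \<rho> m z powr s) S < \<eta> m / 2"
        using S[unfolded has_sum_def] by (rule tendstoD) (use \<eta>[of m] in simp)
      then obtain F where F: "finite F" "F \<subseteq> Z"
        and le': "\<forall>Y. finite Y \<and> F \<subseteq> Y \<and> Y \<subseteq> Z \<longrightarrow> dist (\<Sum>z\<in>Y. \<rho> m z powr s) S < \<eta> m / 2"
        unfolding eventually_finite_subsets_at_top by (elim exE conjE)
      have le: "dist (\<Sum>z\<in>Y. \<rho> m z powr s) S < \<eta> m / 2" if "finite Y" "F \<subseteq> Y" "Y \<subseteq> Z" for Y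
        using le' that by simp
      have "(\<Sum>z\<in>G. \<rho> m z powr s) \<le> \<eta> m" if G: "finite G" "G \<subseteq> Z - F" for G
      proof -
        have "(\<Sum>z\<in>F \<union> G. \<rho> m z powr s) = (\<Sum>z\<in>F. \<rho> m z powr s) + (\<Sum>z\<in>G. \<rho> m z powr s)"
          using G F by (intro sum.union_disjoint) auto
        moreover have "dist (\<Sum>z\<in>F \<union> G. \<rho> m z powr s) S < \<eta> m / 2" using G F by (intro le) auto
        moreover have "dist (\<Sum>z\<in>F. \<rho> m z powr s) S < \<eta> m / 2" using F by (intro le) auto
        ultimately show ?thesis unfolding dist_real_def by linarith
      qed
      then show ?thesis using F by blast
    qed
    then obtain F where F: "\<And>m. finite (F m)" "\<And>m. F m \<subseteq> Z"
      and Fle: "\<And>m G. finite G \<Longrightarrow> G \<subseteq> Z - F m \<Longrightarrow> (\<Sum>z\<in>G. \<rho> m z powr s) \<le> \<eta> m" by metis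
    \<comment> \<open>Removing the finite set \<open>F m\<close> leaves a cover, because each point
      of E lies in infinitely many sets for some m.\<close>
    define C where "C = (SIGMA m:UNIV. Z - F m)"
    have cC: "countable C" unfolding C_def using cZ by auto
    define t where "t = to_nat_on C"
    have inj: "inj_on t C" unfolding t_def by (rule inj_on_to_nat_on[OF cC])
    define V where "V c = B (fst c) (snd c)" for c
    define U where "U i = (if i \<in> t ` C then V (inv_into C t i) else {})" for i
    have Ut: "U (t c) = V c" if "c \<in> C" for c
      using that inj by (simp add: U_def inv_into_f_f)
    have dV: "d x y \<le> \<rho> (fst c) (snd c)" if "c \<in> C" "x \<in> V c" "y \<in> V c" for c x y
      using that by (auto simp: C_def V_def intro: diam)
    have \<rho>\<delta>: "\<rho> (fst c) (snd c) \<le> \<delta>" if "c \<in> C" for c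
    proof (rule ccontr)
      assume "\<not> \<rho> (fst c) (snd c) \<le> \<delta>"
      then have "\<delta> powr s < \<rho> (fst c) (snd c) powr s" using \<delta> s by (intro powr_less_mono2) auto
      moreover have "\<rho> (fst c) (snd c) powr s \<le> \<eta> (fst c)"
        using Fle[of "{snd c}" "fst c"] that by (auto simp: C_def)
      ultimately show False by (simp add: \<eta>_def)
    qed
    have adm: "U i \<subseteq> M \<and> (\<forall>x\<in>U i. \<forall>y\<in>U i. d x y \<le> \<delta>)" for i
    proof (cases "i \<in> t ` C")
      case True
      then obtain c where c: "c \<in> C" "i = t c" by blast
      have "V c \<subseteq> M" unfolding V_def by (rule BM) (use c in \<open>auto simp: C_def\<close>)
      then show ?thesis using dV[OF c(1)] \<rho>\<delta>[OF c(1)] by (auto simp: c(2) Ut[OF c(1)] intro: order_trans)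
    qed (simp add: U_def)
    have cov: "E \<subseteq> (\<Union>i. U i)"
    proof
      fix x assume "x \<in> E"
      then obtain m where m: "infinite {z \<in> Z. x \<in> B m z}" using E by blast
      then have "\<not> {z \<in> Z. x \<in> B m z} \<subseteq> F m" using F(1) finite_subset by blast
      then obtain z where "z \<in> Z - F m" "x \<in> B m z" by blast
      then have "(m, z) \<in> C" "x \<in> V (m, z)" by (auto simp: C_def V_def)
      then show "x \<in> (\<Union>i. U i)" using Ut by blast
    qed
    have "(\<Sum>i. diam_power s (U i)) \<le> ennreal \<epsilon>"
    proof (rule suminf_le_const[OF summableI])
      fix k
      define G where "G = {c \<in> C. t c < k}"
      have tG: "t ` G = {..<k} \<inter> t ` C" by (auto simp: G_def)
      have injG: "inj_on t G" using inj by (rule inj_on_subset) (auto simp: G_def)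
      have fG: "finite G" using tG injG by (metis finite_Int finite_imageD finite_lessThan)
      have "(\<Sum>i<k. diam_power s (U i)) = (\<Sum>i\<in>{..<k} \<inter> t ` C. diam_power s (U i))"
        by (rule sum.mono_neutral_right) (auto simp: U_def diam_power_def)
      also have "\<dots> = (\<Sum>c\<in>G. diam_power s (V c))"
        unfolding tG[symmetric] using injG by (subst sum.reindex) (auto simp: G_def Ut)
      also have "\<dots> \<le> (\<Sum>c\<in>G. ennreal (\<rho> (fst c) (snd c) powr s))"
        by (intro sum_mono diam_power_le s dV) (auto simp: G_def)
      also have "\<dots> = ennreal (\<Sum>c\<in>G. \<rho> (fst c) (snd c) powr s)" by simp
      also have "\<dots> \<le> ennreal \<epsilon>"
      proof (rule ennreal_leI)
        define K where "K = Suc (Max (insert 0 (fst ` G)))"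
        have K: "fst c < K" if "c \<in> G" for c
          using fG that by (auto simp: K_def less_Suc_eq_le intro!: Max_ge)
        define Gm where "Gm m = {z. (m, z) \<in> G}" for m
        have fGm: "finite (Gm m)" for m
          using fG by (rule finite_surj[of _ _ snd]) (force simp: Gm_def)
        have "G = (SIGMA m:{..<K}. Gm m)" using K by (auto simp: Gm_def)
        then have "(\<Sum>c\<in>G. \<rho> (fst c) (snd c) powr s) = (\<Sum>c\<in>(SIGMA m:{..<K}. Gm m). (\<lambda>(m, z). \<rho> m z powr s) c)"
          by (intro sum.cong) (auto split: prod.splits)
        also have "\<dots> = (\<Sum>m<K. \<Sum>z\<in>Gm m. \<rho> m z powr s)"
          using fGm by (subst sum.Sigma) auto
        also have "\<dots> \<le> (\<Sum>m<K. \<epsilon> * (1/2) ^ Suc m)"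
        proof (rule sum_mono)
          fix m
          have "(\<Sum>z\<in>Gm m. \<rho> m z powr s) \<le> \<eta> m"
            by (rule Fle[OF fGm]) (auto simp: Gm_def G_def C_def)
          then show "(\<Sum>z\<in>Gm m. \<rho> m z powr s) \<le> \<epsilon> * (1/2) ^ Suc m" by (simp add: \<eta>_def)
        qed
        also have "\<dots> = \<epsilon> * (1 - (1/2) ^ K)"
          by (induction K) (auto simp: algebra_simps)
        also have "\<dots> \<le> \<epsilon>" using \<epsilon> by (simp add: algebra_simps)
        finally show "(\<Sum>c\<in>G. \<rho> (fst c) (snd c) powr s) \<le> \<epsilon>" .
      qed
      finally show "(\<Sum>i<k. diam_power s (U i)) \<le> ennreal \<epsilon>" .
    qed
    moreover have "hausdorff_premeasure s \<delta> E \<le> (\<Sum>i. diam_power s (U i))"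
      unfolding hausdorff_premeasure_def using adm cov by (intro INF_lower) auto
    ultimately show ?thesis by (rule order_trans[rotated])
  qed
  note small = this
  have "hausdorff_premeasure s \<delta> E \<le> 0" if "\<delta> > 0" for \<delta>
  proof (rule ennreal_le_epsilon)
    fix e :: real assume "e > 0"
    from small[OF that this] show "hausdorff_premeasure s \<delta> E \<le> 0 + ennreal e" by simp
  qed
  then have "hausdorff_measure s E \<le> 0"
    unfolding hausdorff_measure_def by (intro SUP_least) simp
  then show ?thesis by simp
qed

text \<open>The mass distribution argument requires s > 0. The exponent 0 is excluded from the
  infimum defining the dimension by mere nonemptiness, since one nonempty covering set already has
  weight 1.\<close>

lemma hausdorff_measure_0_pos:
  assumes "E \<noteq> {}" shows "hausdorff_measure 0 E \<noteq> 0"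
proof -
  have "1 \<le> hausdorff_premeasure 0 1 E"
    unfolding hausdorff_premeasure_def
  proof (rule INF_greatest)
    fix U :: "nat \<Rightarrow> 'a set"
    assume "U \<in> {U. (\<forall>i. U i \<subseteq> M \<and> (\<forall>x\<in>U i. \<forall>y\<in>U i. d x y \<le> 1)) \<and> E \<subseteq> (\<Union>i. U i)}"
    then obtain i where "U i \<noteq> {}" using assms by blast
    then have "1 = (\<Sum>j\<in>{i}. diam_power 0 (U j))" by (simp add: diam_power_def)
    also have "\<dots> \<le> (\<Sum>j. diam_power 0 (U j))" by (rule sum_le_suminf[OF summableI]) auto
    finally show "1 \<le> (\<Sum>j. diam_power 0 (U j))" .
  qed
  also have "\<dots> \<le> hausdorff_measure 0 E" unfolding hausdorff_measure_def by (intro SUP_upper) simp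
  finally show ?thesis by auto
qed

text \<open>The measure on E is the image of N under f, kept on the side of N: a measurable set A
  containing the preimage of a ball replaces that preimage, so measurability of f does not enter.
  Testing the radii \<theta>^k suffices, as every diameter can be rounded up to one of them at the
  cost of a factor \<theta>^(-s).\<close>

lemma mass_distribution_principle:
  fixes N :: "'w measure"
  assumes N: "prob_space N" and f: "\<And>w. w \<in> space N \<Longrightarrow> f w \<in> E"
    and s: "s > 0" and C: "C > 0" and \<theta>: "0 < \<theta>" "\<theta> < 1"
    and ball: "\<And>w k. w \<in> space N \<Longrightarrow> \<exists>A\<in>sets N. {w' \<in> space N. d (f w) (f w') \<le> \<theta> ^ k} \<subseteq> A
                 \<and> emeasure N A \<le> ennreal (C * (\<theta> ^ k) powr s)"
  shows "hausdorff_measure s E \<noteq> 0"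
proof -
  interpret prob_space N by (rule N)
  \<comment> \<open>The factor \<open>\<theta> powr s\<close> pays for rounding diameters up to
    powers of \<theta>, and the 2 for the total error 1/2 granted to the sets of the cover.\<close>
  define c where "c = \<theta> powr s / (2 * C)"
  have c: "c > 0" using C \<theta> by (simp add: c_def)
  have "ennreal c \<le> hausdorff_premeasure s 1 E"
    unfolding hausdorff_premeasure_def
  proof (rule INF_greatest)
    fix U :: "nat \<Rightarrow> 'a set"
    assume "U \<in> {U. (\<forall>i. U i \<subseteq> M \<and> (\<forall>x\<in>U i. \<forall>y\<in>U i. d x y \<le> 1)) \<and> E \<subseteq> (\<Union>i. U i)}"
    then have d1: "\<And>i x y. x \<in> U i \<Longrightarrow> y \<in> U i \<Longrightarrow> d x y \<le> 1" and cov: "E \<subseteq> (\<Union>i. U i)" by auto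
    have "\<exists>A\<in>sets N. {w \<in> space N. f w \<in> U i} \<subseteq> A \<and>
        emeasure N A \<le> ennreal (C / \<theta> powr s) * diam_power s (U i) + ennreal ((1/2) ^ Suc (Suc i))" for i
    proof (cases "{w \<in> space N. f w \<in> U i} = {}")
      case True
      show ?thesis unfolding True by (intro bexI[of _ "{}"]) auto
    next
      case False
      then obtain w where w: "w \<in> space N" "f w \<in> U i" by blast
      define t where "t = mdiam (U i)"
      have t: "d (f w) y \<le> t" if "y \<in> U i" for y
        unfolding t_def using d1 w(2) that by (rule dist_le_mdiam)
      have t0: "t \<ge> 0" using t[OF w(2)] nonneg order_trans by blast
      have t1: "t \<le> 1" unfolding t_def using d1 w(2) by (intro mdiam_le) auto
      have dp: "diam_power s (U i) = ennreal (t powr s)" using w s by (auto simp: diam_power_def t_def)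
      \<comment> \<open>A set of diameter 0 has weight 0, while its mass is only known to be
        arbitrarily small. The error terms (1/2)^(i+2), with sum 1/2, absorb this case.\<close>
      have "\<exists>k. t \<le> \<theta> ^ k \<and> C * (\<theta> ^ k) powr s \<le> C / \<theta> powr s * t powr s + (1/2) ^ Suc (Suc i)"
      proof (cases "t = 0")
        case True
        have "\<theta> powr s < 1" using \<theta> s powr_less_mono2[of s \<theta> 1] by simp
        then have "(\<lambda>k. C * (\<theta> powr s) ^ k) \<longlonglongrightarrow> C * 0"
          using \<theta> by (intro tendsto_mult tendsto_const LIMSEQ_realpow_zero) auto
        then have "\<forall>\<^sub>F k in sequentially. C * (\<theta> powr s) ^ k < (1/2) ^ Suc (Suc i)"
          by (rule order_tendstoD) simp
        then obtain k where "C * (\<theta> powr s) ^ k < (1/2) ^ Suc (Suc i)"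
          by (auto simp: eventually_sequentially)
        moreover have "(\<theta> ^ k) powr s = (\<theta> powr s) ^ k"
          using \<theta> by (simp add: powr_powr mult.commute flip: powr_realpow)
        ultimately show ?thesis using True \<theta> by (intro exI[of _ k]) (auto intro: less_imp_le)
      next
        case False
        then have "t > 0" using t0 by simp
        obtain n where n: "\<theta> ^ n < t" using real_arch_pow_inv[OF \<open>t > 0\<close> \<theta>(2)] by blast
        define k where "k = (LEAST n. \<theta> ^ n < t)"
        have k: "\<theta> ^ k < t" unfolding k_def by (rule LeastI) (rule n)
        have "k \<noteq> 0" using k t1 by (cases k) auto
        then obtain k' where k': "k = Suc k'" by (cases k) auto
        have "\<not> \<theta> ^ k' < t" using not_less_Least[of k' "\<lambda>n. \<theta> ^ n < t"] k' by (auto simp: k_def)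
        moreover have "\<theta> ^ k' \<le> t / \<theta>" using k \<theta> by (simp add: k' field_simps)
        then have "(\<theta> ^ k') powr s \<le> (t / \<theta>) powr s" using s \<theta> by (intro powr_mono2) auto
        then have "C * (\<theta> ^ k') powr s \<le> C * (t powr s / \<theta> powr s)"
          using C by (intro mult_left_mono) (simp_all add: powr_divide t0 \<theta> less_imp_le)
        then have "C * (\<theta> ^ k') powr s \<le> C / \<theta> powr s * t powr s + (1/2) ^ Suc (Suc i)"
          by (simp add: add_increasing2)
        ultimately show ?thesis by (intro exI[of _ k']) auto
      qed
      then obtain k where k: "t \<le> \<theta> ^ k"
        "C * (\<theta> ^ k) powr s \<le> C / \<theta> powr s * t powr s + (1/2) ^ Suc (Suc i)" by blast
      obtain A where A: "A \<in> sets N" "{w' \<in> space N. d (f w) (f w') \<le> \<theta> ^ k} \<subseteq> A"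
        "emeasure N A \<le> ennreal (C * (\<theta> ^ k) powr s)" using ball[OF w(1)] by blast
      have "{w \<in> space N. f w \<in> U i} \<subseteq> A" using A(2) t k(1) by (blast intro: order_trans)
      moreover have "ennreal (C * (\<theta> ^ k) powr s) \<le> ennreal (C / \<theta> powr s) * diam_power s (U i) + ennreal ((1/2) ^ Suc (Suc i))"
      proof -
        have "ennreal (C * (\<theta> ^ k) powr s) \<le> ennreal (C / \<theta> powr s * t powr s + (1/2) ^ Suc (Suc i))"
          using k(2) by (rule ennreal_leI)
        also have "\<dots> = ennreal (C / \<theta> powr s) * ennreal (t powr s) + ennreal ((1/2) ^ Suc (Suc i))"
          using C by (subst ennreal_plus) (auto simp del: power_Suc simp flip: ennreal_mult)
        finally show ?thesis unfolding dp .
      qed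
      ultimately show ?thesis using A by (auto intro: order_trans)
    qed
    then obtain A where A: "\<And>i. A i \<in> sets N" "\<And>i. {w \<in> space N. f w \<in> U i} \<subseteq> A i"
      "\<And>i. emeasure N (A i) \<le> ennreal (C / \<theta> powr s) * diam_power s (U i) + ennreal ((1/2) ^ Suc (Suc i))"
      by metis
    have "space N \<subseteq> (\<Union>i. A i)" using f cov A(2) by blast
    then have "emeasure N (space N) \<le> emeasure N (\<Union>i. A i)" using A(1) by (intro emeasure_mono) auto
    then have "1 \<le> emeasure N (\<Union>i. A i)" by (simp add: emeasure_space_1)
    also have "\<dots> \<le> (\<Sum>i. emeasure N (A i))" using A(1) by (intro emeasure_subadditive_countably) auto
    also have "\<dots> \<le> (\<Sum>i. ennreal (C / \<theta> powr s) * diam_power s (U i) + ennreal ((1/2) ^ Suc (Suc i)))"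
      by (rule suminf_le[OF A(3)]) auto
    also have "\<dots> = ennreal (C / \<theta> powr s) * (\<Sum>i. diam_power s (U i)) + (\<Sum>i. ennreal ((1/2) ^ Suc (Suc i)))"
      by (subst suminf_add[symmetric]) (auto simp: ennreal_suminf_cmult)
    also have "(\<Sum>i. ennreal ((1/2) ^ Suc (Suc i))) = ennreal (1/2)"
    proof -
      have "(\<lambda>i. (1/2 :: real) * (1/2) ^ Suc i) sums (1/2 * 1)"
        by (intro sums_mult power_half_series)
      then show ?thesis by (intro suminf_ennreal_eq) auto
    qed
    finally have le: "1 \<le> ennreal (C / \<theta> powr s) * (\<Sum>i. diam_power s (U i)) + ennreal (1/2)" .
    show "ennreal c \<le> (\<Sum>i. diam_power s (U i))"
    proof (cases "(\<Sum>i. diam_power s (U i))")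
      case (real r)
      have "ennreal 1 \<le> ennreal (C / \<theta> powr s * r + 1/2)"
      proof -
        have "ennreal (C / \<theta> powr s * r + 1/2) = ennreal (C / \<theta> powr s) * ennreal r + ennreal (1/2)"
          using C real by (subst ennreal_plus) (auto simp flip: ennreal_mult)
        then show ?thesis using le real by simp
      qed
      then have "1 \<le> C / \<theta> powr s * r + 1/2"
        using real C by (subst (asm) ennreal_le_iff) auto
      then have "c \<le> r" using C \<theta> by (simp add: c_def field_simps)
      then show ?thesis using real by (simp add: ennreal_leI)
    qed simp
  qed
  also have "\<dots> \<le> hausdorff_measure s E" unfolding hausdorff_measure_def by (intro SUP_upper) simp
  finally show ?thesis using c by auto
qed

end

section \<open>Approximation in several variables\<close>

definition height :: "nat \<Rightarrow> (nat \<Rightarrow> int) \<Rightarrow> nat \<Rightarrow> real" where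
  "height n r q = real_of_int (max (int_vec_norm n r) (int q))"

lemma int_vec_norm_le_iff:
  assumes "n \<ge> 1"
  shows "int_vec_norm n r \<le> B \<longleftrightarrow> (\<forall>i<n. \<bar>r i\<bar> \<le> B)"
proof -
  have "{..<n} \<noteq> {}" using assms by (auto simp: lessThan_empty_iff)
  then show ?thesis unfolding int_vec_norm_def by (subst Max_le_iff) auto
qed

lemma abs_le_int_vec_norm: "i < n \<Longrightarrow> \<bar>r i\<bar> \<le> int_vec_norm n r"
  using int_vec_norm_le_iff[of n r "int_vec_norm n r"] by (cases "n \<ge> 1") auto

lemma height_le_iff:
  assumes "n \<ge> 1"
  shows "height n r q \<le> real_of_int B \<longleftrightarrow> (\<forall>i<n. \<bar>r i\<bar> \<le> B) \<and> int q \<le> B"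
  by (simp only: height_def of_int_le_iff max.bounded_iff int_vec_norm_le_iff[OF assms])

lemma le_height: "real q \<le> height n r q" "i < n \<Longrightarrow> real_of_int \<bar>r i\<bar> \<le> height n r q"
proof -
  show "real q \<le> height n r q"
    unfolding height_def by (metis of_int_le_iff of_int_of_nat_eq max.cobounded2)
  show "real_of_int \<bar>r i\<bar> \<le> height n r q" if "i < n"
    unfolding height_def of_int_le_iff using abs_le_int_vec_norm[OF that, of r] by linarith
qed

lemma height_multiple_ge:
  assumes n: "n \<ge> 1" and r': "\<And>i. i < n \<Longrightarrow> r' i = int m * r i"
  shows "real m * height n r q \<le> height n r' (m * q)"
proof (cases "m = 0")
  case True
  then show ?thesis using le_height(1)[of 0 n r'] by simp
next
  case False
  define h where "h = max (int_vec_norm n r') (int (m * q))"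
  have "height n r q \<le> real_of_int (h div int m)"
    unfolding height_le_iff[OF n]
  proof (intro conjI allI impI)
    fix i assume i: "i < n"
    have "\<bar>r i\<bar> * int m \<le> h"
      using abs_le_int_vec_norm[OF i, of r'] r'[OF i] by (simp add: h_def abs_mult mult.commute)
    from zdiv_mono1[OF this, of "int m"] show "\<bar>r i\<bar> \<le> h div int m" using False by simp
  next
    have "int q * int m \<le> h" by (simp add: h_def mult.commute)
    from zdiv_mono1[OF this, of "int m"] show "int q \<le> h div int m" using False by simp
  qed
  then have "real m * height n r q \<le> real_of_int (int m * (h div int m))"
    using False by simp
  also have "\<dots> \<le> real_of_int h" unfolding of_int_le_iff using False mult_div_mod_eq[of "int m" h] pos_mod_sign[of "int m" h] by linarith
  finally show ?thesis by (simp add: height_def h_def)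
qed

context
  fixes p n :: nat
  assumes p: "prime p" and n: "n \<ge> 1"
begin

abbreviation vec_defect :: "nat \<Rightarrow> (nat \<Rightarrow> (nat \<Rightarrow> rat) set) \<Rightarrow> (nat \<Rightarrow> int) \<Rightarrow> real" where
  "vec_defect q x r \<equiv>
     padic_vec_norm p n (\<lambda>i. [q] \<cdot>\<^bsub>Qp p\<^esub> x i \<ominus>\<^bsub>Qp p\<^esub> [r i] \<cdot>\<^bsub>Qp p\<^esub> \<one>\<^bsub>Qp p\<^esub>)"

lemma index_set_nonempty: "{..<n} \<noteq> {}"
  using n by (auto simp: lessThan_empty_iff)

lemma padic_vec_norm_le_iff: "padic_vec_norm p n x \<le> e \<longleftrightarrow> (\<forall>i<n. padic_norm p (x i) \<le> e)"
  unfolding padic_vec_norm_def using index_set_nonempty by (subst Max_le_iff) auto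

lemma padic_vec_norm_less_iff: "padic_vec_norm p n x < e \<longleftrightarrow> (\<forall>i<n. padic_norm p (x i) < e)"
  unfolding padic_vec_norm_def using index_set_nonempty by (subst Max_less_iff) auto

lemma padic_vec_dist_le_iff:
  assumes "x \<in> Qp_vec p n" "y \<in> Qp_vec p n"
  shows "padic_vec_dist p n x y \<le> e \<longleftrightarrow> (\<forall>i<n. padic_norm p (x i \<ominus>\<^bsub>Qp p\<^esub> y i) \<le> e)"
  using assms by (simp add: padic_vec_dist_def padic_vec_norm_le_iff)

lemma Qp_vec_component: "x \<in> Qp_vec p n \<Longrightarrow> i < n \<Longrightarrow> x i \<in> carrier (Qp p)"
  by (auto simp: Qp_vec_def)

lemma padic_approximations_iff:
  "(r, q) \<in> padic_approximations p n \<tau> x \<longleftrightarrow>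
     r \<in> {..<n} \<rightarrow>\<^sub>E UNIV \<and> q > 0 \<and> vec_defect q x r < height n r q powr (- \<tau>)"
  by (simp add: padic_approximations_def height_def)

text \<open>If all defects are positive, finitely many pairs would keep them away from 0. The
  closure of P under factors 1 + pk handles an exact solution; since such factors are prime to p, P
  may be divisibility by p as well as its negation.\<close>

lemma infinite_approximations_if_small_defects:
  assumes x: "x \<in> Qp_vec p n"
    and P: "\<And>q k. P q \<Longrightarrow> P ((1 + p * k) * q)"
    and small: "\<And>e. e > 0 \<Longrightarrow> \<exists>r q. (r, q) \<in> padic_approximations p n \<tau> x \<and> P q \<and> vec_defect q x r < e"
  shows "infinite {(r, q). (r, q) \<in> padic_approximations p n \<tau> x \<and> P q}" (is "infinite ?A")
proof
  assume fin: "finite ?A"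
  have nonneg: "vec_defect q x r \<ge> 0" for r q
  proof -
    have "0 \<le> defect p q (x 0) (r 0)" using defect_nonneg[OF p] Qp_vec_component[OF x] n by simp
    also have "\<dots> \<le> vec_defect q x r"
      unfolding padic_vec_norm_def using n by (intro Max_ge) (auto intro!: image_eqI[of _ _ 0])
    finally show ?thesis .
  qed
  show False
  proof (cases "\<exists>(r, q)\<in>?A. vec_defect q x r = 0")
    case True
    then obtain r q where rq: "(r, q) \<in> padic_approximations p n \<tau> x" "P q" "vec_defect q x r \<le> 0" by auto
    have q: "q > 0" using rq by (simp add: padic_approximations_iff)
    \<comment> \<open>An exact solution stays exact when multiplied, and a zero defect satisfies the
      bound at every height.\<close>
    define r' where "r' k = (\<lambda>i\<in>{..<n}. int (1 + p * k) * r i)" for k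
    have "(r' k, (1 + p * k) * q) \<in> ?A" for k
    proof -
      have D0: "vec_defect ((1 + p * k) * q) x (r' k) \<le> 0"
        unfolding padic_vec_norm_le_iff
      proof (intro allI impI)
        fix i assume i: "i < n"
        have "defect p q (x i) (r i) \<le> 0" using rq(3) i by (simp add: padic_vec_norm_le_iff)
        moreover have "defect p ((1 + p * k) * q) (x i) (r' k i) =
            padic_abs p (of_nat (1 + p * k)) * defect p q (x i) (r i)"
          using defect_multiple[OF p Qp_vec_component[OF x i]] i by (simp only: r'_def restrict_apply' lessThan_iff)
        ultimately show "defect p ((1 + p * k) * q) (x i) (r' k i) \<le> 0"
          by (simp only: mult_nonneg_nonpos padic_abs_nonneg)
      qed
      have "height n (r' k) ((1 + p * k) * q) > 0"
        using le_height(1)[of "(1 + p * k) * q" n "r' k"] q by (auto intro: less_le_trans[rotated] simp del: of_nat_mult)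
      then have "0 < height n (r' k) ((1 + p * k) * q) powr - \<tau>" by simp
      with D0 have "vec_defect ((1 + p * k) * q) x (r' k) < height n (r' k) ((1 + p * k) * q) powr - \<tau>"
        by (rule order.strict_trans1)
      moreover have "r' k \<in> {..<n} \<rightarrow>\<^sub>E UNIV" by (auto simp: r'_def)
      ultimately show ?thesis
        using q P[OF rq(2)] by (simp add: padic_approximations_iff del: add_Suc)
    qed
    then have "range (\<lambda>k. (1 + p * k) * q) \<subseteq> snd ` ?A" by (force simp: image_iff)
    then have "finite (range (\<lambda>k. (1 + p * k) * q))" using fin finite_subset by blast
    moreover have "inj (\<lambda>k. (1 + p * k) * q)" using q prime_gt_0_nat[OF p] by (auto simp: inj_on_def)
    ultimately show False using finite_imageD by blast
  next
    case False
    define e where "e = Min (insert 1 ((\<lambda>(r, q). vec_defect q x r) ` ?A))"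
    have "e > 0" unfolding e_def
      using fin False nonneg by (subst Min_gr_iff) (auto simp: less_le)
    then obtain r q where rq: "(r, q) \<in> ?A" "vec_defect q x r < e" using small by blast
    have "e \<le> vec_defect q x r" unfolding e_def using fin rq(1) by (intro Min_le) auto
    then show False using rq(2) by simp
  qed
qed

text \<open>A rational close to an integral X has absolute value at most 1, so its reduced
  denominator v is prime to p and vz = u is solvable modulo p^k. Taking the least residue controls
  the height.\<close>

lemma Zp_int_dense:
  assumes X: "X \<in> Zp p"
  obtains r where "0 \<le> r" "r < int p ^ k" "defect p 1 X r \<le> real p powi (- int k)"
proof -
  interpret field "Qp p" by (rule field_Qp[OF p])
  have Xc: "X \<in> carrier (Qp p)" and X1: "padic_norm p X \<le> 1" using X by (auto simp: Zp_def)
  have p1: "real p > 1" using prime_gt_1_nat[OF p] by simp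
  let ?c = "\<lambda>c. padic_null p +>\<^bsub>padic_Cauchy_ring p\<^esub> (\<lambda>_. c)"
  obtain c where c: "padic_norm p (X \<ominus>\<^bsub>Qp p\<^esub> ?c c) \<le> real p powi (- int k)"
    using Qp_rat_dense[OF p Xc, of "real p powi (- int k)"] p1 by auto
  have cc: "?c c \<in> carrier (Qp p)" for c by (intro cls_closed[OF p] padic_Cauchy_const[OF p])
  have "?c c = X \<ominus>\<^bsub>Qp p\<^esub> (X \<ominus>\<^bsub>Qp p\<^esub> ?c c)"
    using Xc cc[of c] by (simp add: a_minus_def minus_add r_neg2)
  then have "padic_abs p c \<le> max (padic_norm p X) (padic_norm p (X \<ominus>\<^bsub>Qp p\<^esub> ?c c))"
    using padic_norm_diff_le[OF p Xc, of "X \<ominus>\<^bsub>Qp p\<^esub> ?c c"] Xc cc[of c]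
    by (metis minus_closed padic_norm_const[OF p])
  moreover have "real p powi (- int k) \<le> real p powi 0" using p1 by (intro power_int_increasing) auto
  ultimately have c1: "padic_abs p c \<le> 1" using X1 c by simp
  obtain u v where uv: "quotient_of c = (u, v)" by fastforce
  have v0: "v > 0" using quotient_of_denom_pos[OF uv] .
  have cop: "coprime u v" using quotient_of_coprime[OF uv] .
  have ce: "c = of_int u / of_int v" using quotient_of_div[OF uv] .
  have pv: "\<not> int p dvd v"
  proof
    assume pv: "int p dvd v"
    have "prime (int p)" using p by simp
    then have pu: "\<not> int p dvd u" using pv cop by (meson coprime_common_divisor not_prime_unit)
    then have "u \<noteq> 0" by auto
    have "padic_abs p (of_int u) = padic_abs p c * padic_abs p (of_int v)"
      unfolding padic_abs_mult[OF p, symmetric] using v0 by (simp add: ce)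
    moreover have "padic_abs p (of_int v) < 1"
      using pv padic_abs_of_int_eq_1_iff[OF p, of v] padic_abs_of_int_le_1[OF p, of v] by simp
    moreover have "padic_abs p (of_int u) = 1" using padic_abs_of_int_eq_1_iff[OF p] pu by simp
    moreover have "padic_abs p (of_int v) \<ge> 0" by simp
    ultimately show False
      using mult_right_mono[OF c1, of "padic_abs p (of_int v)"] by linarith
  qed
  have "coprime v (int p ^ k)"
    using prime_imp_coprime[of "int p" v] pv p by (simp add: coprime_commute)
  then obtain z where z: "[v * z = u] (mod int p ^ k)"
    by (metis cong_solve_coprime_int cong_scalar_right mult.assoc mult.left_neutral mult.commute)
  define r where "r = z mod int p ^ k"
  have r: "0 \<le> r" "r < int p ^ k" using p1 by (auto simp: r_def)
  have "[v * r = u] (mod int p ^ k)" using z by (simp add: r_def cong_def mod_mult_right_eq)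
  then have dv: "int p ^ k dvd u - v * r" by (simp add: cong_iff_dvd_diff dvd_diff_commute)
  have "padic_abs p (c - of_int r) * padic_abs p (of_int v) = padic_abs p (of_int (u - v * r))"
    unfolding padic_abs_mult[OF p, symmetric] using v0 by (intro arg_cong[of _ _ "padic_abs p"]) (simp add: ce field_simps)
  moreover have "padic_abs p (of_int v) = 1" using padic_abs_of_int_eq_1_iff[OF p] pv by simp
  moreover have "padic_abs p (of_int (u - v * r)) \<le> real p powi (- int k)"
    using padic_abs_of_int_le_iff[OF p] dv by blast
  ultimately have "padic_abs p (c - of_int r) \<le> real p powi (- int k)" by simp
  moreover have re: "[r] \<cdot>\<^bsub>Qp p\<^esub> \<one>\<^bsub>Qp p\<^esub> = ?c (of_int r)"
    by (simp add: Qp_one[OF p] Qp_add_pow_int[OF p] padic_Cauchy_const[OF p])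
  ultimately have "padic_norm p (?c c \<ominus>\<^bsub>Qp p\<^esub> [r] \<cdot>\<^bsub>Qp p\<^esub> \<one>\<^bsub>Qp p\<^esub>) \<le> real p powi (- int k)"
    unfolding re by (simp add: Qp_minus[OF p] padic_Cauchy_const[OF p] padic_norm_const[OF p])
  then have "defect p 1 X r \<le> real p powi (- int k)"
    using padic_norm_dist_le[OF p Xc cc[of c], of "[r] \<cdot>\<^bsub>Qp p\<^esub> \<one>\<^bsub>Qp p\<^esub>"] c Xc by simp
  then show ?thesis using r that by blast
qed

section \<open>Powers of p in the denominator, and integral vectors\<close>

lemma padic_power_decompose:
  assumes "q > 0"
  obtains j q' where "q = p ^ j * q'" "\<not> p dvd q'" "q' > 0"
proof -
  obtain q' where q': "q = p ^ multiplicity p q * q'" "\<not> p dvd q'"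
    by (rule multiplicity_decompose'[of q p]) (use assms p in \<open>auto simp: not_prime_unit\<close>)
  moreover have "q' > 0" using q' assms by (cases q') auto
  ultimately show ?thesis using that by blast
qed

text \<open>The gain that makes the covering argument sharp: counting all numerators would only bound
  the dimension by \<open>(n + 1) / (\<tau> - 1)\<close>.\<close>

lemma approximation_numerator_dvd:
  assumes x: "x \<in> Qp_vec p n" and m: "\<And>i. i < n \<Longrightarrow> padic_norm p (x i) \<le> real p ^ m"
    and a: "(r, p ^ j * q') \<in> padic_approximations p n \<tau> x" and \<tau>: "\<tau> \<ge> 1" and i: "i < n"
  shows "int p ^ (j - m) dvd r i"
proof -
  have p1: "real p > 1" using prime_gt_1_nat[OF p] by simp
  let ?q = "p ^ j * q'"
  have q: "?q > 0" and d: "defect p ?q (x i) (r i) < height n r ?q powr - \<tau>"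
    using a i by (auto simp: padic_approximations_iff padic_vec_norm_less_iff)
  have q': "q' \<ge> 1" using q by (cases q') auto
  have "real p ^ j \<le> real ?q" using q' p1 by (simp add: mult_le_cancel_left1)
  also have "\<dots> \<le> height n r ?q" by (rule le_height)
  finally have h: "real p ^ j \<le> height n r ?q" .
  have h1: "height n r ?q \<ge> 1" using h one_le_power[of "real p" j] p1 by linarith
  have "height n r ?q powr - \<tau> \<le> height n r ?q powr - 1" using h1 \<tau> by (intro powr_mono) auto
  also have "\<dots> = inverse (height n r ?q)" using h1 by (simp add: powr_minus)
  also have "\<dots> \<le> inverse (real p ^ j)" using h p1 by (intro le_imp_inverse_le) auto
  also have "\<dots> = real p powi (- int j)" by (simp add: power_int_minus)
  also have "\<dots> \<le> real p powi (- int (j - m))" using p1 by (intro power_int_increasing) auto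
  finally have 1: "height n r ?q powr - \<tau> \<le> real p powi (- int (j - m))" .
  have "padic_abs p (of_nat ?q) = real p powi (- int j) * padic_abs p (of_nat q')"
    unfolding of_nat_mult padic_abs_mult[OF p] padic_abs_p_power[OF p] ..
  also have "\<dots> \<le> real p powi (- int j) * 1"
    using padic_abs_of_int_le_1[OF p, of "int q'"] by (intro mult_left_mono) auto
  finally have "padic_abs p (of_nat ?q) * padic_norm p (x i) \<le> real p powi (- int j) * real p ^ m"
    using m[OF i] by (intro mult_mono padic_norm_nonneg[OF p] Qp_vec_component[OF x i]) auto
  also have "\<dots> = real p powi (int m - int j)" using p1 by (simp add: power_int_diff power_int_minus field_simps)
  finally have 2: "padic_abs p (of_nat ?q) * padic_norm p (x i) \<le> real p powi (int m - int j)" .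
  have "padic_abs p (of_int (r i)) \<le> real p powi (- int (j - m))"
  proof (cases "j \<ge> m")
    case True
    then have e: "real p powi (int m - int j) = real p powi (- int (j - m))" by simp
    have "defect p ?q (x i) (r i) \<le> real p powi (- int (j - m))" using 1 d by linarith
    moreover have "padic_abs p (of_nat ?q) * padic_norm p (x i) \<le> real p powi (- int (j - m))"
      using 2 unfolding e .
    ultimately show ?thesis
      by (intro order_trans[OF padic_abs_le_defect[OF p Qp_vec_component[OF x i], of "r i" ?q]] max.boundedI)
  next
    case False
    then show ?thesis using padic_abs_of_int_le_1[OF p] by simp
  qed
  then show ?thesis by (simp add: padic_abs_of_int_le_iff[OF p])
qed

lemma W_star_Zp_vec:
  assumes \<tau>: "\<tau> \<ge> 1"
  shows "W_star p n \<tau> \<inter> Zp_vec p n = {}"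
proof (rule ccontr)
  assume "W_star p n \<tau> \<inter> Zp_vec p n \<noteq> {}"
  then obtain x where xW: "x \<in> W_star p n \<tau>" and xZ: "x \<in> Zp_vec p n" by blast
  have x: "x \<in> Qp_vec p n" using xW by (simp add: W_star_def)
  have p1: "real p > 1" using prime_gt_1_nat[OF p] by simp
  have xi: "x i \<in> Zp p" if "i < n" for i using xZ that by (auto simp: Zp_vec_def)
  have "infinite {(r, q). (r, q) \<in> padic_approximations p n \<tau> x \<and> \<not> p dvd q}"
  proof (rule infinite_approximations_if_small_defects[OF x])
    show "\<not> p dvd (1 + p * k) * q" if "\<not> p dvd q" for q k
    proof -
      have "\<not> p dvd 1 + p * k"
        using prime_gt_1_nat[OF p] by (subst dvd_add_left_iff) auto
      then show ?thesis unfolding prime_dvd_mult_iff[OF p] using that by blast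
    qed
  next
    fix e :: real assume e: "e > 0"
    show "\<exists>r q. (r, q) \<in> padic_approximations p n \<tau> x \<and> \<not> p dvd q \<and> vec_defect q x r < e"
    proof (cases "\<tau> = 1")
      case True
      obtain k where k: "inverse (real p) ^ k < e" using real_arch_pow_inv[OF e, of "inverse (real p)"] p1
        by (auto simp: inverse_less_1_iff)
      define l where "l = Suc k"
      have "\<forall>i. \<exists>r. i < n \<longrightarrow> 0 \<le> r \<and> r < int p ^ l \<and> defect p 1 (x i) r \<le> real p powi (- int l)"
        using Zp_int_dense[OF xi, of _ l] by metis
      then obtain r0 where r0: "\<And>i. i < n \<Longrightarrow> 0 \<le> r0 i \<and> r0 i < int p ^ l \<and> defect p 1 (x i) (r0 i) \<le> real p powi (- int l)"
        by metis
      define r where "r = (\<lambda>i\<in>{..<n}. r0 i)"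
      have D: "vec_defect 1 x r \<le> real p powi (- int l)"
        unfolding padic_vec_norm_le_iff using r0 by (simp add: r_def)
      have "int p ^ l \<ge> 2"
        using prime_ge_2_nat[OF p] mult_mono[of 2 "int p" 1 "int p ^ k"] by (simp add: l_def)
      then have H: "height n r 1 \<le> real_of_int (int p ^ l - 1)"
        unfolding height_le_iff[OF n] using r0 by (auto simp: r_def)
      have H1: "height n r 1 \<ge> 1" using le_height(1)[of 1 n r] by simp
      have "real p powi (- int l) = inverse (real_of_int (int p ^ l))" by (simp add: power_int_minus)
      also have "\<dots> < inverse (height n r 1)" using H H1 by (intro less_imp_inverse_less) auto
      also have "\<dots> = height n r 1 powr - \<tau>" using True H1 by (simp add: powr_minus)
      finally have "(r, 1) \<in> padic_approximations p n \<tau> x"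
        using D by (simp add: padic_approximations_iff r_def[symmetric]) (auto simp: r_def)
      moreover have "real p powi (- int l) < e"
      proof -
        have "real p powi (- int l) \<le> real p powi (- int k)" using p1 by (intro power_int_increasing) (auto simp: l_def)
        also have "\<dots> = inverse (real p) ^ k" by (simp add: power_int_minus power_inverse)
        finally show ?thesis using k by simp
      qed
      ultimately show ?thesis using D prime_gt_1_nat[OF p] by (intro exI[of _ r] exI[of _ 1]) auto
    next
      case False
      then have \<tau>1: "\<tau> > 1" using \<tau> by simp
      define A where "A = {(r, q). (r, q) \<in> padic_approximations p n \<tau> x \<and> p dvd q}"
      have inf: "infinite A" using xW by (simp add: W_star_def A_def)
      have "\<forall>\<^sub>F t :: nat in sequentially. real t powr (1 - \<tau>) < e"
      proof -
        have "((\<lambda>t :: nat. real t powr (1 - \<tau>)) \<longlongrightarrow> 0) sequentially"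
          using \<tau>1 by (intro tendsto_neg_powr filterlim_real_sequentially) auto
        then show ?thesis using e by (rule order_tendstoD)
      qed
      then obtain t :: nat where t: "t > 0" "real t powr (1 - \<tau>) < e"
        unfolding eventually_sequentially by (metis le_cases less_numeral_extra(1) less_le_trans zero_less_one)
      \<comment> \<open>Only finitely many pairs have height at most t, while A is infinite.\<close>
      have "\<exists>(r, q)\<in>A. height n r q > real t"
      proof (rule ccontr)
        assume "\<not> ?thesis"
        then have le: "height n r q \<le> real_of_int (int t)" if "(r, q) \<in> A" for r q using that by force
        have "A \<subseteq> ({..<n} \<rightarrow>\<^sub>E {- int t..int t}) \<times> {..t}"
        proof
          fix z assume z: "z \<in> A"
          obtain r q where rq: "z = (r, q)" by fastforce
          have ext: "r \<in> {..<n} \<rightarrow>\<^sub>E UNIV" using z rq by (auto simp: A_def padic_approximations_iff)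
          have "\<forall>i<n. \<bar>r i\<bar> \<le> int t" "int q \<le> int t" using le z rq height_le_iff[OF n, of r q "int t"] by auto
          then show "z \<in> ({..<n} \<rightarrow>\<^sub>E {- int t..int t}) \<times> {..t}"
            using ext unfolding rq by (auto simp: PiE_iff abs_le_iff)
        qed
        moreover have "finite (({..<n} \<rightarrow>\<^sub>E {- int t..int t}) \<times> {..t})" by (intro finite_cartesian_product finite_PiE) auto
        ultimately show False using inf finite_subset by blast
      qed
      then obtain r q where rq: "(r, q) \<in> A" and ht: "height n r q > real t" by blast
      have a: "(r, q) \<in> padic_approximations p n \<tau> x" using rq by (simp add: A_def)
      then have q0: "q > 0" by (simp add: padic_approximations_iff)
      obtain j q' where q: "q = p ^ j * q'" "\<not> p dvd q'" "q' > 0" by (rule padic_power_decompose[OF q0])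
      have dv: "int p ^ j dvd r i" if "i < n" for i
        using approximation_numerator_dvd[OF x, of 0 r j q' \<tau> i] xi a \<tau> that by (auto simp: q(1) Zp_def)
      define r' where "r' = (\<lambda>i\<in>{..<n}. r i div int p ^ j)"
      have rr': "r i = int (p ^ j) * r' i" if "i < n" for i using dv that by (simp add: r'_def)
      have H: "real (p ^ j) * height n r' q' \<le> height n r q"
        unfolding q(1) using rr' by (rule height_multiple_ge[OF n])
      have H': "height n r' q' \<ge> 1" using le_height(1)[of q' n r'] q(3) by linarith
      have pj: "real (p ^ j) \<ge> 1" using p1 by simp
      have D: "vec_defect q' x r' < real (p ^ j) * height n r q powr - \<tau>"
        unfolding padic_vec_norm_less_iff
      proof (intro allI impI)
        fix i assume i: "i < n"
        have e: "defect p q (x i) (r i) = real p powi (- int j) * defect p q' (x i) (r' i)"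
          unfolding q(1) rr'[OF i] padic_abs_p_power[OF p, symmetric]
          by (rule defect_multiple[OF p Qp_vec_component[OF x i]])
        have "defect p q (x i) (r i) < height n r q powr - \<tau>"
          using a i by (simp add: padic_approximations_iff padic_vec_norm_less_iff)
        then have "real p ^ j * defect p q (x i) (r i) < real p ^ j * height n r q powr - \<tau>"
          using p1 by (intro mult_strict_left_mono) auto
        moreover have "real p ^ j * defect p q (x i) (r i) = defect p q' (x i) (r' i)"
          unfolding e using p1 by (simp add: power_int_minus)
        ultimately show "defect p q' (x i) (r' i) < real (p ^ j) * height n r q powr - \<tau>"
          by (simp only: of_nat_power)
      qed
      have Hpos: "height n r q > 0" using ht by (meson of_nat_0_le_iff le_less_trans)
      \<comment> \<open>Cancelling multiplies the defect by p^j and divides the height by at least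
        p^j, so for \<tau> \<ge> 1 the result is again an approximation.\<close>
      have "real (p ^ j) * height n r q powr - \<tau> \<le> height n r' q' powr - \<tau>"
      proof -
        have "0 < real (p ^ j) * height n r' q'" using H' p1 by (intro mult_pos_pos) auto
        then have "height n r q powr - \<tau> \<le> (real (p ^ j) * height n r' q') powr - \<tau>"
          using H \<tau> by (intro powr_mono2') auto
        also have "\<dots> = real (p ^ j) powr - \<tau> * height n r' q' powr - \<tau>" using H' by (simp add: powr_mult)
        also have "\<dots> \<le> real (p ^ j) powr - 1 * height n r' q' powr - \<tau>"
          using pj \<tau> by (intro mult_right_mono powr_mono) auto
        finally have "real (p ^ j) * height n r q powr - \<tau>
            \<le> real (p ^ j) * (real (p ^ j) powr - 1 * height n r' q' powr - \<tau>)"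
          by (intro mult_left_mono) auto
        also have "\<dots> = height n r' q' powr - \<tau>"
          using p1 by (simp add: powr_minus del: of_nat_power)
        finally show ?thesis .
      qed
      then have a': "(r', q') \<in> padic_approximations p n \<tau> x"
        using D q(3) by (simp add: padic_approximations_iff) (auto simp: r'_def)
      \<comment> \<open>Since p^j is at most the old height H, the new defect is below H^(1 -
        \<tau>), which is small for large H because \<tau> > 1.\<close>
      have "real (p ^ j) \<le> real (p ^ j) * height n r' q'" using H' pj by (simp add: mult_le_cancel_left1)
      then have "real (p ^ j) \<le> height n r q" using H by linarith
      then have "real (p ^ j) * height n r q powr - \<tau> \<le> height n r q * height n r q powr - \<tau>"
        by (intro mult_right_mono) auto
      also have "\<dots> = height n r q powr (1 - \<tau>)" using Hpos by (simp add: powr_mult_base)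
      also have "\<dots> \<le> real t powr (1 - \<tau>)" using ht t \<tau> by (intro powr_mono2') auto
      finally have "vec_defect q' x r' < e" using D t(2) by linarith
      then show ?thesis using a' q(2) by blast
    qed
  qed
  then show False using xW by (simp add: W_star_def)
qed

end

section \<open>The upper bound\<close>

lemma summable_on_Times_mult:
  fixes f :: "'a \<Rightarrow> real" and g :: "'b \<Rightarrow> real"
  assumes f: "f summable_on A" "\<And>a. a \<in> A \<Longrightarrow> f a \<ge> 0"
    and g: "g summable_on B" "\<And>b. b \<in> B \<Longrightarrow> g b \<ge> 0"
  shows "(\<lambda>(a, b). f a * g b) summable_on A \<times> B"
proof (rule summable_on_SigmaI)
  show "((\<lambda>b. case (a, b) of (a, b) \<Rightarrow> f a * g b) has_sum f a * infsum g B) B" for a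
    using has_sum_cmult_right[OF has_sum_infsum[OF g(1)], of "f a"] by simp
  show "(\<lambda>a. f a * infsum g B) summable_on A" by (rule summable_on_cmult_left) (rule f)
qed (use f g in auto)

text \<open>A finite set of vectors lies in the box spanned by its coordinate projections, and over
  a box the sum of products is a product of sums.\<close>

lemma summable_on_prod_PiE:
  fixes f :: "'a \<Rightarrow> real"
  assumes I: "finite I" and f: "f summable_on A" "\<And>a. a \<in> A \<Longrightarrow> f a \<ge> 0"
  shows "(\<lambda>r. \<Prod>i\<in>I. f (r i)) summable_on (I \<rightarrow>\<^sub>E A)"
proof (rule nonneg_bdd_above_summable_on)
  show "(\<Prod>i\<in>I. f (r i)) \<ge> 0" if "r \<in> I \<rightarrow>\<^sub>E A" for r
    using that f(2) by (intro prod_nonneg) auto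
  show "bdd_above (sum (\<lambda>r. \<Prod>i\<in>I. f (r i)) ` {F. F \<subseteq> I \<rightarrow>\<^sub>E A \<and> finite F})"
  proof (rule bdd_aboveI2)
    fix F assume "F \<in> {F. F \<subseteq> I \<rightarrow>\<^sub>E A \<and> finite F}"
    then have F: "F \<subseteq> I \<rightarrow>\<^sub>E A" "finite F" by auto
    define G where "G i = (\<lambda>r. r i) ` F" for i
    have G: "finite (G i)" "i \<in> I \<Longrightarrow> G i \<subseteq> A" for i using F by (auto simp: G_def)
    have sub: "F \<subseteq> Pi\<^sub>E I G"
    proof
      fix r assume r: "r \<in> F"
      then have "r \<in> I \<rightarrow>\<^sub>E A" using F by blast
      then show "r \<in> Pi\<^sub>E I G" using r by (simp add: PiE_iff G_def)
    qed
    have "(\<Sum>r\<in>F. \<Prod>i\<in>I. f (r i)) \<le> (\<Sum>r\<in>Pi\<^sub>E I G. \<Prod>i\<in>I. f (r i))"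
    proof (rule sum_mono2[OF _ sub])
      show "finite (Pi\<^sub>E I G)" using I G by (intro finite_PiE) auto
      show "0 \<le> (\<Prod>i\<in>I. f (r i))" if "r \<in> Pi\<^sub>E I G - F" for r
      proof (rule prod_nonneg)
        fix i assume i: "i \<in> I"
        then have "r i \<in> A" using that G(2)[OF i] by (auto simp: PiE_iff)
        then show "0 \<le> f (r i)" by (rule f(2))
      qed
    qed
    also have "\<dots> = (\<Prod>i\<in>I. \<Sum>a\<in>G i. f a)"
      using I G by (intro prod_sum_PiE[symmetric]) auto
    also have "\<dots> \<le> (\<Prod>i\<in>I. infsum f A)"
    proof (rule prod_mono, intro conjI)
      fix i assume i: "i \<in> I"
      show "0 \<le> (\<Sum>a\<in>G i. f a)" using f(2) G(2)[OF i] by (intro sum_nonneg) auto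
      show "(\<Sum>a\<in>G i. f a) \<le> infsum f A"
        using f G i by (intro finite_sum_le_infsum) auto
    qed
    finally show "(\<Sum>r\<in>F. \<Prod>i\<in>I. f (r i)) \<le> (\<Prod>i\<in>I. infsum f A)" .
  qed
qed

lemma nat_powr_summable_on:
  assumes "\<sigma> > 1" shows "(\<lambda>q :: nat. real q powr - \<sigma>) summable_on UNIV"
proof (rule norm_summable_imp_summable_on)
  show "summable (\<lambda>q. norm (real q powr - \<sigma>))"
    using assms by (simp add: summable_real_powr_iff)
qed

text \<open>The cut-off at 1 matters: \<open>0 powr - \<sigma>\<close> is 0, and a vanishing factor
  would spoil the product that dominates the powers of the height.\<close>

lemma int_powr_summable_on:
  assumes "\<sigma> > 1" shows "(\<lambda>z :: int. real_of_int (max 1 \<bar>z\<bar>) powr - \<sigma>) summable_on UNIV"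
proof -
  let ?f = "\<lambda>z :: int. real_of_int (max 1 \<bar>z\<bar>) powr - \<sigma>"
  define g where "g k = - int k - 1" for k :: nat
  define h where "h k = int (Suc k)" for k :: nat
  have s: "(\<lambda>k. real (Suc k) powr - \<sigma>) summable_on UNIV"
    using summable_on_reindex[of Suc UNIV "\<lambda>q. real q powr - \<sigma>"]
      summable_on_subset_banach[OF nat_powr_summable_on[OF assms], of "range Suc"]
    by (simp add: comp_def)
  have "?f \<circ> g = (\<lambda>k. real (Suc k) powr - \<sigma>)" by (auto simp: g_def fun_eq_iff max_def)
  then have 1: "?f summable_on range g"
    using s summable_on_reindex[of g UNIV ?f] by (simp add: inj_def g_def)
  have "?f \<circ> h = (\<lambda>k. real (Suc k) powr - \<sigma>)" by (auto simp: h_def fun_eq_iff max_def)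
  then have 2: "?f summable_on range h"
    using s summable_on_reindex[of h UNIV ?f] by (simp add: inj_def h_def)
  have "UNIV = insert 0 (range g \<union> range h)"
  proof -
    have "z = 0 \<or> z \<in> range g \<or> z \<in> range h" for z
    proof -
      have "z = g (nat (- z - 1))" if "z < 0" using that by (simp add: g_def)
      moreover have "z = h (nat (z - 1))" if "z > 0" using that by (simp add: h_def)
      ultimately show ?thesis by (metis linorder_neqE rangeI)
    qed
    then show ?thesis by blast
  qed
  moreover have "?f summable_on insert 0 (range g \<union> range h)"
    unfolding summable_on_insert_iff
    by (rule summable_on_Un_disjoint[OF 1 2]) (auto simp: g_def h_def)
  ultimately show ?thesis by simp
qed

section \<open>Covering by approximation balls\<close>

context
  fixes p n :: nat
  assumes p: "prime p" and n: "n \<ge> 1"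
begin

text \<open>The height dominates all n+1 coordinates, so its exponent can be shared equally among
  them. The sum over pairs then factors, which replaces a count of the pairs of given
  height.\<close>

lemma height_powr_le_prod:
  assumes q: "q > 0" and \<sigma>: "\<sigma> \<ge> 0"
  shows "height n r q powr (- (real n + 1) * \<sigma>)
    \<le> (\<Prod>i<n. real_of_int (max 1 \<bar>r i\<bar>) powr - \<sigma>) * real q powr - \<sigma>"
proof -
  have H1: "height n r q \<ge> 1" using le_height(1)[of q n r] q by linarith
  have "height n r q powr - \<sigma> \<le> real_of_int (max 1 \<bar>r i\<bar>) powr - \<sigma>" if "i < n" for i
    using H1 le_height(2)[OF that, of r q] \<sigma> by (intro powr_mono2') auto
  then have "(\<Prod>i<n. height n r q powr - \<sigma>) \<le> (\<Prod>i<n. real_of_int (max 1 \<bar>r i\<bar>) powr - \<sigma>)"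
    by (intro prod_mono) auto
  moreover have "height n r q powr - \<sigma> \<le> real q powr - \<sigma>"
    using le_height(1)[of q n r] q \<sigma> by (intro powr_mono2') auto
  ultimately have "(\<Prod>i<n. height n r q powr - \<sigma>) * height n r q powr - \<sigma>
      \<le> (\<Prod>i<n. real_of_int (max 1 \<bar>r i\<bar>) powr - \<sigma>) * real q powr - \<sigma>"
    by (intro mult_mono prod_nonneg) auto
  moreover have "(\<Prod>i<n. height n r q powr - \<sigma>) * height n r q powr - \<sigma> = height n r q powr (- (real n + 1) * \<sigma>)"
  proof -
    have "(\<Prod>i<n. height n r q powr - \<sigma>) = height n r q powr (real n * - \<sigma>)"
      using H1 powr_realpow[of "height n r q powr - \<sigma>" n] by (simp add: powr_powr mult.commute)
    then show ?thesis by (simp add: powr_add[symmetric] algebra_simps)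
  qed
  ultimately show ?thesis by simp
qed

text \<open>A denominator p^j q with q prime to p gives a ball of radius p^j H^(-\<tau>), where H is
  at least p^(j-m) times the height of the reduced pair. The sum of the s-th powers splits into a
  geometric series in j with ratio p^((1-\<tau>)s) and a sum over reduced pairs with exponent \<tau>
  s > n+1.\<close>

lemma hausdorff_measure_W_star_eq_0:
  assumes \<tau>: "\<tau> > 1" and s: "s > (real n + 1) / \<tau>"
  shows "Metric_space.hausdorff_measure (Qp_vec p n) (padic_vec_dist p n) s (W_star p n \<tau>) = 0"
proof -
  interpret Metric_space "Qp_vec p n" "padic_vec_dist p n" by (rule Metric_space_Qp_vec[OF p n])
  have p1: "real p > 1" using prime_gt_1_nat[OF p] by simp
  have "(real n + 1) / \<tau> > 0" using \<tau> by simp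
  then have s0: "s > 0" using s by linarith
  define Z where "Z = {(r, q, j :: nat). r \<in> {..<n} \<rightarrow>\<^sub>E (UNIV :: int set) \<and> q > 0 \<and> \<not> p dvd q}"
  \<comment> \<open>The subtraction is truncated: for j \<le> m a point of norm p^m imposes no
    divisibility, and the factor is 1.\<close>
  define R where "R m r j = (\<lambda>i\<in>{..<n}. int (p ^ (j - m)) * r i)" for m r j
  define B where "B m = (\<lambda>(r, q, j). {x \<in> Qp_vec p n. (R m r j, p ^ j * q) \<in> padic_approximations p n \<tau> x})" for m
  define \<rho> where "\<rho> m = (\<lambda>(r, q, j). real p ^ j * height n (R m r j) (p ^ j * q) powr - \<tau>)" for m
  show ?thesis
  proof (rule hausdorff_measure_Cantelli[OF s0, where Z = Z and B = B and \<rho> = \<rho>])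
    have "countable (({..<n} \<rightarrow>\<^sub>E (UNIV :: int set)) \<times> (UNIV :: nat set) \<times> (UNIV :: nat set))"
      by (intro countable_SIGMA countable_PiE) auto
    then show "countable Z" by (rule countable_subset[rotated]) (auto simp: Z_def)
    show "B m z \<subseteq> Qp_vec p n" for m z by (auto simp: B_def split: prod.splits)
  next
    fix m z x y assume z: "z \<in> Z" and xB: "x \<in> B m z" and yB: "y \<in> B m z"
    obtain r q j where zz: "z = (r, q, j)" by (cases z)
    have q: "\<not> p dvd q" using z by (simp add: zz Z_def)
    have x: "x \<in> Qp_vec p n" and y: "y \<in> Qp_vec p n" using xB yB by (auto simp: B_def zz)
    let ?H = "height n (R m r j) (p ^ j * q) powr - \<tau>"
    have a: "padic_abs p (of_nat (p ^ j * q)) = inverse (real p ^ j)"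
    proof -
      have "padic_abs p (of_nat q) = 1" using padic_abs_of_int_eq_1_iff[OF p, of "int q"] q by simp
      then show ?thesis
        unfolding of_nat_mult[of "p ^ j" q] padic_abs_mult[OF p] padic_abs_p_power[OF p]
        by (simp add: power_int_minus)
    qed
    show "padic_vec_dist p n x y \<le> \<rho> m z"
      unfolding padic_vec_dist_le_iff[OF p n x y]
    proof (intro allI impI)
      fix i assume i: "i < n"
      have "defect p (p ^ j * q) (w i) (R m r j i) \<le> ?H" if "w \<in> B m z" for w
        using that i by (auto simp: B_def zz padic_approximations_iff[OF p n] padic_vec_norm_less_iff[OF p n] less_imp_le)
      then have "padic_abs p (of_nat (p ^ j * q)) * padic_norm p (x i \<ominus>\<^bsub>Qp p\<^esub> y i) \<le> ?H"
        using xB yB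
        by (intro order_trans[OF padic_norm_diff_le_defect[OF p Qp_vec_component[OF p n x i] Qp_vec_component[OF p n y i], of _ "R m r j i"]]
            max.boundedI)
      then show "padic_norm p (x i \<ominus>\<^bsub>Qp p\<^esub> y i) \<le> \<rho> m z"
        unfolding a \<rho>_def zz using p1 by (simp add: field_simps)
    qed
  next
    fix m
    \<comment> \<open>The share of the exponent \<tau> s that falls to each of the n+1 coordinates;
      it exceeds 1 exactly when s > (n+1)/\<tau>.\<close>
    define \<sigma> where "\<sigma> = \<tau> * s / (real n + 1)"
    have \<sigma>: "\<sigma> > 1" using s \<tau> by (simp add: \<sigma>_def field_simps)
    define u where "u = real p powr ((1 - \<tau>) * s)"
    have u: "0 < u" "u < 1" using p1 \<tau> s0 powr_less_mono[of "(1 - \<tau>) * s" 0 "real p"]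
      by (auto simp: u_def mult_neg_pos)
    define K where "K = real p powr (real m * \<tau> * s)"
    define g where "g = (\<lambda>(r :: nat \<Rightarrow> int, q :: nat, j :: nat).
      K * ((\<Prod>i<n. real_of_int (max 1 \<bar>r i\<bar>) powr - \<sigma>) * (real q powr - \<sigma> * u ^ j)))"
    have "(\<lambda>j. u ^ j) summable_on UNIV"
      using u by (intro norm_summable_imp_summable_on) (auto intro: summable_geometric)
    from summable_on_Times_mult[OF nat_powr_summable_on[OF \<sigma>] _ this] u
    have "(\<lambda>(q, j). real q powr - \<sigma> * u ^ j) summable_on UNIV \<times> UNIV" by simp
    from summable_on_Times_mult[OF summable_on_prod_PiE[OF _ int_powr_summable_on[OF \<sigma>]] _ this, of "{..<n}"] u
    have "(\<lambda>(r, z). (\<Prod>i<n. real_of_int (max 1 \<bar>r i\<bar>) powr - \<sigma>) * (case z of (q, j) \<Rightarrow> real q powr - \<sigma> * u ^ j))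
        summable_on ({..<n} \<rightarrow>\<^sub>E UNIV) \<times> UNIV \<times> UNIV"
      by (simp add: prod_nonneg case_prod_unfold)
    from summable_on_cmult_right[OF this, of K]
    have "g summable_on ({..<n} \<rightarrow>\<^sub>E UNIV) \<times> UNIV \<times> UNIV"
      by (simp add: g_def case_prod_unfold)
    then have g: "g summable_on Z" by (rule summable_on_subset_banach) (auto simp: Z_def)
    show "(\<lambda>z. \<rho> m z powr s) summable_on Z"
    proof (rule summable_on_comparison_test[OF g])
      fix z assume z: "z \<in> Z"
      obtain r q j where zz: "z = (r, q, j)" by (cases z)
      have q: "q > 0" using z by (simp add: zz Z_def)
      let ?H = "height n (R m r j) (p ^ j * q)"
      have H1: "height n r q \<ge> 1" using le_height(1)[of q n r] q by linarith
      have "real (p ^ (j - m)) * height n r q \<le> height n (R m r j) (p ^ (j - m) * q)"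
        by (rule height_multiple_ge[OF n]) (simp add: R_def)
      also have "\<dots> \<le> ?H"
      proof -
        have "p ^ (j - m) * q \<le> p ^ j * q" using prime_gt_1_nat[OF p] by (intro mult_right_mono power_increasing) auto
        then have "int (p ^ (j - m) * q) \<le> int (p ^ j * q)" by (simp only: of_nat_le_iff)
        then show ?thesis unfolding height_def of_int_le_iff by (rule max.mono[OF order_refl])
      qed
      finally have H: "real (p ^ (j - m)) * height n r q \<le> ?H" .
      \<comment> \<open>The real exponent may be negative, which bounds the truncated power from
        below in both cases and makes the dependence on j purely geometric.\<close>
      have "real p powr (real j - real m) \<le> real p powr real (j - m)" using p1 by (intro powr_mono) auto
      also have "\<dots> = real (p ^ (j - m))" using p1 by (simp add: powr_realpow)
      finally have "real p powr (real j - real m) * height n r q \<le> ?H"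
        using H H1 by (meson mult_right_mono order_trans zero_le_one)
      moreover have "0 < real p powr (real j - real m) * height n r q"
        using p1 H1 by (intro mult_pos_pos) auto
      ultimately have "?H powr - \<tau> \<le> (real p powr (real j - real m) * height n r q) powr - \<tau>"
        using \<tau> by (intro powr_mono2') auto
      then have "\<rho> m z \<le> real p ^ j * (real p powr (real j - real m) * height n r q) powr - \<tau>"
        using p1 by (simp add: \<rho>_def zz)
      then have "\<rho> m z powr s \<le> (real p ^ j * (real p powr (real j - real m) * height n r q) powr - \<tau>) powr s"
        using s0 p1 by (intro powr_mono2) (auto simp: \<rho>_def zz)
      also have "\<dots> = (real p powr real j * real p powr ((real j - real m) * - \<tau>)) powr s * height n r q powr (- \<tau> * s)"
        using p1 H1 by (simp add: powr_mult powr_powr powr_realpow mult.assoc)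
      also have "real p powr real j * real p powr ((real j - real m) * - \<tau>) = real p powr (real m * \<tau> + (1 - \<tau>) * real j)"
        by (simp add: algebra_simps flip: powr_add)
      also have "(real p powr (real m * \<tau> + (1 - \<tau>) * real j)) powr s = K * u ^ j"
        using p1 by (simp add: K_def u_def powr_powr algebra_simps flip: powr_realpow powr_add)
      also have "- \<tau> * s = - (real n + 1) * \<sigma>"
      proof -
        have "real n + 1 \<noteq> 0" by linarith
        then have "(real n + 1) * \<sigma> = \<tau> * s" unfolding \<sigma>_def by simp
        then show ?thesis by (simp only: mult_minus_left)
      qed
      also have "K * u ^ j * height n r q powr (- (real n + 1) * \<sigma>)
          \<le> K * u ^ j * ((\<Prod>i<n. real_of_int (max 1 \<bar>r i\<bar>) powr - \<sigma>) * real q powr - \<sigma>)"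
        using height_powr_le_prod[OF q, of \<sigma> r] \<sigma> u by (intro mult_left_mono) (auto simp: K_def)
      also have "\<dots> = g z" by (simp add: g_def zz)
      finally show "\<rho> m z powr s \<le> g z" .
    qed simp
  next
    fix x assume xW: "x \<in> W_star p n \<tau>"
    then have x: "x \<in> Qp_vec p n" by (simp add: W_star_def)
    obtain m where m: "padic_vec_norm p n x \<le> real p ^ m"
      using real_arch_pow[OF p1, of "padic_vec_norm p n x"] less_imp_le by blast
    have xm: "padic_norm p (x i) \<le> real p ^ m" if "i < n" for i
      using m that by (simp add: padic_vec_norm_le_iff[OF p n])
    define S where "S = {(r, q). (r, q) \<in> padic_approximations p n \<tau> x \<and> p dvd q}"
    have "S \<subseteq> (\<lambda>(r, q, j). (R m r j, p ^ j * q)) ` {z \<in> Z. x \<in> B m z}"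
    proof
      fix z assume z: "z \<in> S"
      obtain r q where zz: "z = (r, q)" by fastforce
      have a: "(r, q) \<in> padic_approximations p n \<tau> x" using z by (simp add: S_def zz)
      then have q0: "q > 0" and ext: "r \<in> {..<n} \<rightarrow>\<^sub>E UNIV" by (auto simp: padic_approximations_iff[OF p n])
      obtain j q' where q: "q = p ^ j * q'" "\<not> p dvd q'" "q' > 0" by (rule padic_power_decompose[OF p n q0])
      have dv: "int p ^ (j - m) dvd r i" if "i < n" for i
        using approximation_numerator_dvd[OF p n x xm _ _ that, of r j q' \<tau>] a \<tau> by (simp add: q(1))
      define r' where "r' = (\<lambda>i\<in>{..<n}. r i div int p ^ (j - m))"
      have "R m r' j = r"
      proof
        fix i show "R m r' j i = r i"
          using dv[of i] ext by (cases "i < n") (auto simp: R_def r'_def PiE_iff extensional_def)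
      qed
      then show "z \<in> (\<lambda>(r, q, j). (R m r j, p ^ j * q)) ` {z \<in> Z. x \<in> B m z}"
        using q x a by (intro image_eqI[of _ _ "(r', q', j)"]) (auto simp: zz Z_def B_def r'_def)
    qed
    moreover have "infinite S" using xW by (simp add: W_star_def S_def)
    ultimately have "infinite {z \<in> Z. x \<in> B m z}" using finite_surj by blast
    then show "\<exists>m. infinite {z \<in> Z. x \<in> B m z}" by blast
  qed
qed

end

section \<open>Rational points in residue classes\<close>

definition residue_vecs :: "nat \<Rightarrow> nat \<Rightarrow> nat \<Rightarrow> (nat \<Rightarrow> int) set" where
  "residue_vecs p n k = {..<n} \<rightarrow>\<^sub>E {0..<int p ^ k}"

lemma finite_residue_vecs: "finite (residue_vecs p n k)"
  unfolding residue_vecs_def by (intro finite_PiE) auto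

lemma card_residue_vecs: "card (residue_vecs p n k) = p ^ (k * n)"
  by (simp add: residue_vecs_def card_PiE power_mult flip: of_nat_power)

lemma int_div_bounds:
  fixes y a b :: int
  assumes "0 \<le> y" "y < a * b" "b > 0"
  shows "0 \<le> y div b \<and> y div b < a"
proof
  show "0 \<le> y div b" using assms by (simp add: pos_imp_zdiv_nonneg_iff)
  have "b * (y div b) \<le> y" using mult_div_mod_eq[of b y] pos_mod_sign[of b y] assms(3) by linarith
  then have "b * (y div b) < b * a" using assms(2) by (simp add: mult.commute)
  then show "y div b < a" using assms(3) by simp
qed

text \<open>Dirichlet's theorem for the modulus \<open>p ^ ((n + 1) * T)\<close> provides solutions of height
  \<open>p ^ (n * T)\<close>; the slack \<open>3 * n\<close> in the exponent leaves room for dividing out powers of \<open>p\<close>.\<close>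

definition rational_residues :: "nat \<Rightarrow> nat \<Rightarrow> nat \<Rightarrow> (nat \<Rightarrow> int) set" where
  "rational_residues p n T = {u \<in> residue_vecs p n ((n + 1) * T - 3 * n).
     \<exists>q s. 0 < q \<and> q \<le> int p ^ (n * T) \<and> \<not> int p dvd q \<and>
       (\<forall>i<n. \<bar>s i\<bar> \<le> int p ^ (n * T) \<and> [s i = q * u i] (mod int p ^ ((n + 1) * T - 3 * n)))}"

section \<open>Dirichlet solutions and the powers of p in their denominators\<close>

context
  fixes p n :: nat
  assumes p: "prime p" and n: "n \<ge> 1"
begin

lemma coprime_prime_power: "\<not> int p dvd q \<Longrightarrow> coprime q (int p ^ k)"
  using prime_imp_coprime[of "int p" q] p by (simp add: coprime_commute)

text \<open>With N = p^(nT) there are (N+1)^(n+1) pairs (v, q) but only N^(n+1) residue vectors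
  modulo p^((n+1)T); the exponents are matched to make the latter count exact. The difference of two
  colliding pairs is the solution.\<close>

lemma Dirichlet_padic:
  assumes T: "T \<ge> 1"
  obtains q s where "0 < q" "q \<le> int p ^ (n * T)"
    "\<And>i. i < n \<Longrightarrow> \<bar>s i\<bar> \<le> int p ^ (n * T) \<and> [s i = q * y i] (mod int p ^ ((n + 1) * T))"
proof -
  define N where "N = int p ^ (n * T)"
  define P where "P = int p ^ ((n + 1) * T)"
  have p1: "int p > 1" using prime_gt_1_nat[OF p] by simp
  have P0: "P > 0" using p1 by (simp add: P_def)
  have NP: "N < P" unfolding N_def P_def using T p1 by (intro power_strict_increasing) auto
  have N0: "N > 0" using p1 by (simp add: N_def)
  define D where "D = ({..<n} \<rightarrow>\<^sub>E {0..N}) \<times> {0..N}"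
  define \<phi> where "\<phi> = (\<lambda>(v, q). \<lambda>i\<in>{..<n}. (v i - q * y i) mod P)"
  have "card D = nat (N + 1) ^ n * nat (N + 1)"
    by (simp add: D_def card_cartesian_product card_PiE)
  also have "\<dots> = nat (N + 1) ^ (n + 1)" by simp
  also have "\<dots> > nat N ^ (n + 1)" using N0 by (intro power_strict_mono) auto
  also have "nat N ^ (n + 1) = p ^ ((n + 1) * T * n)"
    by (simp add: N_def nat_power_eq power_mult[symmetric] algebra_simps flip: power_Suc)
  finally have lt: "card (residue_vecs p n ((n + 1) * T)) < card D" by (simp add: card_residue_vecs)
  have sub: "\<phi> ` D \<subseteq> residue_vecs p n ((n + 1) * T)"
  proof (rule image_subsetI)
    fix z
    have "(v - q * y i) mod P \<in> {0..<P}" for v q i using P0 by simp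
    then show "\<phi> z \<in> residue_vecs p n ((n + 1) * T)"
      unfolding residue_vecs_def P_def[symmetric] \<phi>_def by (cases z) simp
  qed
  have "\<not> inj_on \<phi> D"
  proof
    assume "inj_on \<phi> D"
    then have "card D \<le> card (residue_vecs p n ((n + 1) * T))"
      by (rule card_inj_on_le[OF _ sub finite_residue_vecs])
    then show False using lt by simp
  qed
  then obtain z z' where z: "z \<in> D" "z' \<in> D" "\<phi> z = \<phi> z'" "z \<noteq> z'" by (auto simp: inj_on_def)
  note conclude = that
  have main: thesis if D: "(v, q) \<in> D" "(v', q') \<in> D" and eq: "\<phi> (v, q) = \<phi> (v', q')" and gt: "q' < q"
    for v q v' q'
  proof (rule conclude[of "q - q'" "\<lambda>i. v i - v' i"])
    show "0 < q - q'" "q - q' \<le> int p ^ (n * T)" using gt D by (auto simp: D_def N_def)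
    fix i assume i: "i < n"
    have "(v i - q * y i) mod P = (v' i - q' * y i) mod P"
      using fun_cong[OF eq, of i] i by (simp add: \<phi>_def)
    then have "P dvd (v i - q * y i) - (v' i - q' * y i)" by (simp add: mod_eq_dvd_iff)
    then have "[v i - v' i = (q - q') * y i] (mod P)"
      by (simp add: cong_iff_dvd_diff algebra_simps)
    moreover have "v i \<in> {0..N}" "v' i \<in> {0..N}" using D i by (auto simp: D_def PiE_iff)
    ultimately show "\<bar>v i - v' i\<bar> \<le> int p ^ (n * T) \<and> [v i - v' i = (q - q') * y i] (mod int p ^ ((n + 1) * T))"
      by (auto simp: N_def P_def)
  qed
  obtain v q v' q' where zz: "z = (v, q)" "z' = (v', q')" by fastforce
  \<comment> \<open>Equal denominators would make P divide differences of size at most N < P, and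
    the two pairs would coincide.\<close>
  have "q \<noteq> q'"
  proof
    assume q: "q = q'"
    have "v i = v' i" if i: "i < n" for i
    proof (rule ccontr)
      assume ne: "v i \<noteq> v' i"
      have "(v i - q * y i) mod P = (v' i - q' * y i) mod P"
        using fun_cong[OF z(3), of i] i by (simp add: \<phi>_def zz)
      then have "P dvd v i - v' i" by (simp add: mod_eq_dvd_iff q)
      then have "\<bar>P\<bar> \<le> \<bar>v i - v' i\<bar>" using ne by (intro dvd_imp_le_int) auto
      moreover have "v i \<in> {0..N}" "v' i \<in> {0..N}" using z(1,2) i by (auto simp: D_def PiE_iff zz)
      ultimately show False using NP P0 by auto
    qed
    then have "v = v'" using z(1,2) by (intro PiE_ext[of v "{..<n}" _ v']) (auto simp: D_def zz)
    then show False using z(4) q by (simp add: zz)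
  qed
  then show thesis using main[of v q v' q'] main[of v' q' v q] z by (cases "q' < q") (auto simp: zz)
qed

text \<open>As q is invertible, s determines y modulo p^(A-j), and only the j highest digits of each
  coordinate remain free. Besides the count of Dirichlet solutions, the case q = 1 bounds the number
  of children of the tree in a ball.\<close>

lemma card_linear_congruences_le:
  assumes q: "\<not> int p dvd q" and jA: "j \<le> A"
  shows "card {y \<in> residue_vecs p n A. \<forall>i<n. [s i = q * y i] (mod int p ^ (A - j))} \<le> p ^ (j * n)"
    (is "card ?Y \<le> _")
proof -
  define P where "P = int p ^ (A - j)"
  have P0: "P > 0" using prime_gt_0_nat[OF p] by (simp add: P_def)
  have PA: "int p ^ A = int p ^ j * P" unfolding P_def using jA by (simp flip: power_add)
  define \<psi> where "\<psi> y = (\<lambda>i\<in>{..<n}. y i div P)" for y :: "nat \<Rightarrow> int"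
  have "inj_on \<psi> ?Y"
  proof (rule inj_onI)
    fix y y' assume y: "y \<in> ?Y" and y': "y' \<in> ?Y" and eq: "\<psi> y = \<psi> y'"
    have "y i = y' i" if i: "i < n" for i
    proof -
      have "[s i = q * y i] (mod P)" "[s i = q * y' i] (mod P)" using y y' i by (auto simp: P_def)
      then have "[q * y i = q * y' i] (mod P)" using cong_sym cong_trans by blast
      then have "[y i = y' i] (mod P)"
        unfolding P_def cong_mult_lcancel[OF coprime_prime_power[OF q]] .
      then have "y i mod P = y' i mod P" by (simp add: cong_def)
      moreover have "y i div P = y' i div P" using fun_cong[OF eq, of i] i by (simp add: \<psi>_def)
      ultimately show ?thesis by (metis mult_div_mod_eq)
    qed
    then show "y = y'" using y y' by (intro PiE_ext[of y "{..<n}" _ y']) (auto simp: residue_vecs_def)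
  qed
  moreover have "\<psi> ` ?Y \<subseteq> residue_vecs p n j"
  proof
    fix w assume "w \<in> \<psi> ` ?Y"
    then obtain y where y: "y \<in> ?Y" "w = \<psi> y" by blast
    have "0 \<le> y i div P \<and> y i div P < int p ^ j" if "i < n" for i
    proof -
      have "0 \<le> y i" "y i < int p ^ j * P" using y(1) that PA by (auto simp: residue_vecs_def PiE_iff)
      then show ?thesis using P0 by (rule int_div_bounds)
    qed
    then show "w \<in> residue_vecs p n j" by (auto simp: y(2) \<psi>_def residue_vecs_def)
  qed
  ultimately have "card ?Y \<le> card (residue_vecs p n j)"
    by (rule card_inj_on_le) (rule finite_residue_vecs)
  then show ?thesis by (simp add: card_residue_vecs)
qed

text \<open>These are the conditions left after cancelling p^j. With M = p^(nT-j) there are at most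
  3^n M^(n+1) pairs (s, q), each satisfied by at most p^(jn) vectors. The product is 3^n p^(An-j),
  so each factor p in the denominator saves a factor p \<ge> 2.\<close>

lemma card_deep_Dirichlet_le:
  fixes T j :: nat
  defines "A \<equiv> (n + 1) * T"
  assumes j: "j \<le> n * T"
  shows "real (card {y \<in> residue_vecs p n A. \<exists>q s. 0 < q \<and> q \<le> int p ^ (n * T - j) \<and> \<not> int p dvd q \<and>
       (\<forall>i<n. \<bar>s i\<bar> \<le> int p ^ (n * T - j) \<and> [s i = q * y i] (mod int p ^ (A - j)))})
    \<le> 3 ^ n * real p ^ (A * n) * (1 / 2) ^ j" (is "real (card ?Y) \<le> _")
proof -
  define M where "M = int p ^ (n * T - j)"
  have M1: "M \<ge> 1" using prime_gt_0_nat[OF p] by (simp add: M_def)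
  define I where "I = ({..<n} \<rightarrow>\<^sub>E {-M..M}) \<times> {q \<in> {1..M}. \<not> int p dvd q}"
  define Y where "Y = (\<lambda>(s, q). {y \<in> residue_vecs p n A. \<forall>i<n. [s i = q * y i] (mod int p ^ (A - j))})"
  have "finite {q \<in> {1..M}. \<not> int p dvd q}" by (rule finite_subset[of _ "{1..M}"]) auto
  then have fI: "finite I" unfolding I_def by (intro finite_cartesian_product finite_PiE) auto
  have "?Y \<subseteq> (\<Union>z\<in>I. Y z)"
  proof
    fix y assume y: "y \<in> ?Y"
    then obtain q s where qs: "0 < q" "q \<le> M" "\<not> int p dvd q"
      "\<And>i. i < n \<Longrightarrow> \<bar>s i\<bar> \<le> M \<and> [s i = q * y i] (mod int p ^ (A - j))" by (auto simp: M_def)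
    have "s i \<in> {-M..M}" if "i < n" for i using qs(4)[OF that] by auto
    then have "(restrict s {..<n}, q) \<in> I" using qs by (auto simp: I_def)
    moreover have "y \<in> Y (restrict s {..<n}, q)" using y qs by (auto simp: Y_def)
    ultimately show "y \<in> (\<Union>z\<in>I. Y z)" by blast
  qed
  then have "card ?Y \<le> card (\<Union>z\<in>I. Y z)"
    using fI by (intro card_mono) (auto simp: Y_def finite_residue_vecs)
  also have "\<dots> \<le> (\<Sum>z\<in>I. card (Y z))" by (rule card_UN_le[OF fI])
  also have "\<dots> \<le> (\<Sum>z\<in>I. p ^ (j * n))"
  proof (rule sum_mono)
    fix z assume z: "z \<in> I"
    obtain r q where zz: "z = (r, q)" by fastforce
    have q: "\<not> int p dvd q" using z by (simp add: I_def zz)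
    have "n * T \<le> A" by (simp add: A_def)
    then have "j \<le> A" using j by linarith
    from card_linear_congruences_le[OF q this, of r]
    show "card (Y z) \<le> p ^ (j * n)" by (simp add: Y_def zz)
  qed
  also have "\<dots> = card I * p ^ (j * n)" by simp
  also have "card I \<le> card ({..<n} \<rightarrow>\<^sub>E {-M..M}) * card {1..M}"
    unfolding I_def card_cartesian_product
    by (intro mult_left_mono card_mono) auto
  finally have "real (card ?Y) \<le> real (nat (2 * M + 1) ^ n * nat M * p ^ (j * n))"
    unfolding of_nat_le_iff by (simp add: card_PiE algebra_simps)
  also have "\<dots> = (2 * real_of_int M + 1) ^ n * real_of_int M * real p ^ (j * n)" using M1 by simp
  also have "\<dots> \<le> (3 * real_of_int M) ^ n * real_of_int M * real p ^ (j * n)"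
    using M1 by (intro mult_right_mono power_mono) auto
  also have "\<dots> = 3 ^ n * (real_of_int M ^ (n + 1) * real p ^ (j * n))" by (simp add: power_mult_distrib)
  also have "real_of_int M ^ (n + 1) * real p ^ (j * n) = real p ^ ((n * T - j) * (n + 1) + j * n)"
    by (simp add: M_def power_add power_mult)
  also have "(n * T - j) * (n + 1) + j * n = A * n - j"
  proof -
    obtain k where k: "n * T = j + k" using j le_Suc_ex by blast
    have "A * n = n * T * (n + 1)" by (simp add: A_def algebra_simps)
    then have An: "A * n = (j + k) * (n + 1)" by (simp only: k)
    have nTj: "n * T - j = k" using k by simp
    show ?thesis unfolding nTj An by (simp add: algebra_simps)
  qed
  also have "real p ^ (A * n - j) = real p ^ (A * n) * (1 / real p) ^ j"
  proof -
    have "n * T \<le> A * n" by (simp add: A_def)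
    then have "j \<le> A * n" using j by linarith
    then show ?thesis using prime_gt_0_nat[OF p] by (simp add: power_diff power_divide)
  qed
  also have "3 ^ n * (real p ^ (A * n) * (1 / real p) ^ j) \<le> 3 ^ n * (real p ^ (A * n) * (1 / 2) ^ j)"
    using prime_ge_2_nat[OF p] by (intro mult_left_mono power_mono) (auto simp: field_simps)
  finally show ?thesis by (simp add: mult.assoc)
qed

text \<open>The choice of 3n makes 3^n times the tail of the series of 2^(-j) beyond j = 3n at most
  (3/8)^n < 1/2. Thus at least half of the vectors modulo p^A lose at most 3n digits.\<close>

lemma card_rational_residues:
  assumes T: "3 * n \<le> (n + 1) * T"
  shows "real p ^ (((n + 1) * T - 3 * n) * n) \<le> 2 * real (card (rational_residues p n T))"
proof -
  define A where "A = (n + 1) * T"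
  define J where "J = 3 * n"
  define a where "a = A - J"
  have AJ: "A = a + J" using T by (simp add: A_def J_def a_def)
  have T1: "T \<ge> 1" using T n by (cases T) auto
  have p1: "int p > 1" using prime_gt_1_nat[OF p] by simp
  let ?G = "rational_residues p n T"
  \<comment> \<open>For all j \<le> J the modulus p^(A-j) is a multiple of p^a, so keeping the
    lowest a digits treats these j alike. A reduced vector has p^(Jn) lifts, the factor cancelled at
    the end.\<close>
  define red where "red y = (\<lambda>i\<in>{..<n}. y i mod int p ^ a)" for y :: "nat \<Rightarrow> int"
  define L where "L = {y \<in> residue_vecs p n A. red y \<in> ?G}"
  define Y where "Y j = {y \<in> residue_vecs p n A. \<exists>q s. 0 < q \<and> q \<le> int p ^ (n * T - j) \<and> \<not> int p dvd q \<and>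
       (\<forall>i<n. \<bar>s i\<bar> \<le> int p ^ (n * T - j) \<and> [s i = q * y i] (mod int p ^ (A - j)))}" for j
  have "residue_vecs p n A \<subseteq> L \<union> (\<Union>j\<in>{J<..n * T}. Y j)"
  proof
    fix y assume y: "y \<in> residue_vecs p n A"
    obtain q s where q: "0 < q" "q \<le> int p ^ (n * T)"
      and s: "\<And>i. i < n \<Longrightarrow> \<bar>s i\<bar> \<le> int p ^ (n * T) \<and> [s i = q * y i] (mod int p ^ A)"
      using Dirichlet_padic[OF T1, where y = y] unfolding A_def by blast
    obtain q' where q': "q = int p ^ multiplicity (int p) q * q'" "\<not> int p dvd q'"
      by (rule multiplicity_decompose'[of q "int p"]) (use q p in auto)
    define j where "j = multiplicity (int p) q"
    have qj: "q = int p ^ j * q'" using q' by (simp add: j_def)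
    have pj: "int p ^ j > 0" using p1 by simp
    have q'0: "q' > 0" using q(1) pj unfolding qj by (simp add: zero_less_mult_iff)
    have "int p ^ j * 1 \<le> int p ^ j * q'" using q'0 pj by (intro mult_left_mono) auto
    then have "int p ^ j \<le> int p ^ (n * T)" using q(2) qj by linarith
    then have jT: "j \<le> n * T" using p1 by simp
    have "n * T \<le> A" by (simp add: A_def)
    then have jA: "j \<le> A" using jT by linarith
    have nT: "int p ^ (n * T) = int p ^ j * int p ^ (n * T - j)" using jT by (simp flip: power_add)
    have PA: "int p ^ A = int p ^ j * int p ^ (A - j)" using jA by (simp flip: power_add)
    have q'le: "q' \<le> int p ^ (n * T - j)" 
      using mult_left_le_imp_le[OF _ pj] q(2) unfolding qj nT by blast
    have "\<exists>s'. \<bar>s'\<bar> \<le> int p ^ (n * T - j) \<and> [s' = q' * y i] (mod int p ^ (A - j))" if i: "i < n" for i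
    proof -
      have d: "int p ^ j * int p ^ (A - j) dvd s i - int p ^ j * (q' * y i)"
        using s[OF i] by (simp add: cong_iff_dvd_diff qj PA mult.assoc)
      then have "int p ^ j dvd s i - int p ^ j * (q' * y i)" by (rule dvd_mult_left)
      then have "int p ^ j dvd s i" by (simp add: dvd_diff_left_iff)
      then obtain s' where s': "s i = int p ^ j * s'" by blast
      have "int p ^ j * int p ^ (A - j) dvd int p ^ j * (s' - q' * y i)"
        using d by (simp add: s' algebra_simps)
      then have "[s' = q' * y i] (mod int p ^ (A - j))" using pj by (auto simp: cong_iff_dvd_diff)
      moreover have "int p ^ j * \<bar>s'\<bar> \<le> int p ^ j * int p ^ (n * T - j)"
        using s[OF i] pj by (simp add: s' nT abs_mult)
      then have "\<bar>s'\<bar> \<le> int p ^ (n * T - j)" using pj by (rule mult_left_le_imp_le)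
      ultimately show ?thesis by blast
    qed
    then obtain s' where s': "\<And>i. i < n \<Longrightarrow> \<bar>s' i\<bar> \<le> int p ^ (n * T - j) \<and> [s' i = q' * y i] (mod int p ^ (A - j))"
      by metis
    show "y \<in> L \<union> (\<Union>j\<in>{J<..n * T}. Y j)"
    proof (cases "j \<le> J")
      case True
      have le: "int p ^ (n * T - j) \<le> int p ^ (n * T)" using p1 by (intro power_increasing) auto
      have dvd: "int p ^ a dvd int p ^ (A - j)" using True by (intro le_imp_power_dvd) (simp add: a_def)
      have "\<bar>s' i\<bar> \<le> int p ^ (n * T) \<and> [s' i = q' * red y i] (mod int p ^ a)" if i: "i < n" for i
      proof -
        have "[s' i = q' * y i] (mod int p ^ a)" using s'[OF i] dvd by (blast intro: cong_dvd_modulus)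
        then have "[s' i = q' * red y i] (mod int p ^ a)"
          using i by (simp add: red_def cong_def mod_mult_right_eq)
        then show ?thesis using s'[OF i] le by linarith
      qed
      moreover have "q' \<le> int p ^ (n * T)" using q'le le by linarith
      moreover have "red y \<in> residue_vecs p n a" using p1 by (auto simp: red_def residue_vecs_def)
      ultimately have "red y \<in> ?G"
        unfolding rational_residues_def using q'0 q'(2) by (auto simp: a_def A_def J_def)
      then show ?thesis using y by (simp add: L_def)
    next
      case False
      then have "y \<in> Y j" unfolding Y_def using y q'0 q'le q'(2) s' by blast
      then show ?thesis using False jT by auto
    qed
  qed
  then have "card (residue_vecs p n A) \<le> card (L \<union> (\<Union>j\<in>{J<..n * T}. Y j))"
    by (intro card_mono) (auto simp: L_def Y_def finite_residue_vecs)
  also have "\<dots> \<le> card L + card (\<Union>j\<in>{J<..n * T}. Y j)" by (rule card_Un_le)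
  also have "card (\<Union>j\<in>{J<..n * T}. Y j) \<le> (\<Sum>j\<in>{J<..n * T}. card (Y j))" by (rule card_UN_le) simp
  finally have "real (p ^ (A * n)) \<le> real (card L + (\<Sum>j\<in>{J<..n * T}. card (Y j)))"
    unfolding card_residue_vecs by (simp only: of_nat_le_iff)
  then have 1: "real p ^ (A * n) \<le> real (card L) + (\<Sum>j\<in>{J<..n * T}. real (card (Y j)))" by simp
  have "(\<Sum>j\<in>{J<..n * T}. real (card (Y j))) \<le> (\<Sum>j\<in>{J<..n * T}. 3 ^ n * real p ^ (A * n) * (1 / 2) ^ j)"
    unfolding Y_def A_def by (intro sum_mono card_deep_Dirichlet_le) auto
  also have "\<dots> = 3 ^ n * real p ^ (A * n) * (\<Sum>j\<in>{J<..n * T}. (1 / 2) ^ j)" by (simp add: sum_distrib_left)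
  also have "\<dots> \<le> 3 ^ n * real p ^ (A * n) * (1 / 2) ^ J"
  proof (rule mult_left_mono)
    \<comment> \<open>The subtracted power is the remaining tail of the geometric series; it makes
      the bound inductive.\<close>
    have "(\<Sum>j\<in>{J<..K}. (1 / 2 :: real) ^ j) \<le> (1 / 2) ^ J - (if K \<ge> J then (1 / 2) ^ K else 0)" for K
    proof (induction K)
      case (Suc K)
      have "{J<..Suc K} = (if J \<le> K then insert (Suc K) {J<..K} else {})" by auto
      then show ?case using Suc by (cases "J = Suc K") auto
    qed auto
    from this[of "n * T"] show "(\<Sum>j\<in>{J<..n * T}. (1 / 2 :: real) ^ j) \<le> (1 / 2) ^ J"
      by (auto split: if_splits intro: order_trans)
  qed simp
  also have "\<dots> = real p ^ (A * n) * (3 / 8) ^ n"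
    by (simp add: J_def power_mult power_divide power3_eq_cube)
  also have "\<dots> \<le> real p ^ (A * n) * (3 / 8) ^ 1"
    using n by (intro mult_left_mono power_decreasing) auto
  also have "\<dots> \<le> real p ^ (A * n) / 2" by simp
  finally have 2: "(\<Sum>j\<in>{J<..n * T}. real (card (Y j))) \<le> real p ^ (A * n) / 2" .
  have "card L \<le> card (?G \<times> residue_vecs p n J)"
  proof (rule card_inj_on_le)
    define hi where "hi y = (\<lambda>i\<in>{..<n}. y i div int p ^ a)" for y :: "nat \<Rightarrow> int"
    show "finite (?G \<times> residue_vecs p n J)"
      using finite_residue_vecs by (auto simp: rational_residues_def intro: finite_subset)
    show "inj_on (\<lambda>y. (red y, hi y)) L"
    proof (rule inj_onI)
      fix y y' assume y: "y \<in> L" and y': "y' \<in> L" and eq: "(red y, hi y) = (red y', hi y')"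
      have "y i = y' i" if i: "i < n" for i
      proof -
        have "red y i = red y' i" "hi y i = hi y' i" using eq by simp_all
        then have "y i mod int p ^ a = y' i mod int p ^ a" "y i div int p ^ a = y' i div int p ^ a"
          using i by (simp_all add: red_def hi_def)
        then show ?thesis by (metis mult_div_mod_eq)
      qed
      then show "y = y'" using y y' by (intro PiE_ext[of y "{..<n}" _ y']) (auto simp: L_def residue_vecs_def)
    qed
    show "(\<lambda>y. (red y, hi y)) ` L \<subseteq> ?G \<times> residue_vecs p n J"
    proof (rule image_subsetI)
      fix y assume y: "y \<in> L"
      have "0 \<le> y i div int p ^ a \<and> y i div int p ^ a < int p ^ J" if "i < n" for i
      proof -
        have "0 \<le> y i" "y i < int p ^ J * int p ^ a"
          using y that by (auto simp: L_def residue_vecs_def PiE_iff AJ power_add mult.commute)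
        moreover have "int p ^ a > 0" using p1 by simp
        ultimately show ?thesis by (rule int_div_bounds)
      qed
      then show "(red y, hi y) \<in> ?G \<times> residue_vecs p n J"
        using y by (auto simp: L_def hi_def residue_vecs_def)
    qed
  qed
  then have "real (card L) \<le> real (card ?G * p ^ (J * n))"
    by (simp only: of_nat_le_iff card_cartesian_product card_residue_vecs)
  then have "real p ^ (A * n) / 2 \<le> real (card ?G) * real p ^ (J * n)" using 1 2 by simp
  then have "real p ^ (a * n) * real p ^ (J * n) \<le> 2 * real (card ?G) * real p ^ (J * n)"
    by (simp add: AJ power_add algebra_simps)
  then have "real p ^ (a * n) \<le> 2 * real (card ?G)" using prime_gt_0_nat[OF p] by simp
  then show ?thesis by (simp add: a_def A_def J_def)
qed

text \<open>The lift v is s/q modulo p^B; cancelling q modulo the smaller power shows that it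
  reduces to u. So the ball about a rational point can be made as small as desired, while points
  from different classes stay apart at the scale of those classes.\<close>

lemma rational_residues_lift:
  assumes u: "u \<in> rational_residues p n T" and B: "(n + 1) * T - 3 * n \<le> B"
  obtains v q s where "0 < q" "q \<le> int p ^ (n * T)"
    "\<And>i. i < n \<Longrightarrow> \<bar>s i\<bar> \<le> int p ^ (n * T) \<and> 0 \<le> v i \<and> v i < int p ^ B \<and>
      [q * v i = s i] (mod int p ^ B) \<and> [v i = u i] (mod int p ^ ((n + 1) * T - 3 * n))"
proof -
  define a where "a = (n + 1) * T - 3 * n"
  have pB: "int p ^ B > 0" using prime_gt_0_nat[OF p] by simp
  obtain q s where q: "0 < q" "q \<le> int p ^ (n * T)" "\<not> int p dvd q"
    and s: "\<And>i. i < n \<Longrightarrow> \<bar>s i\<bar> \<le> int p ^ (n * T) \<and> [s i = q * u i] (mod int p ^ a)"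
    using u unfolding rational_residues_def a_def by blast
  obtain z where z: "[q * z = 1] (mod int p ^ B)"
    using cong_solve_coprime_int[OF coprime_prime_power[OF q(3)]] by blast
  show thesis
  proof (rule that[OF q(1,2), of s "\<lambda>i. (z * s i) mod int p ^ B"])
    fix i assume i: "i < n"
    let ?v = "(z * s i) mod int p ^ B"
    have "[q * ?v = q * (z * s i)] (mod int p ^ B)" by (simp add: cong_def mod_mult_right_eq)
    also have "[q * (z * s i) = s i] (mod int p ^ B)"
      using cong_scalar_right[OF z, of "s i"] by (simp add: mult.assoc)
    finally have v: "[q * ?v = s i] (mod int p ^ B)" .
    then have "[q * ?v = s i] (mod int p ^ a)"
      by (rule cong_dvd_modulus) (use B in \<open>auto simp: a_def intro: le_imp_power_dvd\<close>)
    then have "[q * ?v = q * u i] (mod int p ^ a)" using s[OF i] cong_trans by blast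
    then have "[?v = u i] (mod int p ^ a)"
      unfolding cong_mult_lcancel[OF coprime_prime_power[OF q(3)]] .
    then show "\<bar>s i\<bar> \<le> int p ^ (n * T) \<and> 0 \<le> ?v \<and> ?v < int p ^ B \<and>
      [q * ?v = s i] (mod int p ^ B) \<and> [?v = u i] (mod int p ^ ((n + 1) * T - 3 * n))"
      using s[OF i] v pB by (simp add: a_def)
  qed
qed

end

section \<open>A Cantor set of well-approximable points\<close>

lemma product_uniform_prob_space:
  assumes "\<And>i. finite (G i)" "\<And>i. G i \<noteq> {}"
  shows "product_prob_space (\<lambda>i. uniform_count_measure (G i))"
  using assms by (intro product_prob_spaceI prob_space_uniform_count_measure)

section \<open>Limits of coherent integer sequences, divided by p\<close>

context
  fixes p :: nat
  assumes p: "prime p"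
begin

text \<open>Dividing by \<open>p\<close> moves limits of units out of \<^const>\<open>Zp\<close>, where denominators
  prime to \<open>p\<close> give no approximations at all.\<close>

definition padic_limit :: "(nat \<Rightarrow> int) \<Rightarrow> (nat \<Rightarrow> rat) set" where
  "padic_limit c = padic_null p +>\<^bsub>padic_Cauchy_ring p\<^esub> (\<lambda>k. of_int (c k) / of_nat p)"

lemma padic_abs_of_int_div_p: "padic_abs p (of_int z / of_nat p) = real p * padic_abs p (of_int z)"
proof -
  have "padic_abs p (of_nat p) = inverse (real p)" using padic_abs_p_power[OF p, of 1] by (simp add: power_int_minus)
  then show ?thesis
    by (simp add: divide_inverse padic_abs_mult[OF p] padic_abs_inverse[OF p])
qed

context
  fixes b :: "nat \<Rightarrow> nat"
  assumes b: "\<And>l. l \<le> b l"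
begin

lemma padic_Cauchy_coherent:
  assumes c: "\<And>l k. l \<le> k \<Longrightarrow> [c k = c l] (mod int p ^ b l)"
  shows "padic_Cauchy p (\<lambda>k. of_int (c k) / of_nat p)"
  unfolding padic_Cauchy_def
proof (intro allI impI)
  fix e :: real assume e: "e > 0"
  have p1: "real p > 1" using prime_gt_1_nat[OF p] by simp
  have "e / real p > 0" using e p1 by simp
  then obtain l where l: "inverse (real p) ^ l < e / real p"
    using real_arch_pow_inv[of "e / real p" "inverse (real p)"] p1 by (auto simp: inverse_less_1_iff)
  have "padic_abs p (of_int (c i) / of_nat p - of_int (c j) / of_nat p) < e" if "i \<ge> l" "j \<ge> l" for i j
  proof -
    have "[c i = c j] (mod int p ^ b l)" using c[OF that(1)] c[OF that(2)] cong_sym cong_trans by blast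
    moreover have "int p ^ l dvd int p ^ b l" using b by (rule le_imp_power_dvd)
    ultimately have "int p ^ l dvd c i - c j" by (meson cong_iff_dvd_diff dvd_trans)
    then have "padic_abs p (of_int (c i - c j)) \<le> real p powi (- int l)" by (simp only: padic_abs_of_int_le_iff[OF p])
    also have "\<dots> = inverse (real p) ^ l" by (simp add: power_int_minus power_inverse)
    finally have "real p * padic_abs p (of_int (c i - c j)) < real p * (e / real p)"
      using l p1 by (intro mult_strict_left_mono) auto
    then have "padic_abs p (of_int (c i - c j) / of_nat p) < e"
      unfolding padic_abs_of_int_div_p using p1 by simp
    then show ?thesis by (simp add: diff_divide_distrib)
  qed
  then show "\<exists>N. \<forall>i\<ge>N. \<forall>j\<ge>N. padic_abs p (of_int (c i) / of_nat p - of_int (c j) / of_nat p) < e" by blast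
qed

lemma padic_limit_closed:
  assumes "\<And>l k. l \<le> k \<Longrightarrow> [c k = c l] (mod int p ^ b l)"
  shows "padic_limit c \<in> carrier (Qp p)"
  unfolding padic_limit_def by (intro cls_closed[OF p] padic_Cauchy_coherent assms)

text \<open>Clearing the denominator p expresses the defect by absolute values of integers, which
  divisibility controls.\<close>

lemma defect_padic_limit:
  assumes c: "\<And>l k. l \<le> k \<Longrightarrow> [c k = c l] (mod int p ^ b l)"
  shows "(\<lambda>k. real p * padic_abs p (of_int (int q * c k - int p * r))) \<longlonglongrightarrow> defect p q (padic_limit c) r"
proof -
  have C1: "padic_Cauchy p (\<lambda>k. of_int (c k) / of_nat p)" by (intro padic_Cauchy_coherent c)
  note C = C1 padic_Cauchy_const[OF p]
  have qC: "padic_Cauchy p (\<lambda>k. of_nat q * (of_int (c k) / of_nat p))"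
    by (rule padic_Cauchy_mult[OF p C(2,1)])
  have dC: "padic_Cauchy p (\<lambda>k. of_nat q * (of_int (c k) / of_nat p) - of_int r)"
    using padic_Cauchy_add[OF p qC padic_Cauchy_const[OF p], of "- of_int r"] by simp
  have "[q] \<cdot>\<^bsub>Qp p\<^esub> padic_limit c \<ominus>\<^bsub>Qp p\<^esub> [r] \<cdot>\<^bsub>Qp p\<^esub> \<one>\<^bsub>Qp p\<^esub>
      = padic_null p +>\<^bsub>padic_Cauchy_ring p\<^esub> (\<lambda>k. of_nat q * (of_int (c k) / of_nat p) - of_int r)"
    unfolding padic_limit_def Qp_one[OF p] Qp_add_pow_nat[OF p C(1)] Qp_add_pow_int[OF p C(2)]
    using Qp_minus[OF p qC C(2), of "of_int r"] by simp
  moreover have "padic_abs p (of_nat q * (of_int (c k) / of_nat p) - of_int r)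
      = real p * padic_abs p (of_int (int q * c k - int p * r))" for k
  proof -
    have "of_nat q * (of_int (c k) / of_nat p) - of_int r = of_int (int q * c k - int p * r) / (of_nat p :: rat)"
      using prime_gt_0_nat[OF p] by (simp add: field_simps)
    then show ?thesis by (simp only: padic_abs_of_int_div_p)
  qed
  ultimately show ?thesis using padic_norm_cls[OF p dC] by simp
qed

lemma defect_padic_limit_le:
  assumes c: "\<And>l k. l \<le> k \<Longrightarrow> [c k = c l] (mod int p ^ b l)"
    and d: "\<And>k. k \<ge> K \<Longrightarrow> int p ^ B dvd int q * c k - r"
  shows "defect p (p * q) (padic_limit c) r \<le> real p powi (- int B)"
proof (rule LIMSEQ_le_const2[OF defect_padic_limit[OF c]], assumption, intro exI[of _ K] allI impI)
  fix k assume "k \<ge> K"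
  then have "padic_abs p (of_int (int q * c k - r)) \<le> real p powi (- int B)"
    using d padic_abs_of_int_le_iff[OF p] by blast
  moreover have "real p * padic_abs p (of_int (int (p * q) * c k - int p * r)) = padic_abs p (of_int (int q * c k - r))"
  proof -
    have "of_int (int (p * q) * c k - int p * r) / of_nat p = (of_int (int q * c k - r) :: rat)"
      using prime_gt_0_nat[OF p] by (simp add: field_simps)
    then show ?thesis by (simp only: padic_abs_of_int_div_p[symmetric])
  qed
  ultimately show "real p * padic_abs p (of_int (int (p * q) * c k - int p * r)) \<le> real p powi (- int B)"
    by (simp only:)
qed

text \<open>Here qc is a unit and pr is not, so qc - pr is a unit, and the division by p raises its
  absolute value 1 to p. A defect above 1 rules out every approximation with such a
  denominator.\<close>

lemma defect_padic_limit_eq_p: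
  assumes c: "\<And>l k. l \<le> k \<Longrightarrow> [c k = c l] (mod int p ^ b l)"
    and unit: "\<And>k. \<not> int p dvd c k" and q: "\<not> p dvd q"
  shows "defect p q (padic_limit c) r = real p"
proof -
  have "padic_abs p (of_int (int q * c k - int p * r)) = 1" for k
  proof -
    have "prime (int p)" using p by simp
    then have "\<not> int p dvd int q * c k" using unit[of k] q by (auto simp: prime_dvd_mult_iff)
    then show ?thesis unfolding padic_abs_of_int_eq_1_iff[OF p] by (simp add: dvd_diff_left_iff)
  qed
  then have "(\<lambda>k. real p) \<longlonglongrightarrow> defect p q (padic_limit c) r"
    using defect_padic_limit[OF c, of q r] by simp
  then show ?thesis by (simp add: LIMSEQ_const_iff)
qed

text \<open>The shift from k to k+1 digits undoes the division by p. The congruence first holds far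
  along the sequences; coherence brings it back to stage l, whose modulus has at least k+1
  digits.\<close>

lemma padic_limit_close:
  assumes c: "\<And>l k. l \<le> k \<Longrightarrow> [c k = c l] (mod int p ^ b l)"
    and c': "\<And>l k. l \<le> k \<Longrightarrow> [c' k = c' l] (mod int p ^ b l)"
    and le: "padic_norm p (padic_limit c \<ominus>\<^bsub>Qp p\<^esub> padic_limit c') \<le> real p powi (- int k)"
    and Kb: "Suc k \<le> b l"
  shows "int p ^ Suc k dvd c l - c' l"
proof -
  have p1: "real p > 1" using prime_gt_1_nat[OF p] by simp
  have C1: "padic_Cauchy p (\<lambda>k. of_int (c k) / of_nat p)" by (rule padic_Cauchy_coherent) (rule c)
  have C2: "padic_Cauchy p (\<lambda>k. of_int (c' k) / of_nat p)" by (rule padic_Cauchy_coherent) (rule c')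
  note C = C1 C2
  have dC: "padic_Cauchy p (\<lambda>k. of_int (c k) / of_nat p - of_int (c' k) / of_nat p)"
    using padic_Cauchy_add[OF p C(1) padic_Cauchy_minus[OF p C(2)]] by simp
  have lim: "(\<lambda>k. padic_abs p (of_int (c k) / of_nat p - of_int (c' k) / of_nat p))
      \<longlonglongrightarrow> padic_norm p (padic_limit c \<ominus>\<^bsub>Qp p\<^esub> padic_limit c')"
    unfolding padic_limit_def Qp_minus[OF p C] by (rule padic_norm_cls[OF p dC])
  \<comment> \<open>Only a strict bound on a limit passes to the terms of the sequence; discreteness
    of the values then restores the exponent -k.\<close>
  have "real p powi (- int k) < real p powi (- int k + 1)" using p1 by (intro power_int_strict_increasing) auto
  with le have "padic_norm p (padic_limit c \<ominus>\<^bsub>Qp p\<^esub> padic_limit c') < real p powi (- int k + 1)" by linarith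
  from order_tendstoD(2)[OF lim this] have "\<forall>\<^sub>F j in sequentially. padic_abs p (of_int (c j) / of_nat p - of_int (c' j) / of_nat p) < real p powi (- int k + 1)" .
  then obtain j0 where "\<And>j. j \<ge> j0 \<Longrightarrow> padic_abs p (of_int (c j) / of_nat p - of_int (c' j) / of_nat p) < real p powi (- int k + 1)"
    unfolding eventually_sequentially by blast
  then obtain j where j: "j \<ge> l" "padic_abs p (of_int (c j) / of_nat p - of_int (c' j) / of_nat p) < real p powi (- int k + 1)"
    by (meson max.cobounded1 max.cobounded2)
  then have "padic_abs p (of_int (c j) / of_nat p - of_int (c' j) / of_nat p) \<le> real p powi (- int k)"
    by (intro padic_abs_less_imp_le[OF p])
  moreover have "of_int (c j) / of_nat p - of_int (c' j) / of_nat p = of_int (c j - c' j) / (of_nat p :: rat)"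
    by (simp add: diff_divide_distrib)
  ultimately have "real p * padic_abs p (of_int (c j - c' j)) \<le> real p powi (- int k)"
    by (simp only: padic_abs_of_int_div_p)
  moreover have "real p powi (- int k) = real p * real p powi (- int (Suc k))"
    using p1 power_int_add[of "real p" 1 "- int (Suc k)"] by simp
  ultimately have "padic_abs p (of_int (c j - c' j)) \<le> real p powi (- int (Suc k))"
    using p1 by (simp only: mult_le_cancel_left_pos)
  then have 1: "int p ^ Suc k dvd c j - c' j" by (simp only: padic_abs_of_int_le_iff[OF p])
  have d: "int p ^ Suc k dvd int p ^ b l" using Kb by (rule le_imp_power_dvd)
  have 2: "int p ^ Suc k dvd c j - c l" "int p ^ Suc k dvd c' j - c' l"
    using c[OF j(1)] c'[OF j(1)] d by (meson cong_iff_dvd_diff dvd_trans)+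
  have "c l - c' l = (c j - c' j) - (c j - c l) + (c' j - c' l)" by simp
  then show ?thesis using 1 2 by (metis dvd_add dvd_diff)
qed

end

end

text \<open>Up to the factor \<open>1 / p\<close> in \<^const>\<open>padic_limit\<close>, the level \<open>l\<close> of the tree consists of balls
  of radius \<open>p ^ - b l\<close>. Inside \<open>c + p ^ b l * Zp\<close> the children are the balls of radius \<open>p ^ - b (l + 1)\<close>
  about the rational points \<open>c + p ^ b l * (r / q)\<close>, where \<open>v \<equiv> r / q\<close> to the required precision.\<close>

locale Cantor_tree =
  fixes p n :: nat and b T :: "nat \<Rightarrow> nat"
    and v r :: "nat \<Rightarrow> (nat \<Rightarrow> int) \<Rightarrow> nat \<Rightarrow> int" and q :: "nat \<Rightarrow> (nat \<Rightarrow> int) \<Rightarrow> int"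
  assumes p: "prime p" and n: "n \<ge> 1" and b0: "b 0 = 1"
    and T: "\<And>l. 3 * n \<le> (n + 1) * T l"
    and b_step: "\<And>l. b l < b (Suc l)" "\<And>l. b l + ((n + 1) * T l - 3 * n) \<le> b (Suc l)"
    and lift: "\<And>l u. u \<in> rational_residues p n (T l) \<Longrightarrow> 0 < q l u \<and> q l u \<le> int p ^ (n * T l) \<and>
      (\<forall>i<n. \<bar>r l u i\<bar> \<le> int p ^ (n * T l) \<and> 0 \<le> v l u i \<and> v l u i < int p ^ (b (Suc l) - b l) \<and>
        [q l u * v l u i = r l u i] (mod int p ^ (b (Suc l) - b l)) \<and>
        [v l u i = u i] (mod int p ^ ((n + 1) * T l - 3 * n)))"
begin

abbreviation G :: "nat \<Rightarrow> (nat \<Rightarrow> int) set" where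
  "G l \<equiv> rational_residues p n (T l)"

abbreviation a :: "nat \<Rightarrow> nat" where
  "a l \<equiv> (n + 1) * T l - 3 * n"

text \<open>The start 1 together with \<open>b 0 = 1\<close> makes all centres congruent to 1 modulo
  p, hence units. In the step the integer v stands for the rational number r/q.\<close>

primrec center :: "(nat \<Rightarrow> nat \<Rightarrow> int) \<Rightarrow> nat \<Rightarrow> nat \<Rightarrow> int" where
  "center w 0 i = 1"
| "center w (Suc l) i = center w l i + int p ^ b l * v l (w l) i"

definition point :: "(nat \<Rightarrow> nat \<Rightarrow> int) \<Rightarrow> nat \<Rightarrow> (nat \<Rightarrow> rat) set" where
  "point w = (\<lambda>i\<in>{..<n}. padic_limit p (\<lambda>l. center w l i))"

lemma p_gt_1: "real p > 1" "int p > 1"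
  using prime_gt_1_nat[OF p] by simp_all

lemma b_mono: "l \<le> k \<Longrightarrow> b l \<le> b k"
  by (rule lift_Suc_mono_le[of b, OF less_imp_le[OF b_step(1)]])

lemma b_ge: "Suc l \<le> b l"
proof (induction l)
  case (Suc l)
  then show ?case using b_step(1)[of l] by linarith
qed (simp add: b0)

lemma center_coherent: "l \<le> k \<Longrightarrow> [center w k i = center w l i] (mod int p ^ b l)"
proof (induction k rule: dec_induct)
  case (step k)
  have "int p ^ b l dvd int p ^ b k" using b_mono[OF step(1)] by (rule le_imp_power_dvd)
  then have "[center w (Suc k) i = center w k i] (mod int p ^ b l)" by (simp add: cong_iff_dvd_diff)
  then show ?case using step cong_trans by blast
qed simp

lemma le_b: "l \<le> b l"
  using b_ge[of l] by simp

lemma center_unit: "\<not> int p dvd center w l i"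
proof -
  have "[center w l i = 1] (mod int p)" using center_coherent[of 0 l w i] by (simp add: b0)
  then show ?thesis using p_gt_1 by (metis cong_dvd_iff not_less zdvd_imp_le zero_less_one)
qed

lemma center_bounds:
  assumes "\<And>l. w l \<in> G l" and i: "i < n"
  shows "0 \<le> center w l i \<and> center w l i < int p ^ b l"
proof (induction l)
  case (Suc l)
  have v: "0 \<le> v l (w l) i" "v l (w l) i \<le> int p ^ (b (Suc l) - b l) - 1" using lift[OF assms(1)] i by auto
  have pb: "int p ^ b l > 0" using p_gt_1 by simp
  have "int p ^ b l * v l (w l) i \<le> int p ^ b l * (int p ^ (b (Suc l) - b l) - 1)"
    using v(2) pb by (intro mult_left_mono) auto
  also have "\<dots> = int p ^ b (Suc l) - int p ^ b l"
    using b_step(1)[of l] by (simp add: right_diff_distrib flip: power_add)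
  finally show ?case using Suc v(1) pb by auto
qed (use p_gt_1 in \<open>simp add: b0\<close>)

lemma point_in_Qp_vec: "point w \<in> Qp_vec p n"
  using padic_limit_closed[OF p le_b center_coherent] by (auto simp: point_def Qp_vec_def)

lemma point_in_W_star:
  assumes w: "\<And>l. w l \<in> G l" and \<tau>: "\<tau> \<ge> 1"
    and b_height: "\<And>l. (2 * real p ^ (b l + 1) * real p ^ (n * T l)) powr \<tau> < real p ^ b (Suc l)"
  shows "point w \<in> W_star p n \<tau>"
proof -
  have "infinite {(r, q). (r, q) \<in> padic_approximations p n \<tau> (point w) \<and> p dvd q}"
  proof (rule infinite_approximations_if_small_defects[OF p n point_in_Qp_vec])
    fix e :: real assume "e > 0"
    then obtain l where l: "inverse (real p) ^ l < e"
      using real_arch_pow_inv[of e "inverse (real p)"] p_gt_1 by (auto simp: inverse_less_1_iff)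
    define Q where "Q = nat (q l (w l))"
    \<comment> \<open>The rational point of the child is (center + p^(b l) r/Q)/p, and R is its
      numerator over the denominator pQ.\<close>
    define R where "R = (\<lambda>i\<in>{..<n}. int Q * center w l i + int p ^ b l * r l (w l) i)"
    have Q: "0 < Q" "int Q = q l (w l)" "int Q \<le> int p ^ (n * T l)" using lift[OF w[of l]] by (simp_all add: Q_def)
    have le: "vec_defect p n (p * Q) (point w) R \<le> real p powi (- int (b (Suc l)))"
      unfolding padic_vec_norm_le_iff[OF p n]
    proof (intro allI impI)
      fix i assume i: "i < n"
      have "int p ^ b (Suc l) dvd int Q * center w k i - R i" if k: "k \<ge> Suc l" for k
      proof -
        have "int p ^ b (Suc l) dvd center w k i - center w (Suc l) i"
          using center_coherent[OF k] by (simp only: cong_iff_dvd_diff)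
        then have 1: "int p ^ b (Suc l) dvd int Q * (center w k i - center w (Suc l) i)" by (rule dvd_mult)
        have "int p ^ (b (Suc l) - b l) dvd int Q * v l (w l) i - r l (w l) i"
          using lift[OF w] i by (auto simp: Q cong_iff_dvd_diff)
        then have "int p ^ b l * int p ^ (b (Suc l) - b l) dvd int p ^ b l * (int Q * v l (w l) i - r l (w l) i)"
          by (intro mult_dvd_mono) auto
        then have 2: "int p ^ b (Suc l) dvd int p ^ b l * (int Q * v l (w l) i - r l (w l) i)"
          using b_step(1)[of l] by (simp flip: power_add)
        have "int Q * center w k i - R i = int Q * (center w k i - center w (Suc l) i)
            + int p ^ b l * (int Q * v l (w l) i - r l (w l) i)"
          using i by (simp add: R_def algebra_simps)
        then show ?thesis using 1 2 by (metis dvd_add)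
      qed
      then show "defect p (p * Q) (point w i) (R i) \<le> real p powi (- int (b (Suc l)))"
        using i by (simp only: point_def restrict_apply' lessThan_iff)
          (rule defect_padic_limit_le[OF p le_b center_coherent])
    qed
    \<comment> \<open>Both summands of the numerator are at most p^(b l + n T l); the additional
      factor p leaves room for the denominator pQ.\<close>
    have "height n R (p * Q) \<le> real_of_int (2 * int p ^ (b l + 1) * int p ^ (n * T l))"
      unfolding height_le_iff[OF n]
    proof (intro conjI allI impI)
      have pT: "int p ^ (n * T l) > 0" using p_gt_1 by simp
      have pb: "int p ^ b l > 0" using p_gt_1 by simp
      have e2: "2 * int p ^ (b l + 1) * int p ^ (n * T l) = 2 * int p * (int p ^ b l * int p ^ (n * T l))" by simp
      fix i assume i: "i < n"
      have "\<bar>R i\<bar> \<le> int Q * \<bar>center w l i\<bar> + int p ^ b l * \<bar>r l (w l) i\<bar>"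
        using i abs_triangle_ineq[of "int Q * center w l i" "int p ^ b l * r l (w l) i"] by (simp add: R_def abs_mult)
      also have "\<dots> \<le> int p ^ (n * T l) * int p ^ b l + int p ^ b l * int p ^ (n * T l)"
        using Q(3) center_bounds[OF w i, of l] lift[OF w[of l]] i pT pb by (intro add_mono mult_mono) auto
      also have "\<dots> = 2 * (int p ^ b l * int p ^ (n * T l))" by simp
      also have "\<dots> \<le> 2 * int p * (int p ^ b l * int p ^ (n * T l))"
        using p_gt_1 pT pb by (intro mult_right_mono) auto
      finally show "\<bar>R i\<bar> \<le> 2 * int p ^ (b l + 1) * int p ^ (n * T l)" unfolding e2 .
    next
      have pT: "int p ^ (n * T l) > 0" using p_gt_1 by simp
      have pb: "int p ^ b l \<ge> 1" using p_gt_1 by simp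
      have e2: "2 * int p ^ (b l + 1) * int p ^ (n * T l) = (int p * int p ^ (n * T l)) * (2 * int p ^ b l)" by simp
      have "int (p * Q) \<le> int p * int p ^ (n * T l) * 1" using Q(3) p_gt_1 by simp
      also have "\<dots> \<le> (int p * int p ^ (n * T l)) * (2 * int p ^ b l)"
        using pb pT p_gt_1 by (intro mult_left_mono) (linarith, simp)
      finally show "int (p * Q) \<le> 2 * int p ^ (b l + 1) * int p ^ (n * T l)" unfolding e2 .
    qed
    then have H: "height n R (p * Q) \<le> 2 * real p ^ (b l + 1) * real p ^ (n * T l)" by simp
    have "0 < real (p * Q)" using Q(1) prime_gt_0_nat[OF p] by simp
    then have H0: "height n R (p * Q) > 0" using le_height(1)[of "p * Q" n R] by linarith
    have "height n R (p * Q) powr \<tau> < real p ^ b (Suc l)"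
      using powr_mono2[of \<tau>, OF _ _ H] H0 \<tau> b_height[of l] by simp
    then have "inverse (real p ^ b (Suc l)) < inverse (height n R (p * Q) powr \<tau>)"
      using H0 by (intro less_imp_inverse_less) auto
    then have "real p powi (- int (b (Suc l))) < height n R (p * Q) powr - \<tau>"
      by (simp add: power_int_minus powr_minus)
    then have "(R, p * Q) \<in> padic_approximations p n \<tau> (point w)"
      using le Q(1) prime_gt_0_nat[OF p] by (simp add: padic_approximations_iff[OF p n]) (simp add: R_def)
    moreover have "real p powi (- int (b (Suc l))) < e"
    proof -
      have "l \<le> b (Suc l)" using b_ge[of "Suc l"] by simp
      then have "real p powi (- int (b (Suc l))) \<le> real p powi (- int l)"
        using p_gt_1 by (intro power_int_increasing) auto
      also have "\<dots> = inverse (real p) ^ l" by (simp add: power_int_minus power_inverse)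
      finally show ?thesis using l by simp
    qed
    ultimately show "\<exists>r q. (r, q) \<in> padic_approximations p n \<tau> (point w) \<and> p dvd q \<and> vec_defect p n q (point w) r < e"
      using le by (intro exI[of _ R] exI[of _ "p * Q"]) auto
  qed simp
  moreover have "finite {(r, q). (r, q) \<in> padic_approximations p n \<tau> (point w) \<and> \<not> p dvd q}"
  proof -
    have False if a: "(r, q) \<in> padic_approximations p n \<tau> (point w)" and q: "\<not> p dvd q" for r q
    proof -
      have "defect p q (point w 0) (r 0) = real p"
        using n defect_padic_limit_eq_p[OF p le_b center_coherent center_unit q] by (simp add: point_def)
      moreover have "defect p q (point w 0) (r 0) < height n r q powr - \<tau>" and q0: "q > 0"
        using a n by (auto simp: padic_approximations_iff[OF p n] padic_vec_norm_less_iff[OF p n])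
      moreover have "height n r q \<ge> 1" using le_height(1)[of q n r] q0 by linarith
      then have "height n r q powr - \<tau> \<le> 1" using powr_mono[of "- \<tau>" 0 "height n r q"] \<tau> by simp
      ultimately show False using p_gt_1 by linarith
    qed
    then have "{(r, q). (r, q) \<in> padic_approximations p n \<tau> (point w) \<and> \<not> p dvd q} = {}" by blast
    then show ?thesis by (simp only: finite.emptyI)
  qed
  ultimately show ?thesis using point_in_Qp_vec by (simp only: W_star_def mem_Collect_eq simp_thms)
qed

lemma residues_eq_if_cong:
  assumes "u \<in> G l" "u' \<in> G l" "\<And>i. i < n \<Longrightarrow> [u i = u' i] (mod int p ^ a l)"
  shows "u = u'"
proof (rule PiE_ext[of u "{..<n}" _ u'])
  show uE: "u \<in> {..<n} \<rightarrow>\<^sub>E {0..<int p ^ a l}" "u' \<in> {..<n} \<rightarrow>\<^sub>E {0..<int p ^ a l}"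
    using assms by (auto simp: rational_residues_def residue_vecs_def)
  show "u i = u' i" if "i \<in> {..<n}" for i
    using that uE assms(3)[of i] by (auto simp: PiE_iff cong_def)
qed

text \<open>The level l is the one whose scale contains k+1 digits, the 1 stemming from the division
  by p. Agreement in these digits makes the centres at level l equal. What remains are the leading
  \<open>Suc k - b l\<close> digits of v, of which only the first \<open>a l\<close> are tied to u.
  This explains the minimum.\<close>

lemma point_close:
  assumes w: "\<And>l. w l \<in> G l" and w': "\<And>l. w' l \<in> G l"
    and d: "padic_vec_dist p n (point w) (point w') \<le> real p powi (- int k)"
    and l: "b l \<le> Suc k" "Suc k < b (Suc l)"
  shows "i < n \<Longrightarrow> [w' l i = w l i] (mod int p ^ min (Suc k - b l) (a l))"
    and "l = Suc l' \<Longrightarrow> w' l' = w l'"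
proof -
  have D: "int p ^ Suc k dvd center w (Suc l) i - center w' (Suc l) i" if i: "i < n" for i
  proof (rule padic_limit_close[OF p le_b center_coherent center_coherent])
    show "padic_norm p (padic_limit p (\<lambda>l. center w l i) \<ominus>\<^bsub>Qp p\<^esub> padic_limit p (\<lambda>l. center w' l i)) \<le> real p powi (- int k)"
      using d i unfolding padic_vec_dist_le_iff[OF p n point_in_Qp_vec point_in_Qp_vec] by (simp add: point_def)
    show "Suc k \<le> b (Suc l)" using l(2) by simp
  qed
  \<comment> \<open>The centres are least residues modulo p^(b l), so congruence is
    equality.\<close>
  have eq: "center w l i = center w' l i" if i: "i < n" for i
  proof -
    have "int p ^ b l dvd int p ^ Suc k" using l(1) by (rule le_imp_power_dvd)
    then have "[center w (Suc l) i = center w' (Suc l) i] (mod int p ^ b l)"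
      using D[OF i] by (metis cong_iff_dvd_diff dvd_trans)
    then have "[center w l i = center w' l i] (mod int p ^ b l)"
      using center_coherent[of l "Suc l" _ i] by (meson cong_sym cong_trans le_SucI order_refl)
    then show ?thesis using center_bounds[OF w i, of l] center_bounds[OF w' i, of l] by (simp add: cong_def)
  qed
  show "[w' l i = w l i] (mod int p ^ min (Suc k - b l) (a l))" if i: "i < n"
  proof -
    have "int p ^ b l * int p ^ (Suc k - b l) dvd int p ^ b l * (v l (w l) i - v l (w' l) i)"
      using D[OF i] eq[OF i] l(1) by (simp add: right_diff_distrib flip: power_add)
    then have "[v l (w l) i = v l (w' l) i] (mod int p ^ (Suc k - b l))"
      using p_gt_1 by (auto simp: cong_iff_dvd_diff)
    then have 1: "[v l (w l) i = v l (w' l) i] (mod int p ^ min (Suc k - b l) (a l))"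
      by (rule cong_dvd_modulus) (rule le_imp_power_dvd, simp)
    have 2: "[v l u i = u i] (mod int p ^ min (Suc k - b l) (a l))" if "u \<in> G l" for u
    proof (rule cong_dvd_modulus)
      show "[v l u i = u i] (mod int p ^ a l)" using lift[OF that] i by blast
    qed (rule le_imp_power_dvd, simp)
    show ?thesis using 1 2[OF w] 2[OF w'] by (meson cong_sym cong_trans)
  qed
  show "w' l' = w l'" if ll: "l = Suc l'"
  proof (rule residues_eq_if_cong[OF w' w])
    fix i assume i: "i < n"
    have "[center w l' i = center w' l' i] (mod int p ^ b l')"
      using center_coherent[of l' l _ i] eq[OF i] by (metis cong_sym cong_trans le_SucI ll order_refl)
    then have "center w l' i = center w' l' i"
      using center_bounds[OF w i, of l'] center_bounds[OF w' i, of l'] by (simp add: cong_def)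
    then have "v l' (w l') i = v l' (w' l') i" using eq[OF i] p_gt_1 by (simp add: ll)
    moreover have "[v l' u i = u i] (mod int p ^ a l')" if "u \<in> G l'" for u using lift[OF that] i by blast
    ultimately show "[w' l' i = w l' i] (mod int p ^ a l')"
      using w[of l'] w'[of l'] by (metis cong_sym cong_trans)
  qed
qed

end

section \<open>The lower bound\<close>

context Cantor_tree
begin

lemma finite_G: "finite (G l)"
  by (rule finite_subset[OF _ finite_residue_vecs[of p n "a l"]]) (auto simp: rational_residues_def)

lemma level_exists: obtains l where "b l \<le> Suc k" "Suc k < b (Suc l)"
proof -
  have ex: "\<exists>l. Suc k < b l" using b_ge[of "Suc k"] by (intro exI[of _ "Suc k"]) simp
  define l where "l = (LEAST l. Suc k < b l)"
  have l: "Suc k < b l" unfolding l_def using ex by (rule LeastI_ex)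
  then have "l \<noteq> 0" using b0 by (cases l) auto
  then obtain l' where l': "l = Suc l'" by (cases l) auto
  have "\<not> Suc k < b l'" using not_less_Least[of l' "\<lambda>l. Suc k < b l"] l' by (simp add: l_def)
  then show ?thesis using that[of l'] l l' by simp
qed

text \<open>A ball of radius p^(-k) is enclosed in a cylinder of mass at most 2p^(-sk); the constant
  2 is the half lost in \<open>card_rational_residues\<close>.\<close>

lemma hausdorff_measure_neq_0:
  assumes \<tau>: "\<tau> \<ge> 1" and s: "0 < s" "s \<le> real n"
    and b_height: "\<And>l. (2 * real p ^ (b l + 1) * real p ^ (n * T l)) powr \<tau> < real p ^ b (Suc l)"
    and card_G: "\<And>l. real p powr (s * real (b (Suc l))) \<le> real (card (G l))"
  shows "Metric_space.hausdorff_measure (Qp_vec p n) (padic_vec_dist p n) s (W_star p n \<tau>) \<noteq> 0"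
proof -
  interpret Metric_space "Qp_vec p n" "padic_vec_dist p n" by (rule Metric_space_Qp_vec[OF p n])
  have card_pos: "0 < real (card (G l))" for l
    using card_G[of l] p_gt_1 by (intro less_le_trans[OF _ card_G]) simp
  then have G_ne: "G l \<noteq> {}" for l using card_gt_0_iff[of "G l"] by simp
  interpret product_prob_space "\<lambda>l. uniform_count_measure (G l)" UNIV
    by (rule product_uniform_prob_space) (simp_all add: finite_G G_ne)
  let ?N = "PiM UNIV (\<lambda>l. uniform_count_measure (G l))"
  have space_N: "w l \<in> G l" if "w \<in> space ?N" for w l
    using that by (simp add: space_PiM space_uniform_count_measure PiE_iff)
  define \<theta> where "\<theta> = inverse (real p)"
  show ?thesis
  proof (rule mass_distribution_principle[where N = ?N and f = point and \<theta> = \<theta> and C = 2])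
    show "prob_space ?N" by (rule prob_space_axioms)
    show "point w \<in> W_star p n \<tau>" if "w \<in> space ?N" for w
      using space_N[OF that] \<tau> b_height by (rule point_in_W_star)
    show "0 < s" "0 < \<theta>" "\<theta> < 1" using s p_gt_1 by (auto simp: \<theta>_def inverse_less_1_iff)
  next
    fix w k assume wN: "w \<in> space ?N"
    note w = space_N[OF wN]
    obtain l where l: "b l \<le> Suc k" "Suc k < b (Suc l)" by (rule level_exists)
    \<comment> \<open>The levels grow so fast that the number of choices at level \<open>l - 1\<close> alone already exceeds
      \<open>p powr (s * b l)\<close>; the earlier choices can be ignored.\<close>
    define m where "m = min (Suc k - b l) (a l)"
    define S where "S = {u \<in> G l. \<forall>i<n. [u i = w l i] (mod int p ^ m)}"
    define X where "X i = (if i = l then S else {w i})" for i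
    define J where "J = {i. i = l \<or> Suc i = l}"
    define A where "A = {w' \<in> space ?N. \<forall>i\<in>J. w' i \<in> X i}"
    have J: "J = (if l = 0 then {l} else {l - 1, l})" by (auto simp: J_def)
    have fJ: "finite J" by (simp add: J)
    have SG: "S \<subseteq> G l" by (auto simp: S_def)
    have XG: "X i \<subseteq> G i" for i using w SG by (simp add: X_def)
    have "emeasure ?N A = (\<Prod>i\<in>J. emeasure (uniform_count_measure (G i)) (X i))"
      unfolding A_def by (rule emeasure_PiM_Collect) (use fJ XG in \<open>auto simp: sets_uniform_count_measure\<close>)
    also have "\<dots> = (\<Prod>i\<in>J. ennreal (real (card (X i)) / real (card (G i))))"
      by (intro prod.cong refl emeasure_uniform_count_measure finite_G XG)
    also have "\<dots> = ennreal (\<Prod>i\<in>J. real (card (X i)) / real (card (G i)))"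
      by (intro prod_ennreal) simp
    finally have eA: "emeasure ?N A = ennreal (\<Prod>i\<in>J. real (card (X i)) / real (card (G i)))" .
    define c where "c = (if l = 0 then 1 else 1 / real (card (G (l - 1))))"
    have prod: "(\<Prod>i\<in>J. real (card (X i)) / real (card (G i))) = c * (real (card S) / real (card (G l)))"
      by (simp add: J c_def X_def)
    have c0: "c \<ge> 0" by (simp add: c_def)
    \<comment> \<open>The summand s is needed at l = 0, where no earlier choice exists, c = 1 and
      \<open>b 0 = 1\<close>. It cancels against the k+1 digits that belong to the radius
      p^(-k).\<close>
    have c: "c \<le> real p powr (s - s * real (b l))"
    proof (cases l)
      case 0
      then show ?thesis using p_gt_1 by (simp add: c_def b0)
    next
      case (Suc l')
      have "c = inverse (real (card (G l')))" by (simp add: c_def Suc inverse_eq_divide)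
      also have "\<dots> \<le> inverse (real p powr (s * real (b l)))"
        using card_G[of l'] p_gt_1 by (intro le_imp_inverse_le) (auto simp: Suc)
      also have "\<dots> = real p powr (- (s * real (b l)))" by (simp add: powr_minus)
      also have "\<dots> \<le> real p powr (s - s * real (b l))" using s p_gt_1 by (intro powr_mono) auto
      finally show ?thesis .
    qed
    have c1: "c \<le> 1"
    proof (cases l)
      case (Suc l')
      have "1 \<le> card (G l')" using card_pos[of l'] by linarith
      then show ?thesis by (simp add: c_def Suc divide_le_eq)
    qed (simp add: c_def)
    have card_S: "card S \<le> p ^ ((a l - m) * n)"
    proof -
      have am: "a l - (a l - m) = m" by (simp add: m_def)
      have "S \<subseteq> {y \<in> residue_vecs p n (a l). \<forall>i<n. [w l i = 1 * y i] (mod int p ^ (a l - (a l - m)))}"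
        unfolding am by (auto simp: S_def rational_residues_def cong_sym_eq)
      then have "card S \<le> card \<dots>" by (rule card_mono[rotated]) (simp add: finite_residue_vecs)
      also have "\<dots> \<le> p ^ ((a l - m) * n)"
        using p_gt_1 by (intro card_linear_congruences_le[OF p n]) auto
      finally show ?thesis .
    qed
    have G2: "real p ^ (a l * n) \<le> 2 * real (card (G l))" by (rule card_rational_residues[OF p n T])
    \<comment> \<open>As long as the digits of u decide, fixing m of them in each coordinate saves
      p^(nm), which suffices because s \<le> n. Beyond \<open>a l\<close> digits at most one child
      is left, and the size of \<open>G l\<close> alone covers all scales up to
      \<open>b (Suc l)\<close>.\<close>
    have bound: "c * (real (card S) / real (card (G l))) \<le> 2 * real p powr (- (s * real k))"
    proof (cases "Suc k - b l \<le> a l")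
      case True
      then have m: "m = Suc k - b l" by (simp add: m_def)
      have mal: "m \<le> a l" by (simp add: m_def)
      have "real (card S) \<le> real p ^ ((a l - m) * n)"
        using card_S by (simp flip: of_nat_power)
      also have "\<dots> = real p ^ (a l * n) * inverse (real p ^ (m * n))"
      proof -
        have "real p ^ (a l * n) = real p ^ ((a l - m) * n) * real p ^ (m * n)"
          by (simp only: power_add[symmetric] add_mult_distrib[symmetric] le_add_diff_inverse2[OF mal])
        then show ?thesis using p_gt_1 by simp
      qed
      also have "\<dots> \<le> 2 * real (card (G l)) * inverse (real p ^ (m * n))"
        using G2 by (intro mult_right_mono) auto
      finally have "real (card S) / real (card (G l)) \<le> 2 * inverse (real p ^ (m * n))"
        using card_pos[of l] by (simp add: divide_le_eq mult_ac)
      also have "inverse (real p ^ (m * n)) = real p powr (- (real n * real m))"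
        using p_gt_1 by (simp add: powr_minus powr_realpow[symmetric] mult.commute)
      also have "\<dots> \<le> real p powr (- (s * real m))"
        using s p_gt_1 by (intro powr_mono) (auto intro: mult_right_mono)
      finally have "real (card S) / real (card (G l)) \<le> 2 * real p powr (- (s * real m))" by simp
      then have "c * (real (card S) / real (card (G l)))
          \<le> real p powr (s - s * real (b l)) * (2 * real p powr (- (s * real m)))"
        using c c0 by (intro mult_mono) auto
      also have "\<dots> = 2 * real p powr (s - s * real (b l) + - (s * real m))" by (simp only: powr_add mult_ac)
      also have "real m = real k + 1 - real (b l)" using l(1) by (simp add: m of_nat_diff)
      also have "s - s * real (b l) + - (s * (real k + 1 - real (b l))) = - (s * real k)" by (simp add: algebra_simps)
      finally show ?thesis .
    next
      case False
      then have "m = a l" by (simp add: m_def)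
      then have "real (card S) \<le> 1" using card_S by simp
      then have "c * (real (card S) / real (card (G l))) \<le> 1 * (1 / real (card (G l)))"
        using c1 c0 by (intro mult_mono divide_right_mono) auto
      also have "\<dots> = inverse (real (card (G l)))" by (simp add: inverse_eq_divide)
      also have "\<dots> \<le> inverse (real p powr (s * real (b (Suc l))))"
        using card_G[of l] p_gt_1 by (intro le_imp_inverse_le) auto
      also have "\<dots> = real p powr (- (s * real (b (Suc l))))" by (simp add: powr_minus)
      also have "\<dots> \<le> real p powr (- (s * real k))" using s l(2) p_gt_1 by (intro powr_mono) auto
      also have "\<dots> \<le> 2 * real p powr (- (s * real k))" by simp
      finally show ?thesis .
    qed
    have \<theta>k: "\<theta> ^ k = real p powi (- int k)" by (simp add: \<theta>_def power_int_minus power_inverse)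
    have "(\<theta> ^ k) powr s = real p powr (- (s * real k))"
    proof -
      have "\<theta> ^ k = real p powr (- real k)" using p_gt_1 by (simp add: \<theta>_def powr_minus powr_realpow power_inverse)
      then show ?thesis by (simp add: powr_powr mult.commute)
    qed
    then have "emeasure ?N A \<le> ennreal (2 * (\<theta> ^ k) powr s)"
      unfolding eA prod using bound by (intro ennreal_leI) simp
    moreover have "A \<in> sets ?N"
    proof (rule ccontr)
      assume "A \<notin> sets ?N"
      moreover have "A = (\<Inter>i\<in>J. {w' \<in> space ?N. w' i \<in> X i})" unfolding A_def using J by auto
      moreover have "{w' \<in> space ?N. w' i \<in> X i} \<in> sets ?N" for i
        using measurable_sets[OF measurable_component_singleton[of i UNIV "\<lambda>l. uniform_count_measure (G l)"], of "X i"] XG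
        by (simp add: sets_uniform_count_measure vimage_def Int_def conj_commute)
      ultimately show False using fJ J by (metis (no_types, lifting) insert_not_empty sets.finite_INT)
    qed
    moreover have "{w' \<in> space ?N. padic_vec_dist p n (point w) (point w') \<le> \<theta> ^ k} \<subseteq> A"
    proof
      fix w' assume "w' \<in> {w' \<in> space ?N. padic_vec_dist p n (point w) (point w') \<le> \<theta> ^ k}"
      then have w'N: "w' \<in> space ?N" and d: "padic_vec_dist p n (point w) (point w') \<le> real p powi (- int k)"
        unfolding \<theta>k by auto
      note w' = space_N[OF w'N]
      have "w' l \<in> S" using point_close(1)[OF w w' d l] w' by (simp add: S_def m_def)
      moreover have "w' i = w i" if "Suc i = l" for i using point_close(2)[OF w w' d l] that by simp
      ultimately show "w' \<in> A" using w'N by (auto simp: A_def J_def X_def)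
    qed
    ultimately show "\<exists>A\<in>sets ?N. {w' \<in> space ?N. padic_vec_dist p n (point w) (point w') \<le> \<theta> ^ k} \<subseteq> A
        \<and> emeasure ?N A \<le> ennreal (2 * (\<theta> ^ k) powr s)" by blast
  qed simp
qed

end

text \<open>With b fixed, the height condition determines b' as about \<tau> n T, and the size
  condition then compares two linear functions of T. It holds for large T since s\<tau> <
  n+1.\<close>

lemma Cantor_tree_step:
  fixes p n b :: nat and \<tau> s :: real
  assumes p: "prime p" and n: "n \<ge> 1" and \<tau>: "\<tau> > 1 + 1 / real n" and s: "0 < s" "s < (real n + 1) / \<tau>"
  shows "\<exists>T b'. 3 * n \<le> (n + 1) * T \<and> b < b' \<and> b + ((n + 1) * T - 3 * n) \<le> b' \<and>
    (2 * real p ^ (b + 1) * real p ^ (n * T)) powr \<tau> < real p ^ b' \<and>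
    real p powr (s * real b') \<le> real (card (rational_residues p n T))"
proof -
  have p1: "real p > 1" using prime_gt_1_nat[OF p] by simp
  have p2: "real p \<ge> 2" using prime_ge_2_nat[OF p] by simp
  have n0: "real n > 0" using n by simp
  have \<tau>0: "\<tau> > 1" using \<tau> n0 by (smt (verit) divide_pos_pos)
  \<comment> \<open>The coefficient of T in n((n+1)T - 3n) - s b', that is, in the number of digits
    available minus the number required.\<close>
  define e where "e = real n * (real n + 1 - s * \<tau>)"
  have "s * \<tau> < real n + 1" using s(2) \<tau>0 by (simp add: pos_less_divide_eq)
  then have e: "e > 0" unfolding e_def using n0 by simp
  \<comment> \<open>The terms free of T: the previous level and the rounding of b', the slack 3n in
    each of n coordinates, and 1 for the factor 1/2 in the count of residues.\<close>
  define D where "D = s * (\<tau> * (real b + 2) + 2) + 3 * real n * real n + 1"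
  obtain T0 where T0: "real T0 > D / e" using reals_Archimedean2 by blast
  define T where "T = max T0 (3 * n)"
  have "real T \<ge> real T0" by (simp add: T_def)
  then have "D / e < real T" using T0 by linarith
  then have TD: "D < real T * e" using e by (simp add: pos_divide_less_eq)
  have T3: "3 * n \<le> (n + 1) * T"
  proof -
    have "3 * n \<le> T" by (simp add: T_def)
    then show ?thesis by (simp add: trans_le_add1)
  qed
  \<comment> \<open>The exponent of p in the \<tau>-th power of the height bound; estimating the
    factor 2 by p turns b+1 into b+2.\<close>
  define x where "x = \<tau> * (real b + 2 + real n * real T)"
  have x0: "x \<ge> 0" using \<tau>0 by (simp add: x_def)
  define b' where "b' = nat \<lceil>x\<rceil> + 1"
  have b'1: "x < real b'" and b'2: "real b' \<le> x + 2" using x0 by (auto simp: b'_def) linarith+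
  have "real b + 2 \<le> \<tau> * (real b + 2)" using \<tau>0 by simp
  \<comment> \<open>This is where \<tau> > 1 + 1/n makes the new radius smaller than the separation
    of the rational points.\<close>
  moreover have "(real n + 1) * real T \<le> \<tau> * (real n * real T)"
  proof -
    have "(1 + 1 / real n) * real n \<le> \<tau> * real n" using \<tau> n0 by (intro mult_right_mono) auto
    moreover have "(1 + 1 / real n) * real n = real n + 1" using n0 by (simp add: field_simps)
    ultimately have "real n + 1 \<le> \<tau> * real n" by simp
    from mult_right_mono[OF this, of "real T"] show ?thesis by (simp add: mult.assoc)
  qed
  ultimately have "real b + 2 + (real n + 1) * real T \<le> x" by (simp add: x_def distrib_left)
  moreover have "real (b + (n + 1) * T) = real b + (real n + 1) * real T" by (simp add: algebra_simps)
  ultimately have "real (b + (n + 1) * T) < real b'" using b'1 by linarith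
  then have bb': "b + (n + 1) * T < b'" by (simp only: of_nat_less_iff)
  have height: "(2 * real p ^ (b + 1) * real p ^ (n * T)) powr \<tau> < real p ^ b'"
  proof -
    have "2 * real p ^ (b + 1) * real p ^ (n * T) \<le> real p * real p ^ (b + 1) * real p ^ (n * T)"
      using p2 by (intro mult_right_mono) auto
    also have "\<dots> = real p powr (real b + 2 + real n * real T)"
    proof -
      have "real b + 2 + real n * real T = real (1 + (b + 1) + n * T)" by simp
      then show ?thesis using p1 by (simp only: powr_realpow power_add power_one_right)
    qed
    finally have "(2 * real p ^ (b + 1) * real p ^ (n * T)) powr \<tau> \<le> (real p powr (real b + 2 + real n * real T)) powr \<tau>"
      using \<tau>0 by (intro powr_mono2) auto
    also have "\<dots> = real p powr x" by (simp add: powr_powr x_def mult.commute)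
    also have "\<dots> < real p powr real b'" using b'1 p1 by (intro powr_less_mono) auto
    also have "\<dots> = real p ^ b'" using p1 by (simp add: powr_realpow)
    finally show ?thesis .
  qed
  have "real p powr (s * real b') \<le> real (card (rational_residues p n T))"
  proof -
    define a where "a = (n + 1) * T - 3 * n"
    have ra: "real a = (real n + 1) * real T - 3 * real n"
      unfolding a_def using of_nat_diff[OF T3, where 'a = real] by (simp add: algebra_simps)
    have "s * real b' \<le> s * (x + 2)" using b'2 s by (intro mult_left_mono) auto
    also have "\<dots> = real T * (s * \<tau> * real n) + s * (\<tau> * (real b + 2) + 2)"
      by (simp add: x_def algebra_simps)
    also have "\<dots> \<le> real (a * n) - 1"
      using TD by (simp add: ra D_def e_def algebra_simps)
    finally have "real p powr (s * real b') \<le> real p powr (real (a * n) - 1)" using p1 by (intro powr_mono) auto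
    also have "\<dots> = real p ^ (a * n) / real p" using p1 by (simp only: powr_diff powr_realpow powr_one)
    also have "\<dots> \<le> real p ^ (a * n) / 2" using p2 by (intro divide_left_mono) auto
    also have "\<dots> \<le> real (card (rational_residues p n T))"
      using card_rational_residues[OF p n T3] by (simp add: a_def)
    finally show ?thesis .
  qed
  then show ?thesis using T3 bb' height by (intro exI[of _ T] exI[of _ b']) auto
qed

lemma hausdorff_measure_W_star_neq_0:
  fixes p n :: nat and \<tau> s :: real
  assumes p: "prime p" and n: "n \<ge> 1" and \<tau>: "\<tau> > 1 + 1 / real n" and s: "0 < s" "s < (real n + 1) / \<tau>"
  shows "Metric_space.hausdorff_measure (Qp_vec p n) (padic_vec_dist p n) s (W_star p n \<tau>) \<noteq> 0"
proof -
  let ?R = "\<lambda>b T b'. 3 * n \<le> (n + 1) * T \<and> b < b' \<and> b + ((n + 1) * T - 3 * n) \<le> b' \<and>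
    (2 * real p ^ (b + 1) * real p ^ (n * T)) powr \<tau> < real p ^ b' \<and>
    real p powr (s * real b') \<le> real (card (rational_residues p n T))"
  have "\<forall>b. \<exists>T b'. ?R b T b'" using Cantor_tree_step[OF p n \<tau> s] by blast
  then obtain fT fb where f: "\<And>b. ?R b (fT b) (fb b)" by metis
  define b where "b l = (fb ^^ l) 1" for l
  define T where "T l = fT (b l)" for l
  have bS: "b (Suc l) = fb (b l)" for l by (simp add: b_def)
  have R: "?R (b l) (T l) (b (Suc l))" for l unfolding bS T_def by (rule f)
  define P where "P l u = (\<lambda>(v, r, q). 0 < q \<and> q \<le> int p ^ (n * T l) \<and>
      (\<forall>i<n. \<bar>r i\<bar> \<le> int p ^ (n * T l) \<and> 0 \<le> v i \<and> v i < int p ^ (b (Suc l) - b l) \<and>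
        [q * v i = r i] (mod int p ^ (b (Suc l) - b l)) \<and>
        [v i = u i] (mod int p ^ ((n + 1) * T l - 3 * n))))" for l u
  define h where "h l u = (SOME z. P l u z)" for l u
  have h: "P l u (h l u)" if u: "u \<in> rational_residues p n (T l)" for l u
  proof -
    have "(n + 1) * T l - 3 * n \<le> b (Suc l) - b l" using R[of l] by linarith
    then obtain v q r where "0 < q" "q \<le> int p ^ (n * T l)"
      "\<And>i. i < n \<Longrightarrow> \<bar>r i\<bar> \<le> int p ^ (n * T l) \<and> 0 \<le> v i \<and> v i < int p ^ (b (Suc l) - b l) \<and>
        [q * v i = r i] (mod int p ^ (b (Suc l) - b l)) \<and> [v i = u i] (mod int p ^ ((n + 1) * T l - 3 * n))"
      by (rule rational_residues_lift[OF p n u]) blast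
    then have "P l u (v, r, q)" unfolding P_def by blast
    then show ?thesis unfolding h_def by (rule someI)
  qed
  interpret Cantor_tree p n b T "\<lambda>l u. fst (h l u)" "\<lambda>l u. fst (snd (h l u))" "\<lambda>l u. snd (snd (h l u))"
  proof
    show "b 0 = 1" by (simp add: b_def)
    show "b l + ((n + 1) * T l - 3 * n) \<le> b (Suc l)" for l using R[of l] by blast
  qed (use p n R h in \<open>auto simp: P_def case_prod_unfold\<close>)
  have \<tau>1: "\<tau> \<ge> 1" using \<tau> by (smt (verit) divide_nonneg_nonneg of_nat_0_le_iff)
  have "s \<le> real n"
  proof -
    have "real n * (1 + 1 / real n) \<le> real n * \<tau>" using \<tau> by (intro mult_left_mono) auto
    moreover have "real n * (1 + 1 / real n) = real n + 1" using n by (simp add: field_simps)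
    ultimately have "(real n + 1) / \<tau> \<le> real n" using \<tau>1 by (simp add: pos_divide_le_eq)
    then show ?thesis using s by linarith
  qed
  then show ?thesis using \<tau>1 s R by (intro hausdorff_measure_neq_0) auto
qed

theorem theorem3:
  fixes p n :: nat and \<tau> :: real
  assumes "prime p" and "n \<ge> 1"
  shows "(\<tau> > 1 + 1 / real n \<longrightarrow>
            padic_hausdorff_dim p n (W_star p n \<tau>) = ereal ((real n + 1) / \<tau>)) \<and>
         (\<tau> \<ge> 1 \<longrightarrow> W_star p n \<tau> \<inter> Zp_vec p n = {})"
proof (intro conjI impI)
  assume \<tau>: "\<tau> > 1 + 1 / real n"
  interpret Metric_space "Qp_vec p n" "padic_vec_dist p n" by (rule Metric_space_Qp_vec[OF assms])
  let ?W = "W_star p n \<tau>" and ?c = "(real n + 1) / \<tau>"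
  have \<tau>1: "\<tau> > 1" using \<tau> assms(2) by (smt (verit) divide_pos_pos of_nat_0_less_iff not_one_le_zero gr0I)
  have c: "?c > 0" using \<tau>1 by simp
  show "hausdorff_dim ?W = ereal ?c"
  proof (rule antisym)
    show "hausdorff_dim ?W \<le> ereal ?c"
    proof (rule ereal_le_epsilon2)
      fix e :: real assume e: "e > 0"
      then have "hausdorff_measure (?c + e) ?W = 0"
        by (intro hausdorff_measure_W_star_eq_0[OF assms \<tau>1]) simp
      then show "hausdorff_dim ?W \<le> ereal ?c + ereal e"
        unfolding hausdorff_dim_def using c e by (intro Inf_lower) (auto intro!: exI[of _ "?c + e"])
    qed
    show "ereal ?c \<le> hausdorff_dim ?W"
      unfolding hausdorff_dim_def
    proof (rule Inf_greatest)
      fix z assume "z \<in> {ereal s |s. s \<ge> 0 \<and> hausdorff_measure s ?W = 0}"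
      then obtain s where s: "z = ereal s" "s \<ge> 0" "hausdorff_measure s ?W = 0" by blast
      \<comment> \<open>One positive exponent below the critical one shows that the set is nonempty,
        because the empty set is null by the Cantelli lemma with an empty family. This in turn
        excludes s = 0.\<close>
      have "hausdorff_measure (?c / 2) ?W \<noteq> 0"
        using c by (intro hausdorff_measure_W_star_neq_0 assms \<tau>) auto
      then have "?W \<noteq> {}"
        using hausdorff_measure_Cantelli[of "?c / 2" "{} :: nat set" "\<lambda>_ _. {}" "\<lambda>_ _. 0" "{}"] c by auto
      then have "s \<noteq> 0" using s(3) hausdorff_measure_0_pos by blast
      then have "?c \<le> s" using s hausdorff_measure_W_star_neq_0[OF assms \<tau>, of s] by force
      then show "ereal ?c \<le> z" by (simp add: s)
    qed
  qed
next
  assume "\<tau> \<ge> 1"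
  then show "W_star p n \<tau> \<inter> Zp_vec p n = {}" by (rule W_star_Zp_vec[OF assms])
qed

end
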